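(* Let $L=3^8\,2^{3(n+1)+2}\lambda=O(2^{3n}\lambda)$. The verifiable tomography scheme $(\mathsf{Tomography},\mathsf{Verify})$ described in the context satisfies $(L,\mathcal D_{P_x,x,b})$-distributional same-input correctness for all $n$-qubit Paulis $P_x$, all $x\in\{0,1\}^{d}$ and all $b\in\{0,1\}$; that is, $$\Pr_{k\leftarrow\{0,1\}^\lambda}\left[\mathsf{Verify}\left((P_x,k,x,b),\ \mathsf{Tomography}\left(\Phi_\lambda(P_x,k,x,b)^{\otimes L}\right)\right)=\mathsf{Valid}\right]\ge1-\mathrm{negl}(\lambda).$$
   Context: PRFS. A QPT algorithm $G$ is a (selectively secure) $(d,n)$-PRFS generator if $G_\lambda(k,x)$, for $k\in\{0,1\}^\lambda,x\in\{0,1\}^{d(\lambda)}$, is an $n(\lambda)$-qubit state, and for all polynomials $s,t$, all non-uniform QPT distinguishers $A$ (polynomial-size quantum circuits with quantum advice) and all families of sets of inputs $\{x_1,\dots,x_{s(\lambda)}\}\subseteq\{0,1\}^{d(\lambda)}$ there is a negligible $\varepsilon$ such that $A_\lambda$, given $x_1,\dots,x_s$, distinguishes $G_\lambda(k,x_1)^{\otimes t},\dots,G_\lambda(k,x_s)^{\otimes t}$ (for uniform $k$) from $|\vartheta_1\rangle^{\otimes t},\dots,|\vartheta_s\rangle^{\otimes t}$ (for independent Haar-random $n$-qubit states) with advantage at most $\varepsilon(\lambda)$. $G$ has the recognizable abort property if there are a QPT algorithm $\widehat G$ and an $(n+1)$-qubit state $|\bot\rangle=|1\rangle|\widehat\bot\rangle$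 such that $\widehat G_\lambda(k,x)=\eta_{k,x}|0\rangle\langle0|\otimes|\psi_{k,x}\rangle\langle\psi_{k,x}|+(1-\eta_{k,x})|\bot\rangle\langle\bot|$ with $\eta_{k,x}\in[0,1]$, $|\psi_{k,x}\rangle$ an $n$-qubit pure state, and $G_\lambda(k,x)$ is obtained from it by tracing out the first qubit. Setting. $d(\lambda)=\lceil\log\lambda/\log\log\lambda\rceil$, $n(\lambda)=\lceil3\log_2\lambda\rceil$, and $G$ is a $(d,n)$-PRFS generator with recognizable abort. $n$-qubit Paulis are tensor products of $I,X,Y,Z$. For an $n$-qubit Pauli $P_x$, $k\in\{0,1\}^\lambda$, $x\in\{0,1\}^d$, $b\in\{0,1\}$, let $\Phi_\lambda(P_x,k,x,b)=(I\otimes P_x^b)\,\widehat G_\lambda(k,x)\,(I\otimes P_x^b)$. $\mathcal D_{P_x,x,b}$ samples $k\leftarrow\{0,1\}^\lambda$ uniformly and outputs $(P_x,k,x,b)$. Tomography. $\mathcal T$ is a tomography procedure that given $sN^2$ copies of an $N$-dimensional density matrix $\rho$ outputs a matrix $M$ with $\mathbb E\|M-\rho\|_F^2\le N/s$ (such a procedure exists). $\mathcal T_{\rm imp}$, given $4sN^2\lambda$ copies of $\rho$, runs $\mathcal T(\rho^{\otimes4sN^2})$ independently $\lambda$ times to get $M_1,\dots,M_\lambda$ and outputs some $M_{i^*}$ with $|\{j:\|M_j-M_{i^*}\|_F^2\le4N/s\}|>\lambda/2$, or a failure symbol if none exists. $\mathsf{Tomography}(\rho^{\otimes L})=\mathcal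 T_{\rm imp}(\rho^{\otimes L})$ with $N=2^{n+1}$, $s=3^82^{n+1}$. $\mathsf{Verify}(\mathbf x,M)$: compute $\widehat M\leftarrow\mathsf{Tomography}(\Phi_\lambda(\mathbf x)^{\otimes L})$; output $\mathsf{Invalid}$ if $\langle\bot|M|\bot\rangle>\frac19$; otherwise output $\mathsf{Valid}$ if $\|M-\widehat M\|_F^2\le\frac4{729}$ and $\mathsf{Invalid}$ otherwise (also $\mathsf{Invalid}$ upon failure symbols). $\|\cdot\|_F$ is the Frobenius norm. *)

theory Defs
  imports
    "HOL-Probability.Probability"
    "HOL-Library.Landau_Symbols"
    "Jordan_Normal_Form.Schur_Decomposition"
begin

unbundle no vec_syntax

section \<open>Asymptotics\<close>

definition poly_bounded :: "(nat \<Rightarrow> nat) \<Rightarrow> bool" where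
  "poly_bounded f \<longleftrightarrow> (\<exists>p :: nat poly. \<forall>l. f l \<le> poly p l)"

definition negligible :: "(nat \<Rightarrow> real) \<Rightarrow> bool" where
  "negligible \<epsilon> \<longleftrightarrow> (\<forall>c :: nat. \<epsilon> \<in> O(\<lambda>l. 1 / real l ^ c))"

section \<open>Finite-dimensional quantum states\<close>

text \<open>Matrices and vectors are those of \<open>Jordan_Normal_Form\<close>. An \<open>m\<close>-qubit register has dimension
  \<open>2 ^ m\<close>; the left tensor factor (the first qubit) is the most significant digit of an index.\<close>

definition kron :: "complex mat \<Rightarrow> complex mat \<Rightarrow> complex mat" (infixl \<open>\<otimes>\<^sub>K\<close> 70) where
  "A \<otimes>\<^sub>K B = mat (dim_row A * dim_row B) (dim_col A * dim_col B)
     (\<lambda>(i, j). A $$ (i div dim_row B, j div dim_col B) * B $$ (i mod dim_row B, j mod dim_col B))"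

definition kron_list :: "complex mat list \<Rightarrow> complex mat" where
  "kron_list As = foldr (\<otimes>\<^sub>K) As (1\<^sub>m 1)"

definition tensor_power :: "complex mat \<Rightarrow> nat \<Rightarrow> complex mat" where
  "tensor_power \<rho> m = kron_list (replicate m \<rho>)"

definition kron_vec :: "complex vec \<Rightarrow> complex vec \<Rightarrow> complex vec" where
  "kron_vec v w = vec (dim_vec v * dim_vec w) (\<lambda>i. v $ (i div dim_vec w) * w $ (i mod dim_vec w))"

text \<open>\<open>outer v\<close> is $|v\rangle\langle v|$ and \<open>expval A v\<close> is $\langle v|A|v\rangle$.\<close>

definition outer :: "complex vec \<Rightarrow> complex mat" where
  "outer v = mat (dim_vec v) (dim_vec v) (\<lambda>(i, j). v $ i * cnj (v $ j))"

definition expval :: "complex mat \<Rightarrow> complex vec \<Rightarrow> complex" where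
  "expval A v = (A *\<^sub>v v) \<bullet>c v"

definition mtrace :: "complex mat \<Rightarrow> complex" where
  "mtrace A = (\<Sum>i<dim_row A. A $$ (i, i))"

definition unit_state :: "nat \<Rightarrow> complex vec \<Rightarrow> bool" where
  "unit_state N v \<longleftrightarrow> v \<in> carrier_vec N \<and> v \<bullet>c v = 1"

definition unitary_mat :: "nat \<Rightarrow> complex mat \<Rightarrow> bool" where
  "unitary_mat N U \<longleftrightarrow> U \<in> carrier_mat N N \<and> mat_adjoint U * U = 1\<^sub>m N \<and> U * mat_adjoint U = 1\<^sub>m N"

text \<open>In the order on \<open>complex\<close>, \<open>0 \<le> z\<close> means that \<open>z\<close> is real and nonnegative, so
  \<open>psd_mat\<close> implies Hermitian.\<close>

definition psd_mat :: "nat \<Rightarrow> complex mat \<Rightarrow> bool" where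
  "psd_mat N A \<longleftrightarrow> A \<in> carrier_mat N N \<and> (\<forall>v \<in> carrier_vec N. 0 \<le> expval A v)"

definition density_mat :: "nat \<Rightarrow> complex mat \<Rightarrow> bool" where
  "density_mat N \<rho> \<longleftrightarrow> psd_mat N \<rho> \<and> mtrace \<rho> = 1"

definition ptrace_first :: "nat \<Rightarrow> nat \<Rightarrow> complex mat \<Rightarrow> complex mat" where
  "ptrace_first a b \<rho> = mat b b (\<lambda>(i, j). \<Sum>k<a. \<rho> $$ (k * b + i, k * b + j))"

definition ptrace_second :: "nat \<Rightarrow> nat \<Rightarrow> complex mat \<Rightarrow> complex mat" where
  "ptrace_second a b \<rho> = mat a a (\<lambda>(i, j). \<Sum>k<b. \<rho> $$ (i * b + k, j * b + k))"

definition frob_norm :: "complex mat \<Rightarrow> real" where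
  "frob_norm A = sqrt (\<Sum>i<dim_row A. \<Sum>j<dim_col A. (cmod (A $$ (i, j)))\<^sup>2)"

definition basis_state :: "bool list \<Rightarrow> complex mat" where
  "basis_state bs = kron_list (map (\<lambda>b. outer (unit_vec 2 (if b then 1 else 0))) bs)"

datatype pauli = PauliI | PauliX | PauliY | PauliZ

fun pauli_mat1 :: "pauli \<Rightarrow> complex mat" where
  "pauli_mat1 PauliI = 1\<^sub>m 2"
| "pauli_mat1 PauliX = mat_of_rows_list 2 [[0, 1], [1, 0]]"
| "pauli_mat1 PauliY = mat_of_rows_list 2 [[0, - \<i>], [\<i>, 0]]"
| "pauli_mat1 PauliZ = mat_of_rows_list 2 [[1, 0], [0, - 1]]"

definition pauli_mat :: "pauli list \<Rightarrow> complex mat" where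
  "pauli_mat P = kron_list (map pauli_mat1 P)"

section \<open>Haar-random states\<close>

definition vec_borel :: "nat \<Rightarrow> complex vec measure" where
  "vec_borel N = sigma (carrier_vec N)
     {{v \<in> carrier_vec N. v $ i \<in> B} | i B. i < N \<and> B \<in> sets borel}"

text \<open>The Haar measure on \<open>N\<close>-dimensional states is the (unique) unitarily invariant Borel
  probability measure on the unit sphere.\<close>

definition is_haar_measure :: "nat \<Rightarrow> complex vec measure \<Rightarrow> bool" where
  "is_haar_measure N \<mu> \<longleftrightarrow>
     prob_space \<mu> \<and> sets \<mu> = sets (vec_borel N) \<and> (AE v in \<mu>. unit_state N v) \<and>
     (\<forall>U. unitary_mat N U \<longrightarrow> distr \<mu> (vec_borel N) (\<lambda>v. U *\<^sub>v v) = \<mu>)"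

section \<open>Quantum circuits\<close>

text \<open>Circuits over the universal gate set $\{H, T, \mathrm{CNOT}\}$. The input occupies the first
  \<open>c_in\<close> wires, the following \<open>c_anc\<close> wires are initialised to zero, and at the end all but the
  first \<open>c_out\<close> wires are traced out.\<close>

datatype gate = Hadamard nat | TGate nat | CNot (control: nat) (target: nat)

record circuit =
  c_in :: nat
  c_anc :: nat
  c_gates :: "gate list"
  c_out :: nat

definition on_wire :: "nat \<Rightarrow> nat \<Rightarrow> complex mat \<Rightarrow> complex mat" where
  "on_wire m w A = 1\<^sub>m (2 ^ w) \<otimes>\<^sub>K A \<otimes>\<^sub>K 1\<^sub>m (2 ^ (m - w - 1))"

fun gate_mat :: "nat \<Rightarrow> gate \<Rightarrow> complex mat" where
  "gate_mat m (Hadamard w) =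
     on_wire m w (complex_of_real (1 / sqrt 2) \<cdot>\<^sub>m mat_of_rows_list 2 [[1, 1], [1, - 1]])"
| "gate_mat m (TGate w) = on_wire m w (mat_of_rows_list 2 [[1, 0], [0, cis (pi / 4)]])"
| "gate_mat m (CNot c t) =
     on_wire m c (outer (unit_vec 2 0)) +
     on_wire m c (outer (unit_vec 2 1)) * on_wire m t (pauli_mat1 PauliX)"

fun gate_wf :: "nat \<Rightarrow> gate \<Rightarrow> bool" where
  "gate_wf m (Hadamard w) \<longleftrightarrow> w < m"
| "gate_wf m (TGate w) \<longleftrightarrow> w < m"
| "gate_wf m (CNot c t) \<longleftrightarrow> c < m \<and> t < m \<and> c \<noteq> t"

definition c_wires :: "circuit \<Rightarrow> nat" where
  "c_wires C = c_in C + c_anc C"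

definition circuit_wf :: "circuit \<Rightarrow> bool" where
  "circuit_wf C \<longleftrightarrow> (\<forall>g \<in> set (c_gates C). gate_wf (c_wires C) g) \<and> c_out C \<le> c_wires C"

definition circuit_size :: "circuit \<Rightarrow> nat" where
  "circuit_size C = length (c_gates C) + c_wires C + c_out C"

definition circuit_unitary :: "circuit \<Rightarrow> complex mat" where
  "circuit_unitary C =
     foldl (\<lambda>U g. gate_mat (c_wires C) g * U) (1\<^sub>m (2 ^ c_wires C)) (c_gates C)"

definition run_circuit :: "circuit \<Rightarrow> complex mat \<Rightarrow> complex mat" where
  "run_circuit C \<sigma> =
     ptrace_second (2 ^ c_out C) (2 ^ (c_wires C - c_out C))
       (circuit_unitary C * (\<sigma> \<otimes>\<^sub>K basis_state (replicate (c_anc C) False))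
          * mat_adjoint (circuit_unitary C))"

section \<open>Uniform QPT algorithms\<close>

text \<open>Deterministic Turing machines with one one-way infinite tape, given by a transition function on
  states \<open>{..<Q}\<close> and symbols \<open>{..<K}\<close>. State 0 is initial, state 1 is halting, symbol 0 is the
  blank. A left move on the first cell leaves the head where it is.\<close>

datatype move = MoveLeft | MoveStay | MoveRight

type_synonym tm = "nat \<Rightarrow> nat \<Rightarrow> nat \<times> nat \<times> move"

definition tm_wf :: "tm \<Rightarrow> bool" where
  "tm_wf \<delta> \<longleftrightarrow> (\<exists>Q K. 2 \<le> Q \<and> 3 \<le> K \<and>
     (\<forall>q<Q. \<forall>a<K. fst (\<delta> q a) < Q \<and> fst (snd (\<delta> q a)) < K))"

fun tm_step :: "tm \<Rightarrow> nat \<times> (nat \<Rightarrow> nat) \<times> nat \<Rightarrow> nat \<times> (nat \<Rightarrow> nat) \<times> nat" where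
  "tm_step \<delta> (q, tape, h) =
     (if q = 1 then (q, tape, h)
      else case \<delta> q (tape h) of (q', a, mv) \<Rightarrow>
        (q', tape(h := a),
         case mv of MoveLeft \<Rightarrow> h - 1 | MoveStay \<Rightarrow> h | MoveRight \<Rightarrow> h + 1))"

definition word_tape :: "nat list \<Rightarrow> nat \<Rightarrow> nat" where
  "word_tape w = (\<lambda>i. if i < length w then w ! i else 0)"

text \<open>\<open>f\<close> is computable from the unary input $1^l$ in time polynomial in \<open>l\<close>.\<close>

definition poly_time_unary :: "(nat \<Rightarrow> nat list) \<Rightarrow> bool" where
  "poly_time_unary f \<longleftrightarrow>
     (\<exists>\<delta> (p :: nat poly). tm_wf \<delta> \<and>
        (\<forall>l. \<exists>h. (tm_step \<delta> ^^ poly p l) (0, word_tape (replicate l 1), 0) = (1, word_tape (f l), h)))"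

fun gate_code :: "gate \<Rightarrow> nat list" where
  "gate_code (Hadamard w) = [0, w]"
| "gate_code (TGate w) = [1, w]"
| "gate_code (CNot c t) = [2, c, t]"

text \<open>A circuit is described by a word over the symbols 1 and 2: each number in its description is
  written in unary and terminated by a 2.\<close>

definition circuit_code :: "circuit \<Rightarrow> nat list" where
  "circuit_code C =
     concat (map (\<lambda>i. replicate i 1 @ [2])
       ([c_in C, c_anc C, c_out C] @ concat (map gate_code (c_gates C))))"

definition poly_size :: "(nat \<Rightarrow> circuit) \<Rightarrow> bool" where
  "poly_size C \<longleftrightarrow> (\<forall>l. circuit_wf (C l)) \<and> poly_bounded (\<lambda>l. circuit_size (C l))"

definition QPT :: "(nat \<Rightarrow> circuit) \<Rightarrow> bool" where
  "QPT C \<longleftrightarrow> poly_size C \<and> poly_time_unary (\<lambda>l. circuit_code (C l))"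

text \<open>\<open>G l k x\<close> is the \<open>m l\<close>-qubit output state of a QPT algorithm on the classical input \<open>(k, x)\<close>.\<close>

definition QPT_generator ::
  "(nat \<Rightarrow> nat) \<Rightarrow> (nat \<Rightarrow> nat) \<Rightarrow> (nat \<Rightarrow> bool list \<Rightarrow> bool list \<Rightarrow> complex mat) \<Rightarrow> bool" where
  "QPT_generator d m G \<longleftrightarrow>
     (\<exists>C. QPT C \<and>
        (\<forall>l. c_in (C l) = l + d l \<and> c_out (C l) = m l \<and>
           (\<forall>k x. length k = l \<longrightarrow> length x = d l \<longrightarrow>
              G l k x = run_circuit (C l) (basis_state (k @ x)))))"

section \<open>Pseudorandom function-like states\<close>

text \<open>Probability that the distinguisher circuit \<open>C\<close>, whose output is one qubit, returns 1 on the
  strings \<open>xs\<close>, the states \<open>\<sigma>s\<close> and the advice \<open>a\<close>.\<close>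

definition accept_prob :: "circuit \<Rightarrow> bool list list \<Rightarrow> complex mat list \<Rightarrow> complex mat \<Rightarrow> real" where
  "accept_prob C xs \<sigma>s a =
     Re (run_circuit C (basis_state (concat xs) \<otimes>\<^sub>K kron_list \<sigma>s \<otimes>\<^sub>K a) $$ (1, 1))"

definition uniform_bits :: "nat \<Rightarrow> bool list pmf" where
  "uniform_bits m = pmf_of_set {k. length k = m}"

definition PRFS_secure ::
  "(nat \<Rightarrow> complex vec measure) \<Rightarrow> (nat \<Rightarrow> nat) \<Rightarrow> (nat \<Rightarrow> nat)
     \<Rightarrow> (nat \<Rightarrow> bool list \<Rightarrow> bool list \<Rightarrow> complex mat) \<Rightarrow> bool" where
  "PRFS_secure haar d n G \<longleftrightarrow>
     (\<forall>s t X A q a.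
        poly_bounded s \<longrightarrow> poly_bounded t \<longrightarrow>
        (\<forall>l. length (X l) = s l \<and> distinct (X l) \<and> (\<forall>x \<in> set (X l). length x = d l)) \<longrightarrow>
        poly_size A \<longrightarrow>
        (\<forall>l. c_in (A l) = s l * d l + s l * t l * n l + q l \<and> c_out (A l) = 1 \<and>
           density_mat (2 ^ q l) (a l)) \<longrightarrow>
        (\<exists>\<epsilon>. negligible \<epsilon> \<and>
           (\<forall>l. \<bar>measure_pmf.expectation (uniform_bits l)
                    (\<lambda>k. accept_prob (A l) (X l)
                      (map (\<lambda>x. tensor_power (G l k x) (t l)) (X l)) (a l))
                 - (\<integral>\<theta>. accept_prob (A l) (X l)
                      (map (\<lambda>i. tensor_power (outer (\<theta> i)) (t l)) [0..<s l]) (a l)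
                      \<partial>(\<Pi>\<^sub>M i\<in>{..<s l}. haar (2 ^ n l)))\<bar> \<le> \<epsilon> l)))"

definition PRFS_generator ::
  "(nat \<Rightarrow> complex vec measure) \<Rightarrow> (nat \<Rightarrow> nat) \<Rightarrow> (nat \<Rightarrow> nat)
     \<Rightarrow> (nat \<Rightarrow> bool list \<Rightarrow> bool list \<Rightarrow> complex mat) \<Rightarrow> bool" where
  "PRFS_generator haar d n G \<longleftrightarrow> QPT_generator d n G \<and> PRFS_secure haar d n G"

definition bot_state :: "complex vec \<Rightarrow> complex vec" where
  "bot_state bh = kron_vec (unit_vec 2 1) bh"

definition recognizable_abort ::
  "(nat \<Rightarrow> nat) \<Rightarrow> (nat \<Rightarrow> nat) \<Rightarrow> (nat \<Rightarrow> bool list \<Rightarrow> bool list \<Rightarrow> complex mat)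
     \<Rightarrow> (nat \<Rightarrow> bool list \<Rightarrow> bool list \<Rightarrow> complex mat) \<Rightarrow> (nat \<Rightarrow> complex vec) \<Rightarrow> bool" where
  "recognizable_abort d n G Ghat bothat \<longleftrightarrow>
     QPT_generator d (\<lambda>l. n l + 1) Ghat \<and>
     (\<forall>l. unit_state (2 ^ n l) (bothat l)) \<and>
     (\<forall>l k x. length k = l \<longrightarrow> length x = d l \<longrightarrow>
        (\<exists>\<eta> \<psi>. 0 \<le> \<eta> \<and> \<eta> \<le> 1 \<and> unit_state (2 ^ n l) \<psi> \<and>
           Ghat l k x =
             complex_of_real \<eta> \<cdot>\<^sub>m (outer (unit_vec 2 0) \<otimes>\<^sub>K outer \<psi>) +
             complex_of_real (1 - \<eta>) \<cdot>\<^sub>m outer (bot_state (bothat l))) \<and>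
        G l k x = ptrace_first 2 (2 ^ n l) (Ghat l k x))"

section \<open>Tomography\<close>

text \<open>A quantum measurement of a \<open>D\<close>-dimensional system with outcomes in \<open>'a\<close>: outcome statistics
  follow the Born rule for some positive operators. That these sum to the identity is implied by
  every \<open>f \<sigma>\<close> being a probability distribution.\<close>

definition quantum_measurement :: "nat \<Rightarrow> (complex mat \<Rightarrow> 'a pmf) \<Rightarrow> bool" where
  "quantum_measurement D f \<longleftrightarrow>
     (\<exists>E. (\<forall>a. psd_mat D (E a)) \<and>
        (\<forall>\<sigma> a. density_mat D \<sigma> \<longrightarrow> complex_of_real (pmf (f \<sigma>) a) = mtrace (E a * \<sigma>)))"

text \<open>\<open>T s N\<close> acts on states of \<open>s * N\<^sup>2\<close> systems of dimension \<open>N\<close>.\<close>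

definition tomography_procedure :: "(nat \<Rightarrow> nat \<Rightarrow> complex mat \<Rightarrow> complex mat pmf) \<Rightarrow> bool" where
  "tomography_procedure T \<longleftrightarrow>
     (\<forall>s N. 0 < s \<longrightarrow> 0 < N \<longrightarrow>
        quantum_measurement (N ^ (s * N\<^sup>2)) (T s N) \<and>
        (\<forall>\<rho>. density_mat N \<rho> \<longrightarrow>
           set_pmf (T s N (tensor_power \<rho> (s * N\<^sup>2))) \<subseteq> carrier_mat N N \<and>
           (\<integral>\<^sup>+M. ennreal ((frob_norm (M - \<rho>))\<^sup>2) \<partial>measure_pmf (T s N (tensor_power \<rho> (s * N\<^sup>2))))
             \<le> ennreal (real N / real s)))"

definition good_index :: "nat \<Rightarrow> nat \<Rightarrow> nat \<Rightarrow> complex mat list \<Rightarrow> nat \<Rightarrow> bool" where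
  "good_index s N l Ms i \<longleftrightarrow> i < l \<and>
     real (card {j. j < l \<and> (frob_norm (Ms ! j - Ms ! i))\<^sup>2 \<le> 4 * real N / real s}) > real l / 2"

definition select_output :: "nat \<Rightarrow> nat \<Rightarrow> nat \<Rightarrow> complex mat list \<Rightarrow> complex mat option" where
  "select_output s N l Ms =
     (if \<exists>i. good_index s N l Ms i then Some (Ms ! (SOME i. good_index s N l Ms i)) else None)"

text \<open>The procedure \<open>T_imp\<close> on the input $\rho^{\otimes L}$, passed as \<open>\<rho>\<close> and \<open>L\<close>. It is meant for
  \<open>L = 4 * s * N\<^sup>2 * l\<close> and fails on any other number of copies; \<open>None\<close> is the failure symbol.\<close>

definition T_imp ::
  "(nat \<Rightarrow> nat \<Rightarrow> complex mat \<Rightarrow> complex mat pmf) \<Rightarrow> nat \<Rightarrow> nat \<Rightarrow> nat \<Rightarrow> complex mat \<Rightarrow> nat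
     \<Rightarrow> complex mat option pmf" where
  "T_imp T s N l \<rho> L =
     (if L = 4 * s * N\<^sup>2 * l
      then map_pmf (select_output s N l)
             (replicate_pmf l (T (4 * s) N (tensor_power \<rho> (4 * s * N\<^sup>2))))
      else return_pmf None)"

definition Tomography ::
  "(nat \<Rightarrow> nat \<Rightarrow> complex mat \<Rightarrow> complex mat pmf) \<Rightarrow> (nat \<Rightarrow> nat) \<Rightarrow> nat \<Rightarrow> complex mat \<Rightarrow> nat
     \<Rightarrow> complex mat option pmf" where
  "Tomography T n l \<rho> L = T_imp T (3 ^ 8 * 2 ^ (n l + 1)) (2 ^ (n l + 1)) l \<rho> L"

section \<open>The verifiable tomography scheme\<close>

type_synonym input = "pauli list \<times> bool list \<times> bool list \<times> bool"

fun Phi :: "(nat \<Rightarrow> bool list \<Rightarrow> bool list \<Rightarrow> complex mat) \<Rightarrow> nat \<Rightarrow> input \<Rightarrow> complex mat" where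
  "Phi Ghat l (P, k, x, b) =
     (let V = 1\<^sub>m 2 \<otimes>\<^sub>K (if b then pauli_mat P else 1\<^sub>m (2 ^ length P))
      in V * Ghat l k x * V)"

datatype verdict = Valid | Invalid

definition Verify ::
  "(nat \<Rightarrow> nat \<Rightarrow> complex mat \<Rightarrow> complex mat pmf) \<Rightarrow> (nat \<Rightarrow> nat)
     \<Rightarrow> (nat \<Rightarrow> bool list \<Rightarrow> bool list \<Rightarrow> complex mat) \<Rightarrow> (nat \<Rightarrow> complex vec) \<Rightarrow> (nat \<Rightarrow> nat)
     \<Rightarrow> nat \<Rightarrow> input \<Rightarrow> complex mat option \<Rightarrow> verdict pmf" where
  "Verify T n Ghat bothat L l inp Mo =
     map_pmf (\<lambda>Mo'. case (Mo, Mo') of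
         (Some M, Some Mhat) \<Rightarrow>
           (if Re (expval M (bot_state (bothat l))) > 1 / 9 then Invalid
            else if (frob_norm (M - Mhat))\<^sup>2 \<le> 4 / 729 then Valid
            else Invalid)
       | _ \<Rightarrow> Invalid)
       (Tomography T n l (Phi Ghat l inp) (L l))"

definition input_dist :: "(nat \<Rightarrow> pauli list) \<Rightarrow> (nat \<Rightarrow> bool list) \<Rightarrow> (nat \<Rightarrow> bool) \<Rightarrow> nat \<Rightarrow> input pmf" where
  "input_dist P x b l = map_pmf (\<lambda>k. (P l, k, x l, b l)) (uniform_bits l)"

text \<open>\<open>(L, D)\<close>-distributional same-input correctness of a scheme \<open>(tomo, verify)\<close> for the channel
  family \<open>\<Phi>\<close>; \<open>tomo l \<rho> m\<close> is the tomography algorithm run on $\rho^{\otimes m}$.\<close>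

definition distributional_same_input_correctness ::
  "(nat \<Rightarrow> 'x \<Rightarrow> complex mat) \<Rightarrow> (nat \<Rightarrow> complex mat \<Rightarrow> nat \<Rightarrow> complex mat option pmf)
     \<Rightarrow> (nat \<Rightarrow> 'x \<Rightarrow> complex mat option \<Rightarrow> verdict pmf) \<Rightarrow> (nat \<Rightarrow> nat) \<Rightarrow> (nat \<Rightarrow> 'x pmf) \<Rightarrow> bool" where
  "distributional_same_input_correctness \<Phi> tomo verify L D \<longleftrightarrow>
     (\<exists>\<epsilon>. negligible \<epsilon> \<and>
        (\<forall>l. pmf (bind_pmf (D l) (\<lambda>inp.
                  bind_pmf (tomo l (\<Phi> l inp) (L l)) (\<lambda>M.
                  verify l inp M))) Valid \<ge> 1 - \<epsilon> l))"

text \<open>For the finitely many \<open>l\<close> where the quotient is undefined, the values are irrelevant.\<close>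

definition d_len :: "nat \<Rightarrow> nat" where
  "d_len l = nat \<lceil>log 2 (real l) / log 2 (log 2 (real l))\<rceil>"

definition n_len :: "nat \<Rightarrow> nat" where
  "n_len l = nat \<lceil>3 * log 2 (real l)\<rceil>"

end

theory Submission
  imports Defs "HOL-Real_Asymp.Real_Asymp"
begin

text \<open>
  Every \<open>n\<close>-qubit operator is a combination of \<open>4 ^ n\<close> Pauli strings, and \<open>4 ^ (n * t)\<close> is polynomial
  for constant \<open>t\<close> because \<open>n = O(log \<lambda>)\<close>. A distinguisher that measures one fixed Pauli string
  therefore suffices: choosing the worst string non-uniformly for each \<open>\<lambda>\<close>, PRFS security forces
  $\mathbb E_k\,G(k,x)^{\otimes t}$ and $\mathbb E\,|\vartheta\rangle\langle\vartheta|^{\otimes t}$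
  to agree entrywise up to a negligible error, hence also to give almost the same expectation to
  $|\widehat\bot\rangle\langle\widehat\bot|^{\otimes t}$. For Haar-random states this expectation is
  $O_t(2^{-nt})$ (move $\widehat\bot$ to a uniformly random sign vector by unitary invariance and
  use Khintchine's inequality), while for \<open>G\<close> it is at least $\mathbb E_k(1-\eta_{k,x})^t$. By
  Markov's inequality, $1-\eta_{k,x}>\frac2{27}$ has probability $O(\lambda^{-3t})$ for every \<open>t\<close>.

  For the remaining keys $\langle\bot|\Phi|\bot\rangle\le1-\eta_{k,x}\le\frac2{27}$, because Paulis
  on the last \<open>n\<close> qubits preserve the first one. The majority selection amplifies Markov's inequality
  for the tomography to Frobenius error $\frac1{27}$ with exponentially small failure probability.
  Two such estimates differ by at most $\frac2{27}$, and
  $\langle\bot|M|\bot\rangle\le\frac2{27}+\frac1{27}=\frac19$.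
\<close>

text \<open>No circuit for measuring along \<open>bothat l\<close> is among the hypotheses, whereas
  a Pauli string can be measured exactly with H, T and CNOT gates. The vector \<open>bothat\<close>
  therefore enters only afterwards, through linear algebra on averaged states. The price is a factor
  \<open>4 ^ (n * t)\<close>, which has order l^(6t) and is absorbed by a negligible advantage once
  \<open>t\<close> is fixed.

  Circuits are analysed in the Heisenberg picture: the states given to the distinguisher are
  arbitrary, but the observable, which starts as Z on the output wire, remains a Kronecker product
  of 2x2 matrices at every stage.

  A single \<open>t\<close> yields only an inverse polynomial bound, because the Haar moment itself
  has order 2^(-nt). So \<open>t\<close> has to follow the exponent demanded by negligibility, and
  each \<open>t\<close> brings its own negligible function. Taking the failure probability itself as
  the final witness avoids having to merge these functions into one.\<close>

section \<open>Composite indices and adjoints\<close>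

text \<open>An index \<open>k\<close> of a Kronecker product encodes the pair
  (\<open>k div b\<close>, \<open>k mod b\<close>). Cutting the range into blocks of length
  \<open>b\<close> turns every sum over such an index into a double sum, which is how all product
  rules below factor.\<close>

lemma sum_div_mod:
  fixes f :: "nat \<Rightarrow> nat \<Rightarrow> 'a::comm_monoid_add"
  shows "(\<Sum>k<a * b. f (k div b) (k mod b)) = (\<Sum>i<a. \<Sum>j<b. f i j)"
proof -
  have "(\<Sum>i<a. \<Sum>j<b. f i j) = (\<Sum>i<a. sum (\<lambda>k. f (k div b) (k mod b)) {i * b..<i * b + b})"
  proof (rule sum.cong[OF refl])
    fix i assume "i \<in> {..<a}"
    show "(\<Sum>j<b. f i j) = sum (\<lambda>k. f (k div b) (k mod b)) {i * b..<i * b + b}"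
      by (subst sum.atLeastLessThan_shift_0) (auto simp: lessThan_atLeast0 intro!: sum.cong)
  qed
  also have "\<dots> = (\<Sum>k<a * b. f (k div b) (k mod b))"
    by (rule sum.nat_group)
  finally show ?thesis by simp
qed

lemma mod_less_of_less_mult: "i < a * b \<Longrightarrow> i mod b < (b :: nat)"
  by (cases "b = 0") auto

lemma dim_mat_adjoint [simp]: "dim_row (mat_adjoint A) = dim_col A" "dim_col (mat_adjoint A) = dim_row A"
  by (auto simp: mat_adjoint_def)

lemma index_mat_adjoint [simp]:
  fixes A :: "complex mat"
  shows "i < dim_col A \<Longrightarrow> j < dim_row A \<Longrightarrow> mat_adjoint A $$ (i, j) = cnj (A $$ (j, i))"
  by (simp add: mat_adjoint_def mat_of_rows_def)

lemma mat_adjoint_carrier [simp, intro]: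
  "A \<in> carrier_mat a b \<Longrightarrow> mat_adjoint A \<in> carrier_mat b a"
  by (auto intro: carrier_matI)

lemma mat_adjoint_mult:
  fixes A B :: "complex mat"
  assumes "A \<in> carrier_mat a b" "B \<in> carrier_mat b c"
  shows "mat_adjoint (A * B) = mat_adjoint B * mat_adjoint A"
proof (rule eq_matI)
  fix i j assume "i < dim_row (mat_adjoint B * mat_adjoint A)" "j < dim_col (mat_adjoint B * mat_adjoint A)"
  then show "mat_adjoint (A * B) $$ (i, j) = (mat_adjoint B * mat_adjoint A) $$ (i, j)"
    using assms by (auto simp: scalar_prod_def mult.commute)
qed (use assms in auto)

lemma mat_adjoint_one [simp]: "mat_adjoint (1\<^sub>m N) = (1\<^sub>m N :: complex mat)"
  by (rule eq_matI) auto

lemma mat_adjoint_add: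
  fixes A B :: "complex mat"
  assumes "A \<in> carrier_mat a b" "B \<in> carrier_mat a b"
  shows "mat_adjoint (A + B) = mat_adjoint A + mat_adjoint B"
  by (rule eq_matI) (use assms in auto)

lemma mat_adjoint_smult:
  fixes A :: "complex mat"
  shows "mat_adjoint (c \<cdot>\<^sub>m A) = cnj c \<cdot>\<^sub>m mat_adjoint A"
  by (rule eq_matI) auto

section \<open>Kronecker products\<close>

lemma dim_kron [simp]:
  "dim_row (A \<otimes>\<^sub>K B) = dim_row A * dim_row B" "dim_col (A \<otimes>\<^sub>K B) = dim_col A * dim_col B"
  by (auto simp: kron_def)

lemma index_kron:
  "i < dim_row A * dim_row B \<Longrightarrow> j < dim_col A * dim_col B \<Longrightarrow>
    (A \<otimes>\<^sub>K B) $$ (i, j) =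
      A $$ (i div dim_row B, j div dim_col B) * B $$ (i mod dim_row B, j mod dim_col B)"
  by (auto simp: kron_def)

lemma kron_carrier [simp, intro]:
  "A \<in> carrier_mat a b \<Longrightarrow> B \<in> carrier_mat c d \<Longrightarrow> A \<otimes>\<^sub>K B \<in> carrier_mat (a * c) (b * d)"
  by (auto simp: kron_def)

text \<open>The mixed-product rule: splitting the contracted index into its two digits separates the
  sum into a product of two matrix entries.\<close>

lemma kron_mult:
  assumes A: "A \<in> carrier_mat a b" and C: "C \<in> carrier_mat b c"
    and B: "B \<in> carrier_mat a' b'" and D: "D \<in> carrier_mat b' c'"
  shows "(A \<otimes>\<^sub>K B) * (C \<otimes>\<^sub>K D) = (A * C) \<otimes>\<^sub>K (B * D)"
proof (rule eq_matI)
  fix i j assume "i < dim_row ((A * C) \<otimes>\<^sub>K (B * D))" "j < dim_col ((A * C) \<otimes>\<^sub>K (B * D))"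
  then have i: "i < a * a'" and j: "j < c * c'" using assms by auto
  let ?i1 = "i div a'" and ?i2 = "i mod a'" and ?j1 = "j div c'" and ?j2 = "j mod c'"
  have lt: "?i1 < a" "?i2 < a'" "?j1 < c" "?j2 < c'"
    using i j by (auto simp: less_mult_imp_div_less mod_less_of_less_mult)
  have "((A \<otimes>\<^sub>K B) * (C \<otimes>\<^sub>K D)) $$ (i, j) =
      (\<Sum>k<b * b'. (A \<otimes>\<^sub>K B) $$ (i, k) * (C \<otimes>\<^sub>K D) $$ (k, j))"
    using assms i j by (auto simp: scalar_prod_def lessThan_atLeast0)
  also have "\<dots> = (\<Sum>k<b * b'. A $$ (?i1, k div b') * B $$ (?i2, k mod b') *
      (C $$ (k div b', ?j1) * D $$ (k mod b', ?j2)))"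
    using assms i j by (intro sum.cong refl) (auto simp: index_kron)
  also have "\<dots> = (\<Sum>k<b. \<Sum>l<b'. A $$ (?i1, k) * B $$ (?i2, l) * (C $$ (k, ?j1) * D $$ (l, ?j2)))"
    by (rule sum_div_mod)
  also have "\<dots> = (\<Sum>k<b. A $$ (?i1, k) * C $$ (k, ?j1)) * (\<Sum>l<b'. B $$ (?i2, l) * D $$ (l, ?j2))"
    by (simp add: sum_product mult_ac)
  also have "\<dots> = ((A * C) \<otimes>\<^sub>K (B * D)) $$ (i, j)"
    using assms i j lt by (auto simp: index_kron scalar_prod_def lessThan_atLeast0)
  finally show "((A \<otimes>\<^sub>K B) * (C \<otimes>\<^sub>K D)) $$ (i, j) = ((A * C) \<otimes>\<^sub>K (B * D)) $$ (i, j)" .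
qed (use assms in auto)

lemma kron_adjoint: "mat_adjoint (A \<otimes>\<^sub>K B) = mat_adjoint A \<otimes>\<^sub>K mat_adjoint B"
  by (rule eq_matI) (auto simp: index_kron less_mult_imp_div_less mod_less_of_less_mult)

lemma kron_one: "1\<^sub>m a \<otimes>\<^sub>K 1\<^sub>m b = 1\<^sub>m (a * b)"
proof (rule eq_matI)
  fix i j assume ij: "i < dim_row (1\<^sub>m (a * b) :: complex mat)" "j < dim_col (1\<^sub>m (a * b) :: complex mat)"
  have "i = j \<longleftrightarrow> i div b = j div b \<and> i mod b = j mod b"
    by (metis div_mult_mod_eq)
  then show "(1\<^sub>m a \<otimes>\<^sub>K 1\<^sub>m b) $$ (i, j) = (1\<^sub>m (a * b) :: complex mat) $$ (i, j)"
    using ij by (auto simp: index_kron less_mult_imp_div_less mod_less_of_less_mult)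
qed auto

lemma kron_one_right [simp]: "A \<otimes>\<^sub>K 1\<^sub>m (Suc 0) = A"
  by (rule eq_matI) (auto simp: index_kron)

lemma kron_one_left [simp]: "1\<^sub>m (Suc 0) \<otimes>\<^sub>K A = A"
  by (rule eq_matI) (auto simp: index_kron)

lemma kron_assoc: "A \<otimes>\<^sub>K B \<otimes>\<^sub>K C = A \<otimes>\<^sub>K (B \<otimes>\<^sub>K C)"
proof -
  \<comment> \<open>Both bracketings read the same three mixed-radix digits of an index; a zero
    radix is treated as a separate case.\<close>
  have "i div c div b = i div (b * c)" "i div c mod b = i mod (b * c) div c"
    "i mod c = i mod (b * c) mod c" for i b c :: nat
    using div_mult2_eq[of i c b] mod_mult2_eq[of i c b] by (cases "c = 0"; simp add: mult.commute)+
  then show ?thesis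
    by (intro eq_matI)
      (auto simp: index_kron less_mult_imp_div_less mod_less_of_less_mult mult.assoc)
qed

lemma kron_add_left:
  "A \<in> carrier_mat a b \<Longrightarrow> B \<in> carrier_mat a b \<Longrightarrow> (A + B) \<otimes>\<^sub>K C = A \<otimes>\<^sub>K C + B \<otimes>\<^sub>K C"
  by (rule eq_matI)
    (auto simp: index_kron less_mult_imp_div_less mod_less_of_less_mult algebra_simps)

lemma kron_add_right:
  "B \<in> carrier_mat a b \<Longrightarrow> C \<in> carrier_mat a b \<Longrightarrow> A \<otimes>\<^sub>K (B + C) = A \<otimes>\<^sub>K B + A \<otimes>\<^sub>K C"
  by (rule eq_matI)
    (auto simp: index_kron less_mult_imp_div_less mod_less_of_less_mult algebra_simps)

section \<open>Traces and tensor powers\<close>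

lemma mtrace_kron:
  assumes "A \<in> carrier_mat a a" "B \<in> carrier_mat b b"
  shows "mtrace (A \<otimes>\<^sub>K B) = mtrace A * mtrace B"
proof -
  have "mtrace (A \<otimes>\<^sub>K B) = (\<Sum>k<a * b. A $$ (k div b, k div b) * B $$ (k mod b, k mod b))"
    unfolding mtrace_def using assms by (auto simp: index_kron intro!: sum.cong)
  also have "\<dots> = (\<Sum>i<a. \<Sum>j<b. A $$ (i, i) * B $$ (j, j))"
    by (rule sum_div_mod)
  finally show ?thesis
    using assms by (simp add: mtrace_def sum_product)
qed

lemma mtrace_mult:
  assumes "A \<in> carrier_mat a b" "B \<in> carrier_mat b a"
  shows "mtrace (A * B) = (\<Sum>i<a. \<Sum>j<b. A $$ (i, j) * B $$ (j, i))"
  using assms by (auto simp: mtrace_def scalar_prod_def lessThan_atLeast0)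

lemma mtrace_comm:
  assumes "A \<in> carrier_mat a b" "B \<in> carrier_mat b a"
  shows "mtrace (A * B) = mtrace (B * A)"
  by (subst mtrace_mult[OF assms], subst mtrace_mult[OF assms(2,1)], subst sum.swap)
    (simp add: mult.commute)

lemma mtrace_adjoint: "A \<in> carrier_mat a a \<Longrightarrow> mtrace (mat_adjoint A) = cnj (mtrace A)"
  by (auto simp: mtrace_def)

lemma mtrace_one: "mtrace (1\<^sub>m N) = of_nat N"
  by (simp add: mtrace_def)

lemma mtrace_add: "A \<in> carrier_mat a a \<Longrightarrow> B \<in> carrier_mat a a \<Longrightarrow> mtrace (A + B) = mtrace A + mtrace B"
  by (auto simp: mtrace_def sum.distrib)

lemma mtrace_smult: "A \<in> carrier_mat a a \<Longrightarrow> mtrace (c \<cdot>\<^sub>m A) = c * mtrace A"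
  by (auto simp: mtrace_def sum_distrib_left)

text \<open>Conjugating the trace reverses the factors, and cyclicity restores their order.
  Acceptance probabilities reveal only the real part of such a trace, so for Hermitian observables
  and states they reveal all of it.\<close>

lemma mtrace_hermitian_real:
  assumes "A \<in> carrier_mat a a" "B \<in> carrier_mat a a" "mat_adjoint A = A" "mat_adjoint B = B"
  shows "Im (mtrace (A * B)) = 0"
proof -
  have "cnj (mtrace (A * B)) = mtrace (mat_adjoint (A * B))"
    using assms(1,2) by (subst mtrace_adjoint) auto
  also have "\<dots> = mtrace (A * B)"
    using assms by (simp add: mat_adjoint_mult mtrace_comm)
  finally show ?thesis
    by (metis complex_cnj_cancel_iff complex_is_Real_iff Reals_cnj_iff)
qed

lemma kron_list_Nil [simp]: "kron_list [] = 1\<^sub>m 1"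
  by (simp add: kron_list_def)

lemma kron_list_Cons [simp]: "kron_list (A # As) = A \<otimes>\<^sub>K kron_list As"
  by (simp add: kron_list_def)

lemma kron_list_append: "kron_list (As @ Bs) = kron_list As \<otimes>\<^sub>K kron_list Bs"
  by (induction As) (auto simp: kron_assoc)

lemma kron_list_carrier:
  assumes "set As \<subseteq> carrier_mat a a"
  shows "kron_list As \<in> carrier_mat (a ^ length As) (a ^ length As)"
  using assms by (induction As) auto

lemma kron_list_mult:
  assumes "length As = length Bs" "set As \<subseteq> carrier_mat a a" "set Bs \<subseteq> carrier_mat a a"
  shows "kron_list As * kron_list Bs = kron_list (map2 (*) As Bs)"
  using assms
proof (induction As Bs rule: list_induct2)
  case (Cons A As B Bs)
  then show ?case
    using kron_list_carrier[of As a] kron_list_carrier[of Bs a]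
    by (simp add: kron_mult[where a = a and b = a and c = a])
qed auto

lemma kron_list_replicate_one: "kron_list (replicate k (1\<^sub>m a)) = 1\<^sub>m (a ^ k)"
  by (induction k) (auto simp: kron_one)

lemma tensor_power_0 [simp]: "tensor_power A 0 = 1\<^sub>m 1"
  by (simp add: tensor_power_def)

lemma tensor_power_Suc [simp]: "tensor_power A (Suc t) = A \<otimes>\<^sub>K tensor_power A t"
  by (simp add: tensor_power_def)

lemma tensor_power_carrier [simp, intro]:
  "A \<in> carrier_mat a a \<Longrightarrow> tensor_power A t \<in> carrier_mat (a ^ t) (a ^ t)"
  by (induction t) auto

lemma mtrace_tensor_power: "A \<in> carrier_mat a a \<Longrightarrow> mtrace (tensor_power A t) = mtrace A ^ t"
  by (induction t) (auto simp: mtrace_one mtrace_kron[OF _ tensor_power_carrier])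

lemma tensor_power_adjoint: "mat_adjoint A = A \<Longrightarrow> mat_adjoint (tensor_power A t) = tensor_power A t"
  by (induction t) (auto simp: kron_adjoint)

section \<open>Measuring Pauli strings\<close>

text \<open>An explicit four-entry form, closed under the operations in \<open>mat2_simps\<close>,
  so that identities between single-qubit gates become scalar arithmetic.\<close>

definition mat2 :: "complex \<Rightarrow> complex \<Rightarrow> complex \<Rightarrow> complex \<Rightarrow> complex mat" where
  "mat2 a b c d = mat 2 2 (\<lambda>(i, j). if i = 0 then (if j = 0 then a else b) else (if j = 0 then c else d))"

lemma mat2_carrier [simp, intro]: "mat2 a b c d \<in> carrier_mat 2 2"
  by (simp add: mat2_def)

lemma mat2_eqI:
  assumes "A \<in> carrier_mat 2 2"
    "A $$ (0, 0) = a" "A $$ (0, Suc 0) = b" "A $$ (Suc 0, 0) = c" "A $$ (Suc 0, Suc 0) = d"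
  shows "A = mat2 a b c d"
proof (rule eq_matI)
  fix i j assume "i < dim_row (mat2 a b c d)" "j < dim_col (mat2 a b c d)"
  then have "i = 0 \<or> i = Suc 0" "j = 0 \<or> j = Suc 0" by (auto simp: mat2_def)
  then show "A $$ (i, j) = mat2 a b c d $$ (i, j)" using assms by (auto simp: mat2_def)
qed (use assms in \<open>auto simp: mat2_def\<close>)

lemma mat2_mult:
  "mat2 a b c d * mat2 e f g h = mat2 (a * e + b * g) (a * f + b * h) (c * e + d * g) (c * f + d * h)"
  by (rule mat2_eqI) (auto simp: mat2_def scalar_prod_def numeral_2_eq_2)

lemma mat2_adjoint: "mat_adjoint (mat2 a b c d) = mat2 (cnj a) (cnj c) (cnj b) (cnj d)"
  by (rule mat2_eqI) (auto simp: mat2_def)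

lemma mat2_add: "mat2 a b c d + mat2 e f g h = mat2 (a + e) (b + f) (c + g) (d + h)"
  by (rule mat2_eqI) (auto simp: mat2_def)

lemma mat2_smult: "s \<cdot>\<^sub>m mat2 a b c d = mat2 (s * a) (s * b) (s * c) (s * d)"
  by (rule mat2_eqI) (auto simp: mat2_def)

lemma mat2_trace: "mtrace (mat2 a b c d) = a + d"
  by (auto simp: mat2_def mtrace_def numeral_2_eq_2)

lemma mat2_one: "1\<^sub>m 2 = mat2 1 0 0 1"
  by (rule mat2_eqI) auto

lemma mat2_zero: "0\<^sub>m 2 2 = mat2 0 0 0 0"
  by (rule mat2_eqI) auto

lemma mat2_of_rows_list: "mat_of_rows_list 2 [[a, b], [c, d]] = mat2 a b c d"
  by (rule mat2_eqI) (auto simp: mat_of_rows_list_def numeral_2_eq_2)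

lemmas mat2_simps = mat2_mult mat2_adjoint mat2_add mat2_smult mat2_trace mat2_one mat2_zero
  mat2_of_rows_list

declare pauli_mat1.simps [simp del]
declare pauli_mat1.simps(1) [simp]

lemma pauli_mat1_carrier [simp, intro]: "pauli_mat1 P \<in> carrier_mat 2 2"
  by (cases P) (auto simp: pauli_mat1.simps mat2_simps)

lemma pauli_mat1_dim [simp]: "dim_row (pauli_mat1 P) = 2" "dim_col (pauli_mat1 P) = 2"
  using pauli_mat1_carrier[of P] by (blast dest: carrier_matD)+

lemma pauli_mat1_adjoint [simp]: "mat_adjoint (pauli_mat1 P) = pauli_mat1 P"
  by (cases P) (auto simp: pauli_mat1.simps mat2_simps)

lemma pauli_mat1_square: "pauli_mat1 P * pauli_mat1 P = 1\<^sub>m 2"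
  by (cases P) (auto simp: pauli_mat1.simps mat2_simps)

lemma pauli_mat_Nil [simp]: "pauli_mat [] = 1\<^sub>m 1"
  by (simp add: pauli_mat_def)

lemma pauli_mat_Cons [simp]: "pauli_mat (P # Ps) = pauli_mat1 P \<otimes>\<^sub>K pauli_mat Ps"
  by (simp add: pauli_mat_def)

lemma pauli_mat_carrier [simp, intro]: "pauli_mat Ps \<in> carrier_mat (2 ^ length Ps) (2 ^ length Ps)"
  by (induction Ps) auto

lemma pauli_mat_adjoint [simp]: "mat_adjoint (pauli_mat Ps) = pauli_mat Ps"
  by (induction Ps) (auto simp: kron_adjoint)

lemma pauli_mat_square: "pauli_mat Ps * pauli_mat Ps = 1\<^sub>m (2 ^ length Ps)"
proof (induction Ps)
  case (Cons P Ps)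
  have "pauli_mat (P # Ps) * pauli_mat (P # Ps) =
      (pauli_mat1 P * pauli_mat1 P) \<otimes>\<^sub>K (pauli_mat Ps * pauli_mat Ps)"
    unfolding pauli_mat_Cons
    by (rule kron_mult[OF pauli_mat1_carrier pauli_mat1_carrier pauli_mat_carrier pauli_mat_carrier])
  then show ?case using Cons by (simp add: pauli_mat1_square kron_one)
qed auto

abbreviation proj0 :: "complex mat" where "proj0 \<equiv> outer (unit_vec 2 0)"
abbreviation proj1 :: "complex mat" where "proj1 \<equiv> outer (unit_vec 2 (Suc 0))"

lemma outer_carrier [simp, intro]: "v \<in> carrier_vec N \<Longrightarrow> outer v \<in> carrier_mat N N"
  by (auto simp: outer_def)

lemma outer_unit_vec_eq: "proj0 = mat2 1 0 0 0" "proj1 = mat2 0 0 0 1"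
  by (rule mat2_eqI; simp add: outer_def)+

text \<open>The last two equations evaluate \<open>proj0 + s \<cdot>\<^sub>m proj1\<close> for the
  two signs that arise when an observable is pulled back through a CNOT: the control wire receives
  the identity or a Z.\<close>

lemma outer_unit_vec_simps:
  "mat_adjoint proj0 = proj0" "mat_adjoint proj1 = proj1"
  "proj0 * proj0 = proj0" "proj1 * proj1 = proj1"
  "proj0 * proj1 = 0\<^sub>m 2 2" "proj1 * proj0 = 0\<^sub>m 2 2"
  "proj0 + 1 \<cdot>\<^sub>m proj1 = 1\<^sub>m 2" "proj0 + (- 1) \<cdot>\<^sub>m proj1 = pauli_mat1 PauliZ"
  by (simp_all add: outer_unit_vec_eq mat2_simps pauli_mat1.simps del: One_nat_def)

section \<open>Operators acting on single wires\<close>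

lemma set_update_carrier:
  assumes "set Cs \<subseteq> carrier_mat a a" "A \<in> carrier_mat a a"
  shows "set (Cs[i := A]) \<subseteq> carrier_mat a a"
  using assms set_update_subset_insert[of Cs i A] by blast

lemma set_replicate_one_carrier: "set (replicate m (1\<^sub>m a)) \<subseteq> carrier_mat a a"
  by (auto simp: set_replicate_conv_if split: if_splits)

lemma kron_list_update_add:
  assumes "w < length Bs" "A \<in> carrier_mat 2 2" "B \<in> carrier_mat 2 2" "set Bs \<subseteq> carrier_mat 2 2"
  shows "kron_list (Bs[w := A + B]) = kron_list (Bs[w := A]) + kron_list (Bs[w := B])"
proof -
  have *: "kron_list (Bs[w := C]) = kron_list (take w Bs) \<otimes>\<^sub>K (C \<otimes>\<^sub>K kron_list (drop (Suc w) Bs))" for C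
    using assms(1) by (simp add: upd_conv_take_nth_drop kron_list_append)
  have "kron_list (drop (Suc w) Bs) \<in> carrier_mat (2 ^ length (drop (Suc w) Bs)) (2 ^ length (drop (Suc w) Bs))"
    using assms(4) by (intro kron_list_carrier) (auto dest: in_set_dropD)
  then show ?thesis
    unfolding * kron_add_left[OF assms(2,3)]
    by (intro kron_add_right[OF kron_carrier[OF assms(2)] kron_carrier[OF assms(3)]])
qed

lemma kron_smult_left: "(c \<cdot>\<^sub>m A) \<otimes>\<^sub>K B = c \<cdot>\<^sub>m (A \<otimes>\<^sub>K B)"
  by (rule eq_matI) (auto simp: index_kron less_mult_imp_div_less mod_less_of_less_mult)

lemma kron_smult_right: "A \<otimes>\<^sub>K (c \<cdot>\<^sub>m B) = c \<cdot>\<^sub>m (A \<otimes>\<^sub>K B)"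
  by (rule eq_matI) (auto simp: index_kron less_mult_imp_div_less mod_less_of_less_mult)

lemma kron_list_update_smult:
  assumes "w < length Bs"
  shows "kron_list (Bs[w := c \<cdot>\<^sub>m A]) = c \<cdot>\<^sub>m kron_list (Bs[w := A])"
  using assms by (simp add: upd_conv_take_nth_drop kron_list_append kron_smult_left kron_smult_right)

lemma kron_list_update_zero:
  assumes "w < length Bs" "set Bs \<subseteq> carrier_mat 2 2"
  shows "kron_list (Bs[w := 0\<^sub>m 2 2]) = 0\<^sub>m (2 ^ length Bs) (2 ^ length Bs)"
proof -
  have "(0\<^sub>m 2 2 :: complex mat) = 0 \<cdot>\<^sub>m 0\<^sub>m 2 2" by auto
  then have "kron_list (Bs[w := 0\<^sub>m 2 2]) = 0 \<cdot>\<^sub>m kron_list (Bs[w := 0\<^sub>m 2 2])"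
    using kron_list_update_smult[OF assms(1)] by metis
  moreover have "kron_list (Bs[w := 0\<^sub>m 2 2]) \<in> carrier_mat (2 ^ length Bs) (2 ^ length Bs)"
    using kron_list_carrier[OF set_update_carrier[OF assms(2) zero_carrier_mat]] by simp
  then have "0 \<cdot>\<^sub>m kron_list (Bs[w := 0\<^sub>m 2 2]) = 0\<^sub>m (2 ^ length Bs) (2 ^ length Bs)"
    by (intro eq_matI) auto
  ultimately show ?thesis by simp
qed

text \<open>With this form, multiplication by a one-wire operator becomes an update of one list
  entry, and products of one-wire operators stay within Kronecker lists.\<close>

lemma on_wire_eq:
  assumes "w < m" "A \<in> carrier_mat 2 2"
  shows "on_wire m w A = kron_list ((replicate m (1\<^sub>m 2))[w := A])"
proof -
  have "kron_list ((replicate m (1\<^sub>m 2))[w := A]) =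
      kron_list (replicate w (1\<^sub>m 2)) \<otimes>\<^sub>K (A \<otimes>\<^sub>K kron_list (replicate (m - Suc w) (1\<^sub>m 2)))"
    using assms(1) by (simp add: upd_conv_take_nth_drop kron_list_append min_def)
  then show ?thesis
    by (simp add: on_wire_def kron_list_replicate_one kron_assoc)
qed

lemma on_wire_carrier:
  assumes "w < m" "A \<in> carrier_mat 2 2"
  shows "on_wire m w A \<in> carrier_mat (2 ^ m) (2 ^ m)"
  unfolding on_wire_eq[OF assms]
  using kron_list_carrier[OF set_update_carrier[OF set_replicate_one_carrier assms(2)]] by simp

lemma on_wire_adjoint: "mat_adjoint (on_wire m w A) = on_wire m w (mat_adjoint A)"
  by (simp add: on_wire_def kron_adjoint)

lemma on_wire_mult_kron_list:
  assumes "w < length Bs" "A \<in> carrier_mat 2 2" "set Bs \<subseteq> carrier_mat 2 2"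
  shows "on_wire (length Bs) w A * kron_list Bs = kron_list (Bs[w := A * Bs ! w])"
proof -
  have "map2 (*) ((replicate (length Bs) (1\<^sub>m 2))[w := A]) Bs = Bs[w := A * Bs ! w]"
    using assms by (intro nth_equalityI) (auto simp: nth_list_update in_set_conv_nth subset_iff)
  then show ?thesis
    unfolding on_wire_eq[OF assms(1,2)]
    using assms(3) set_update_carrier[OF set_replicate_one_carrier assms(2)]
    by (simp add: kron_list_mult[where a = 2])
qed

lemma kron_list_mult_on_wire:
  assumes "w < length Bs" "A \<in> carrier_mat 2 2" "set Bs \<subseteq> carrier_mat 2 2"
  shows "kron_list Bs * on_wire (length Bs) w A = kron_list (Bs[w := Bs ! w * A])"
proof -
  have "map2 (*) Bs ((replicate (length Bs) (1\<^sub>m 2))[w := A]) = Bs[w := Bs ! w * A]"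
    using assms by (intro nth_equalityI) (auto simp: nth_list_update in_set_conv_nth subset_iff)
  then show ?thesis
    unfolding on_wire_eq[OF assms(1,2)]
    using assms(3) set_update_carrier[OF set_replicate_one_carrier assms(2)]
    by (simp add: kron_list_mult[where a = 2])
qed

section \<open>Pulling observables back through gates\<close>

text \<open>The action on observables rather than on states: the input state may be entangled, but
  the observables that occur here keep the form \<open>kron_list Bs\<close>.\<close>

definition heisenberg :: "nat \<Rightarrow> gate \<Rightarrow> complex mat \<Rightarrow> complex mat" where
  "heisenberg m g A = mat_adjoint (gate_mat m g) * A * gate_mat m g"

definition hadamard_mat :: "complex mat" where
  "hadamard_mat = complex_of_real (1 / sqrt 2) \<cdot>\<^sub>m mat_of_rows_list 2 [[1, 1], [1, - 1]]"

definition tgate_mat :: "complex mat" where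
  "tgate_mat = mat_of_rows_list 2 [[1, 0], [0, cis (pi / 4)]]"

lemma single_gate_carrier [simp, intro]:
  "hadamard_mat \<in> carrier_mat 2 2" "tgate_mat \<in> carrier_mat 2 2"
  by (auto simp: hadamard_mat_def tgate_mat_def mat2_simps)

lemma sqrt2_mult: "complex_of_real (sqrt 2) * complex_of_real (sqrt 2) = 2"
  by (metis of_real_mult of_real_numeral real_sqrt_mult_self abs_numeral)

text \<open>The case of the identity expresses that the gate preserves traces; the case of Z is the
  basis change for measuring X.\<close>

lemma hadamard_conj:
  "mat_adjoint hadamard_mat * 1\<^sub>m 2 * hadamard_mat = 1\<^sub>m 2"
  "mat_adjoint hadamard_mat * pauli_mat1 PauliZ * hadamard_mat = pauli_mat1 PauliX"
  by (simp_all add: hadamard_mat_def pauli_mat1.simps mat2_simps field_simps sqrt2_mult)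

text \<open>The operator cos(r) X - sin(r) Y, that is, the equatorial Pauli observables along which
  conjugation by T moves in steps of pi/4.\<close>

definition phase_x :: "real \<Rightarrow> complex mat" where
  "phase_x r = mat2 0 (cis r) (cis (- r)) 0"

lemma phase_x_eq: "phase_x 0 = pauli_mat1 PauliX" "phase_x (6 * (pi / 4)) = pauli_mat1 PauliY"
proof -
  show "phase_x 0 = pauli_mat1 PauliX"
    by (simp add: phase_x_def pauli_mat1.simps mat2_simps)
  have "6 * (pi / 4) = pi + pi / 2" by simp
  then have "cis (6 * (pi / 4)) = - \<i>" "cis (- (6 * (pi / 4))) = \<i>"
    by (simp_all only: cis_cnj[symmetric] cis_mult[symmetric]) auto
  then show "phase_x (6 * (pi / 4)) = pauli_mat1 PauliY"
    by (simp only: phase_x_def pauli_mat1.simps mat2_simps)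
qed

lemma tgate_conj:
  "mat_adjoint tgate_mat * 1\<^sub>m 2 * tgate_mat = 1\<^sub>m 2"
  "mat_adjoint tgate_mat * phase_x r * tgate_mat = phase_x (r + pi / 4)"
  by (simp_all add: tgate_mat_def phase_x_def mat2_simps cis_cnj cis_mult add.commute)

lemma heisenberg_on_wire:
  assumes "gate_mat (length Bs) g = on_wire (length Bs) w A"
    and "w < length Bs" "A \<in> carrier_mat 2 2" "set Bs \<subseteq> carrier_mat 2 2"
  shows "heisenberg (length Bs) g (kron_list Bs) = kron_list (Bs[w := mat_adjoint A * Bs ! w * A])"
proof -
  have "Bs ! w \<in> carrier_mat 2 2"
    using assms(4) nth_mem[OF assms(2)] by blast
  then have "set (Bs[w := mat_adjoint A * Bs ! w]) \<subseteq> carrier_mat 2 2"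
    using assms(3) by (intro set_update_carrier[OF assms(4)] mult_carrier_mat) auto
  then show ?thesis
    unfolding heisenberg_def assms(1) on_wire_adjoint
    using on_wire_mult_kron_list[of w Bs "mat_adjoint A"]
      kron_list_mult_on_wire[of w "Bs[w := mat_adjoint A * Bs ! w]" A] assms
    by simp
qed

lemma heisenberg_hadamard:
  assumes "w < length Bs" "set Bs \<subseteq> carrier_mat 2 2"
  shows "heisenberg (length Bs) (Hadamard w) (kron_list Bs) =
    kron_list (Bs[w := mat_adjoint hadamard_mat * Bs ! w * hadamard_mat])"
  by (rule heisenberg_on_wire) (use assms in \<open>auto simp: hadamard_mat_def mat2_of_rows_list mat2_smult\<close>)

lemma heisenberg_tgate:
  assumes "w < length Bs" "set Bs \<subseteq> carrier_mat 2 2"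
  shows "heisenberg (length Bs) (TGate w) (kron_list Bs) =
    kron_list (Bs[w := mat_adjoint tgate_mat * Bs ! w * tgate_mat])"
  by (rule heisenberg_on_wire) (use assms in \<open>auto simp: tgate_mat_def mat2_of_rows_list\<close>)

text \<open>CNOT is the sum of \<open>proj0\<close> on the control and of \<open>proj1\<close> on
  the control times X on the target. Since the control factor of the observable is the identity, the
  two cross terms contain \<open>proj0 * proj1\<close> or \<open>proj1 * proj0\<close> and vanish.
  The remaining \<open>proj1\<close> term conjugates the target factor by X, which only produces the
  scalar \<open>s\<close>. This is phase kickback: for a target factor Z one has
  \<open>s = - 1\<close>, and a Z appears on the control.\<close>

lemma heisenberg_cnot:
  assumes c: "c < length Bs" and t: "t < length Bs" and ct: "c \<noteq> t"
    and Bs: "set Bs \<subseteq> carrier_mat 2 2" and Bc: "Bs ! c = 1\<^sub>m 2"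
    and Bt: "pauli_mat1 PauliX * Bs ! t * pauli_mat1 PauliX = s \<cdot>\<^sub>m Bs ! t"
  shows "heisenberg (length Bs) (CNot c t) (kron_list Bs) = kron_list (Bs[c := proj0 + s \<cdot>\<^sub>m proj1])"
proof -
  let ?m = "length Bs" and ?X = "pauli_mat1 PauliX"
  let ?K0 = "on_wire ?m c proj0" and ?K1 = "on_wire ?m c proj1" and ?Xt = "on_wire ?m t ?X"
  let ?N = "2 ^ ?m :: nat"
  note car = on_wire_carrier[OF c] on_wire_carrier[OF t]
  have K0: "?K0 \<in> carrier_mat ?N ?N" and K1: "?K1 \<in> carrier_mat ?N ?N" and Xt: "?Xt \<in> carrier_mat ?N ?N"
    by (auto intro!: car)
  have Xc: "?X \<in> carrier_mat 2 2" and P: "proj0 \<in> carrier_mat 2 2" "proj1 \<in> carrier_mat 2 2" by auto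
  have Btc: "Bs ! t \<in> carrier_mat 2 2" using Bs nth_mem[OF t] by blast
  have XB: "?X * Bs ! t \<in> carrier_mat 2 2" "Bs ! t * ?X \<in> carrier_mat 2 2" "s \<cdot>\<^sub>m Bs ! t \<in> carrier_mat 2 2"
    using Xc Btc by (auto intro!: mult_carrier_mat)
  have B: "kron_list Bs \<in> carrier_mat ?N ?N"
    by (rule kron_list_carrier[OF Bs])
  have left: "on_wire ?m i A * kron_list Cs = kron_list (Cs[i := A * Cs ! i])"
    and right: "kron_list Cs * on_wire ?m i A = kron_list (Cs[i := Cs ! i * A])"
    if "length Cs = ?m" "i < ?m" "A \<in> carrier_mat 2 2" "set Cs \<subseteq> carrier_mat 2 2" for Cs i A
    using on_wire_mult_kron_list[of i Cs A] kron_list_mult_on_wire[of i Cs A] that by auto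
  \<comment> \<open>The adjoint reverses the two factors; they act on different wires, so commuting
    them shows that CNOT is self-adjoint.\<close>
  have comm: "?Xt * ?K1 = ?K1 * ?Xt"
  proof -
    have l: "?K1 = kron_list ((replicate ?m (1\<^sub>m 2))[c := proj1])"
      by (rule on_wire_eq[OF c P(2)])
    have s: "set ((replicate ?m (1\<^sub>m 2))[c := proj1]) \<subseteq> carrier_mat 2 2"
      by (rule set_update_carrier[OF set_replicate_one_carrier P(2)])
    show ?thesis unfolding l
      using left[OF _ t Xc s] right[OF _ t Xc s] t ct by (simp)
  qed
  have adj: "mat_adjoint (gate_mat ?m (CNot c t)) = ?K0 + ?K1 * ?Xt"
  proof -
    have "mat_adjoint (?K0 + ?K1 * ?Xt) = mat_adjoint ?K0 + mat_adjoint ?Xt * mat_adjoint ?K1"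
      using K0 K1 Xt by (simp add: mat_adjoint_add[of _ ?N ?N] mat_adjoint_mult[of _ ?N ?N])
    then show ?thesis
      using comm by (simp add: on_wire_adjoint outer_unit_vec_simps)
  qed
  define B0 where "B0 = kron_list (Bs[c := proj0])"
  define B1 where "B1 = kron_list (Bs[c := proj1, t := ?X * Bs ! t])"
  have B0c: "B0 \<in> carrier_mat ?N ?N"
    unfolding B0_def using kron_list_carrier[OF set_update_carrier[OF Bs P(1)]] by simp
  have B1c: "B1 \<in> carrier_mat ?N ?N"
    unfolding B1_def using kron_list_carrier[OF set_update_carrier[OF set_update_carrier[OF Bs P(2)] XB(1)]] by simp
  have 1: "(?K0 + ?K1 * ?Xt) * kron_list Bs = B0 + B1"
  proof -
    have "(?K0 + ?K1 * ?Xt) * kron_list Bs = ?K0 * kron_list Bs + ?K1 * (?Xt * kron_list Bs)"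
      using K0 K1 Xt B by (simp add: add_mult_distrib_mat[of _ ?N ?N] assoc_mult_mat[of _ ?N ?N _ ?N _ ?N])
    also have "?K0 * kron_list Bs = B0"
      unfolding B0_def using left[OF _ c P(1) Bs] Bc by (simp add: outer_def)
    also have "?K1 * (?Xt * kron_list Bs) = ?K1 * kron_list (Bs[t := ?X * Bs ! t])"
      using left[OF _ t Xc Bs] by simp
    also have "\<dots> = B1"
      unfolding B1_def using left[OF _ c P(2) set_update_carrier[OF Bs XB(1)], of t] Bc ct
      by (simp add: list_update_swap[OF ct] outer_def)
    finally show ?thesis .
  qed
  have k01: "B0 * (?K1 * ?Xt) = 0\<^sub>m ?N ?N"
  proof -
    have "B0 * (?K1 * ?Xt) = B0 * ?K1 * ?Xt"
      using B0c K1 Xt by (simp add: assoc_mult_mat[of _ ?N ?N _ ?N _ ?N])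
    also have "B0 * ?K1 = 0\<^sub>m ?N ?N"
      unfolding B0_def using right[OF _ c P(2) set_update_carrier[OF Bs P(1)], of c] c
      by (simp add: outer_unit_vec_simps kron_list_update_zero[OF _ Bs])
    finally show ?thesis using Xt by (simp)
  qed
  have k10: "B1 * ?K0 = 0\<^sub>m ?N ?N"
    unfolding B1_def using right[OF _ c P(1) set_update_carrier[OF set_update_carrier[OF Bs P(2)] XB(1)], of c t] c ct
      kron_list_update_zero[of c "Bs[c := proj1, t := ?X * Bs ! t]", OF _ set_update_carrier[OF set_update_carrier[OF Bs P(2)] XB(1)]]
    by (simp add: outer_unit_vec_simps)
  have k00: "B0 * ?K0 = B0"
    unfolding B0_def using right[OF _ c P(1) set_update_carrier[OF Bs P(1)], of c] c
    by (simp add: outer_unit_vec_simps)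
  have k11: "B1 * (?K1 * ?Xt) = kron_list (Bs[c := s \<cdot>\<^sub>m proj1])"
  proof -
    have "B1 * (?K1 * ?Xt) = B1 * ?K1 * ?Xt"
      using B1c K1 Xt by (simp add: assoc_mult_mat[of _ ?N ?N _ ?N _ ?N])
    also have "B1 * ?K1 = B1"
      unfolding B1_def using right[OF _ c P(2) set_update_carrier[OF set_update_carrier[OF Bs P(2)] XB(1)], of c t] c ct
      by (simp add: outer_unit_vec_simps list_update_swap[OF ct])
    also have "B1 * ?Xt = kron_list (Bs[c := proj1, t := s \<cdot>\<^sub>m Bs ! t])"
      unfolding B1_def using right[OF _ t Xc set_update_carrier[OF set_update_carrier[OF Bs P(2)] XB(1)], of c t] t ct Bt
      by (simp)
    also have "\<dots> = s \<cdot>\<^sub>m kron_list (Bs[c := proj1, t := Bs ! t])"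
      using t by (simp add: kron_list_update_smult)
    also have "Bs[c := proj1, t := Bs ! t] = Bs[c := proj1]"
      using ct by (metis list_update_id nth_list_update_neq)
    also have "s \<cdot>\<^sub>m kron_list (Bs[c := proj1]) = kron_list (Bs[c := s \<cdot>\<^sub>m proj1])"
      using c by (simp add: kron_list_update_smult)
    finally show ?thesis .
  qed
  have "heisenberg ?m (CNot c t) (kron_list Bs) = (B0 + B1) * (?K0 + ?K1 * ?Xt)"
    unfolding heisenberg_def adj 1 by simp
  also have "\<dots> = (B0 * ?K0 + B1 * ?K0) + (B0 * (?K1 * ?Xt) + B1 * (?K1 * ?Xt))"
    unfolding mult_add_distrib_mat[OF add_carrier_mat[OF B1c] K0 mult_carrier_mat[OF K1 Xt]]
      add_mult_distrib_mat[OF B0c B1c K0] add_mult_distrib_mat[OF B0c B1c mult_carrier_mat[OF K1 Xt]]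
    by simp
  also have "\<dots> = B0 + kron_list (Bs[c := s \<cdot>\<^sub>m proj1])"
    unfolding k00 k01 k10 k11 using B0c kron_list_carrier[OF set_update_carrier[OF Bs smult_carrier_mat[OF P(2)]], of c s] by simp
  also have "\<dots> = kron_list (Bs[c := proj0 + s \<cdot>\<^sub>m proj1])"
    unfolding B0_def using kron_list_update_add[OF c P(1) _ Bs, of "s \<cdot>\<^sub>m proj1"] P(2) by simp
  finally show ?thesis .
qed

section \<open>Block traces and acceptance probabilities\<close>

definition mat_block :: "nat \<Rightarrow> complex mat \<Rightarrow> nat \<Rightarrow> nat \<Rightarrow> complex mat" where
  "mat_block N D a b = mat N N (\<lambda>(i, j). D $$ (a * N + i, b * N + j))"

lemma mat_block_carrier [simp, intro]: "mat_block N D a b \<in> carrier_mat N N"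
  by (simp add: mat_block_def)

text \<open>Peels off the first tensor factor of a trace. This serves both to read the output qubit
  of a circuit and to recover matrix entries from Pauli expectations qubit by qubit.\<close>

lemma mtrace_kron_mult_block:
  assumes A: "A \<in> carrier_mat a a" and B: "B \<in> carrier_mat N N" and D: "D \<in> carrier_mat (a * N) (a * N)"
  shows "mtrace ((A \<otimes>\<^sub>K B) * D) = (\<Sum>i<a. \<Sum>j<a. A $$ (i, j) * mtrace (B * mat_block N D j i))"
proof -
  define f where "f i1 i2 j1 j2 = A $$ (i1, j1) * B $$ (i2, j2) * D $$ (j1 * N + j2, i1 * N + i2)" for i1 i2 j1 j2
  have "mtrace ((A \<otimes>\<^sub>K B) * D) = (\<Sum>i<a * N. \<Sum>j<a * N. (A \<otimes>\<^sub>K B) $$ (i, j) * D $$ (j, i))"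
    by (rule mtrace_mult[OF kron_carrier[OF A B] D])
  also have "\<dots> = (\<Sum>i<a * N. \<Sum>j<a * N. f (i div N) (i mod N) (j div N) (j mod N))"
    unfolding f_def using A B by (intro sum.cong refl) (auto simp: index_kron)
  also have "\<dots> = (\<Sum>i1<a. \<Sum>i2<N. \<Sum>j1<a. \<Sum>j2<N. f i1 i2 j1 j2)"
    by (simp only: sum_div_mod[where f = "\<lambda>j1 j2. f _ _ j1 j2"]
      sum_div_mod[where f = "\<lambda>i1 i2. \<Sum>j1<a. \<Sum>j2<N. f i1 i2 j1 j2"])
  also have "\<dots> = (\<Sum>i1<a. \<Sum>j1<a. \<Sum>i2<N. \<Sum>j2<N. f i1 i2 j1 j2)"
    by (intro sum.cong refl sum.swap)
  also have "\<dots> = (\<Sum>i<a. \<Sum>j<a. A $$ (i, j) * mtrace (B * mat_block N D j i))"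
    unfolding f_def mtrace_mult[OF B mat_block_carrier]
    by (intro sum.cong refl) (simp add: sum_distrib_left mat_block_def mult_ac)
  finally show ?thesis .
qed

lemma gate_mat_carrier: "gate_wf m g \<Longrightarrow> gate_mat m g \<in> carrier_mat (2 ^ m) (2 ^ m)"
proof (cases g)
  case (CNot c t)
  assume "gate_wf m g"
  then have "on_wire m c proj0 \<in> carrier_mat (2 ^ m) (2 ^ m)" "on_wire m c proj1 \<in> carrier_mat (2 ^ m) (2 ^ m)"
    "on_wire m t (pauli_mat1 PauliX) \<in> carrier_mat (2 ^ m) (2 ^ m)"
    using CNot by (auto intro!: on_wire_carrier)
  then show ?thesis using CNot by (auto intro!: add_carrier_mat mult_carrier_mat)
qed (auto intro!: on_wire_carrier simp: mat2_of_rows_list)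

lemma heisenberg_carrier:
  "gate_wf m g \<Longrightarrow> A \<in> carrier_mat (2 ^ m) (2 ^ m) \<Longrightarrow> heisenberg m g A \<in> carrier_mat (2 ^ m) (2 ^ m)"
  unfolding heisenberg_def using gate_mat_carrier[of m g]
  by (auto intro!: mult_carrier_mat)

lemma foldr_heisenberg_carrier:
  "\<forall>g \<in> set gs. gate_wf m g \<Longrightarrow> A \<in> carrier_mat (2 ^ m) (2 ^ m) \<Longrightarrow>
    foldr (heisenberg m) gs A \<in> carrier_mat (2 ^ m) (2 ^ m)"
  by (induction gs) (auto intro: heisenberg_carrier)

lemma foldl_gate_mat_carrier:
  "\<forall>g \<in> set gs. gate_wf m g \<Longrightarrow> U \<in> carrier_mat (2 ^ m) (2 ^ m) \<Longrightarrow>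
    foldl (\<lambda>U g. gate_mat m g * U) U gs \<in> carrier_mat (2 ^ m) (2 ^ m)"
  by (induction gs arbitrary: U) (auto intro!: mult_carrier_mat gate_mat_carrier)

text \<open>Later gates stand further left in the circuit unitary, so the last gate is the first to
  conjugate the observable; this turns the \<open>foldl\<close> over gates into a
  \<open>foldr\<close>. The arbitrary initial \<open>U\<close> is the accumulator needed for the
  induction.\<close>

lemma foldl_gate_mat_conj:
  assumes "\<forall>g \<in> set gs. gate_wf m g" "A \<in> carrier_mat (2 ^ m) (2 ^ m)" "U \<in> carrier_mat (2 ^ m) (2 ^ m)"
  shows "mat_adjoint (foldl (\<lambda>U g. gate_mat m g * U) U gs) * A * foldl (\<lambda>U g. gate_mat m g * U) U gs =
    mat_adjoint U * foldr (heisenberg m) gs A * U"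
  using assms
proof (induction gs arbitrary: U)
  case (Cons g gs)
  let ?N = "2 ^ m :: nat"
  let ?F = "foldr (heisenberg m) gs A" and ?g = "gate_mat m g"
  have g: "?g \<in> carrier_mat ?N ?N" "?F \<in> carrier_mat ?N ?N" "U \<in> carrier_mat ?N ?N"
    using Cons.prems by (auto intro!: gate_mat_carrier foldr_heisenberg_carrier)
  have "mat_adjoint (foldl (\<lambda>U g. gate_mat m g * U) U (g # gs)) * A * foldl (\<lambda>U g. gate_mat m g * U) U (g # gs) =
      mat_adjoint (?g * U) * ?F * (?g * U)"
    using Cons.prems g by (simp add: Cons.IH)
  also have "\<dots> = (mat_adjoint U * mat_adjoint ?g) * ?F * (?g * U)"
    by (simp add: mat_adjoint_mult[OF g(1,3)])
  also have "\<dots> = mat_adjoint U * (mat_adjoint ?g * ?F * ?g) * U"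
    using g by (simp add: assoc_mult_mat[of _ ?N ?N _ ?N _ ?N] mult_carrier_mat[of _ ?N ?N _ ?N])
  finally show ?case by (simp only: foldr.simps o_apply heisenberg_def[of m g])
qed simp

text \<open>Each gate is an isometry. This follows from the conjugation rules above with identity
  factors everywhere; for CNOT it is the case \<open>s = 1\<close>.\<close>

lemma heisenberg_one:
  assumes "gate_wf m g"
  shows "heisenberg m g (1\<^sub>m (2 ^ m)) = 1\<^sub>m (2 ^ m)"
proof -
  define Bs where "Bs = replicate m (1\<^sub>m 2 :: complex mat)"
  have Bs: "set Bs \<subseteq> carrier_mat 2 2" "length Bs = m" "kron_list Bs = 1\<^sub>m (2 ^ m)"
    and nth: "\<And>w. w < m \<Longrightarrow> Bs ! w = 1\<^sub>m 2"
    using set_replicate_one_carrier[of m 2]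
    by (auto simp: Bs_def kron_list_replicate_one)
  have upd: "Bs[w := 1\<^sub>m 2] = Bs" for w
    using list_update_id[of Bs w] nth[of w] Bs(2) by (cases "w < m") (auto simp: list_update_beyond not_less)
  show ?thesis
  proof (cases g)
    case (Hadamard w)
    with assms show ?thesis
      using heisenberg_hadamard[of w Bs] by (simp add: Bs nth upd hadamard_conj)
  next
    case (TGate w)
    with assms show ?thesis
      using heisenberg_tgate[of w Bs] by (simp add: Bs nth upd tgate_conj)
  next
    case (CNot c t)
    have "pauli_mat1 PauliX * 1\<^sub>m 2 * pauli_mat1 PauliX = 1 \<cdot>\<^sub>m 1\<^sub>m 2"
      using pauli_mat1_square[of PauliX]
      by (simp add: right_mult_one_mat[OF pauli_mat1_carrier]) (rule eq_matI; simp)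
    with CNot assms show ?thesis
      using heisenberg_cnot[of c Bs t 1] by (simp add: Bs nth upd outer_unit_vec_simps)
  qed
qed

lemma foldr_heisenberg_one:
  "\<forall>g \<in> set gs. gate_wf m g \<Longrightarrow> foldr (heisenberg m) gs (1\<^sub>m (2 ^ m)) = 1\<^sub>m (2 ^ m)"
  by (induction gs) (auto simp: heisenberg_one)

lemma circuit_unitary_carrier:
  "circuit_wf C \<Longrightarrow> circuit_unitary C \<in> carrier_mat (2 ^ c_wires C) (2 ^ c_wires C)"
  unfolding circuit_unitary_def circuit_wf_def by (intro foldl_gate_mat_carrier) auto

lemma circuit_unitary_conj:
  assumes "circuit_wf C" "A \<in> carrier_mat (2 ^ c_wires C) (2 ^ c_wires C)"
  shows "mat_adjoint (circuit_unitary C) * A * circuit_unitary C = foldr (heisenberg (c_wires C)) (c_gates C) A"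
proof -
  have wf: "\<forall>g \<in> set (c_gates C). gate_wf (c_wires C) g"
    using assms(1) by (simp add: circuit_wf_def)
  show ?thesis
    unfolding circuit_unitary_def
    using foldl_gate_mat_conj[OF wf assms(2) one_carrier_mat] foldr_heisenberg_carrier[OF wf assms(2)]
    by simp
qed

lemma circuit_unitary_expectation:
  assumes C: "circuit_wf C" and A: "A \<in> carrier_mat (2 ^ c_wires C) (2 ^ c_wires C)"
    and s: "\<sigma> \<in> carrier_mat (2 ^ c_wires C) (2 ^ c_wires C)"
  shows "mtrace (A * (circuit_unitary C * \<sigma> * mat_adjoint (circuit_unitary C))) =
    mtrace (foldr (heisenberg (c_wires C)) (c_gates C) A * \<sigma>)"
proof -
  let ?N = "2 ^ c_wires C :: nat" and ?U = "circuit_unitary C"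
  note U = circuit_unitary_carrier[OF C]
  have UA: "mat_adjoint ?U \<in> carrier_mat ?N ?N" using U by auto
  have "A * (?U * \<sigma> * mat_adjoint ?U) = (A * ?U * \<sigma>) * mat_adjoint ?U"
    using U UA A s by (simp add: assoc_mult_mat[of _ ?N ?N _ ?N _ ?N] mult_carrier_mat[of _ ?N ?N _ ?N])
  also have "mtrace \<dots> = mtrace (mat_adjoint ?U * (A * ?U * \<sigma>))"
    using U UA A s by (intro mtrace_comm[of _ ?N ?N]) (auto intro!: mult_carrier_mat)
  also have "mat_adjoint ?U * (A * ?U * \<sigma>) = (mat_adjoint ?U * A * ?U) * \<sigma>"
    using U UA A s by (simp add: assoc_mult_mat[of _ ?N ?N _ ?N _ ?N] mult_carrier_mat[of _ ?N ?N _ ?N])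
  finally show ?thesis
    unfolding circuit_unitary_conj[OF C A] .
qed

text \<open>Tracing out the other wires makes the (1, 1) entry the trace of the lower diagonal
  block, that is, the expectation of (1 - Z)/2 on the output wire. Pulling 1 and Z back separately
  through the circuit gives the two traces.\<close>

lemma run_circuit_accept:
  fixes C \<sigma>
  defines "\<sigma>' \<equiv> \<sigma> \<otimes>\<^sub>K basis_state (replicate (c_anc C) False)"
  assumes C: "circuit_wf C" "c_out C = 1" "c_wires C = Suc m"
    and s: "\<sigma>' \<in> carrier_mat (2 ^ Suc m) (2 ^ Suc m)"
  shows "run_circuit C \<sigma> $$ (1, 1) =
    (mtrace \<sigma>' - mtrace (foldr (heisenberg (Suc m)) (c_gates C)
       (kron_list (pauli_mat1 PauliZ # replicate m (1\<^sub>m 2))) * \<sigma>')) / 2"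
proof -
  define N where "N = (2 ^ m :: nat)"
  define M where "M = circuit_unitary C * \<sigma>' * mat_adjoint (circuit_unitary C)"
  have NN: "2 ^ Suc m = 2 * N" by (simp add: N_def)
  note U = circuit_unitary_carrier[OF C(1), unfolded C(3)]
  have M: "M \<in> carrier_mat (2 * N) (2 * N)"
    unfolding M_def NN[symmetric] using U s by (auto intro!: mult_carrier_mat)
  have Z: "kron_list (pauli_mat1 PauliZ # replicate m (1\<^sub>m 2)) = pauli_mat1 PauliZ \<otimes>\<^sub>K 1\<^sub>m N"
    by (simp add: kron_list_replicate_one N_def)
  have one: "1\<^sub>m (2 ^ Suc m) = 1\<^sub>m 2 \<otimes>\<^sub>K 1\<^sub>m N"
    by (simp add: kron_one N_def)
  have run: "run_circuit C \<sigma> $$ (1, 1) = mtrace (mat_block N M 1 1)"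
    unfolding run_circuit_def using C
    by (simp add: ptrace_second_def M_def[symmetric] \<sigma>'_def[symmetric] N_def[symmetric] mat_block_def mtrace_def)
  have one_mult: "1\<^sub>m N * mat_block N M i j = mat_block N M i j" for i j
    by (rule left_mult_one_mat) auto
  have wf: "\<forall>g \<in> set (c_gates C). gate_wf (Suc m) g"
    using C by (simp add: circuit_wf_def)
  have "mtrace \<sigma>' = mtrace (foldr (heisenberg (Suc m)) (c_gates C) (1\<^sub>m (2 ^ Suc m)) * \<sigma>')"
    by (simp only: foldr_heisenberg_one[OF wf] left_mult_one_mat[OF s])
  also have "\<dots> = mtrace (1\<^sub>m (2 ^ Suc m) * M)"
    unfolding M_def by (rule circuit_unitary_expectation[OF C(1), unfolded C(3), symmetric]) (use s in auto)
  also have "\<dots> = mtrace (mat_block N M 0 0) + mtrace (mat_block N M 1 1)"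
    unfolding one by (subst mtrace_kron_mult_block[OF _ _ M])
      (auto simp: numeral_2_eq_2 one_mult)
  finally have 1: "mtrace \<sigma>' = mtrace (mat_block N M 0 0) + mtrace (mat_block N M 1 1)" .
  have "mtrace (foldr (heisenberg (Suc m)) (c_gates C) (pauli_mat1 PauliZ \<otimes>\<^sub>K 1\<^sub>m N) * \<sigma>') =
      mtrace ((pauli_mat1 PauliZ \<otimes>\<^sub>K 1\<^sub>m N) * M)"
    using circuit_unitary_expectation[OF C(1), of "pauli_mat1 PauliZ \<otimes>\<^sub>K 1\<^sub>m N" \<sigma>'] s
      kron_carrier[OF pauli_mat1_carrier one_carrier_mat, of PauliZ N]
    by (simp only: C(3) M_def[symmetric] NN)
  also have "\<dots> = mtrace (mat_block N M 0 0) - mtrace (mat_block N M 1 1)"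
    by (subst mtrace_kron_mult_block[OF _ _ M])
      (auto simp: numeral_2_eq_2 one_mult pauli_mat1.simps mat_of_rows_list_def)
  finally show ?thesis unfolding run Z 1 by simp
qed

section \<open>A circuit measuring a Pauli string\<close>

text \<open>A change of basis followed by a CNOT that adds the outcome to the parity on wire 0. The
  gate set has no inverse of T, so the phase T^(-2) is written as T^6; two T gates would give -Y in
  place of Y.\<close>

fun pauli_block :: "nat \<Rightarrow> pauli \<Rightarrow> gate list" where
  "pauli_block w PauliI = []"
| "pauli_block w PauliX = [Hadamard w, CNot w 0]"
| "pauli_block w PauliY = replicate 6 (TGate w) @ [Hadamard w, CNot w 0]"
| "pauli_block w PauliZ = [CNot w 0]"

fun pauli_gates :: "nat \<Rightarrow> pauli list \<Rightarrow> gate list" where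
  "pauli_gates w [] = []"
| "pauli_gates w (P # Ps) = pauli_block w P @ pauli_gates (Suc w) Ps"

lemma foldr_heisenberg_tgate:
  assumes "w < length Bs" "set Bs \<subseteq> carrier_mat 2 2"
  shows "foldr (heisenberg (length Bs)) (replicate k (TGate w)) (kron_list (Bs[w := phase_x r])) =
    kron_list (Bs[w := phase_x (r + real k * (pi / 4))])"
proof (induction k)
  case (Suc k)
  have "phase_x s \<in> carrier_mat 2 2" for s by (simp add: phase_x_def)
  then have s: "set (Bs[w := phase_x s]) \<subseteq> carrier_mat 2 2" for s
    using set_update_carrier[OF assms(2)] by auto
  show ?case
    using heisenberg_tgate[OF _ s[of "r + real k * (pi / 4)"], of w] assms(1)
    by (simp only: replicate_Suc foldr.simps o_apply Suc.IH) (simp add: tgate_conj algebra_simps add_divide_distrib)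
qed simp

text \<open>Because XZX = -Z on wire 0, pulling back through the CNOT places a Z on wire
  \<open>w\<close>; the Hadamard gate turns it into X, and the six T gates rotate that X to
  Y.\<close>

lemma heisenberg_pauli_block:
  assumes Bs: "set Bs \<subseteq> carrier_mat 2 2" "Bs ! 0 = pauli_mat1 PauliZ"
    and w: "0 < w" "w < length Bs" "Bs ! w = 1\<^sub>m 2"
  shows "foldr (heisenberg (length Bs)) (pauli_block w P) (kron_list Bs) = kron_list (Bs[w := pauli_mat1 P])"
proof -
  have "pauli_mat1 PauliX * Bs ! 0 * pauli_mat1 PauliX = (- 1) \<cdot>\<^sub>m Bs ! 0"
    unfolding Bs by (simp add: pauli_mat1.simps mat2_simps)
  moreover have "0 < length Bs" "w \<noteq> 0" using w by auto
  ultimately have "heisenberg (length Bs) (CNot w 0) (kron_list Bs) =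
      kron_list (Bs[w := proj0 + (- 1) \<cdot>\<^sub>m proj1])"
    using heisenberg_cnot[OF w(2) _ _ Bs(1) w(3)] by blast
  then
  have Z: "heisenberg (length Bs) (CNot w 0) (kron_list Bs) = kron_list (Bs[w := pauli_mat1 PauliZ])"
    by (simp only: outer_unit_vec_simps)
  have X: "heisenberg (length Bs) (Hadamard w) (kron_list (Bs[w := pauli_mat1 PauliZ])) =
      kron_list (Bs[w := pauli_mat1 PauliX])"
    using heisenberg_hadamard[OF _ set_update_carrier[OF Bs(1) pauli_mat1_carrier], of w w PauliZ] w
    by (simp add: hadamard_conj)
  have Y: "foldr (heisenberg (length Bs)) (replicate 6 (TGate w)) (kron_list (Bs[w := pauli_mat1 PauliX])) =
      kron_list (Bs[w := pauli_mat1 PauliY])"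
    using foldr_heisenberg_tgate[OF w(2) Bs(1), of 6 0] by (simp only: phase_x_eq[symmetric]) simp
  show ?thesis
  proof (cases P)
    case PauliI
    then show ?thesis using list_update_id[of Bs w] w(3) by simp
  qed (simp_all only: pauli_block.simps foldr_append foldr.simps o_apply id_apply Z X Y)
qed

text \<open>A block touches only wire 0 and its own wire, so the string builds up factor by factor
  while the Z on wire 0 survives. \<open>R\<close> holds the wires before the current one and
  absorbs one identity factor per induction step; \<open>S\<close> holds the wires behind the
  measured register.\<close>

lemma heisenberg_pauli_gates:
  assumes "set R \<subseteq> carrier_mat 2 2" "set S \<subseteq> carrier_mat 2 2" "R \<noteq> []" "R ! 0 = pauli_mat1 PauliZ"
    and "m = length R + length Ps + length S"
  shows "foldr (heisenberg m) (pauli_gates (length R) Ps) (kron_list (R @ replicate (length Ps) (1\<^sub>m 2) @ S)) =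
    kron_list (R @ map pauli_mat1 Ps @ S)"
  using assms
proof (induction Ps arbitrary: R)
  case (Cons P Ps)
  let ?Bs = "R @ 1\<^sub>m 2 # map pauli_mat1 Ps @ S"
  have IH: "foldr (heisenberg m) (pauli_gates (Suc (length R)) Ps)
      (kron_list (R @ replicate (length (P # Ps)) (1\<^sub>m 2) @ S)) = kron_list ?Bs"
    using Cons.IH[of "R @ [1\<^sub>m 2]"] Cons.prems by (simp add: nth_append)
  have "foldr (heisenberg (length ?Bs)) (pauli_block (length R) P) (kron_list ?Bs) =
      kron_list (?Bs[length R := pauli_mat1 P])"
    using Cons.prems by (intro heisenberg_pauli_block) (auto simp: nth_append)
  moreover have "length ?Bs = m" using Cons.prems by simp
  ultimately have "foldr (heisenberg m) (pauli_block (length R) P) (kron_list ?Bs) =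
      kron_list (R @ map pauli_mat1 (P # Ps) @ S)"
    by simp
  then show ?case using IH by simp
qed simp

lemma pauli_block_wf: "g \<in> set (pauli_block w P) \<Longrightarrow> 0 < w \<Longrightarrow> w < m \<Longrightarrow> gate_wf m g"
  by (cases P) auto

lemma pauli_gates_wf: "g \<in> set (pauli_gates w Ps) \<Longrightarrow> 0 < w \<Longrightarrow> w + length Ps \<le> m \<Longrightarrow> gate_wf m g"
  by (induction Ps arbitrary: w) (auto dest: pauli_block_wf[where m = m])

lemma length_pauli_gates: "length (pauli_gates w Ps) \<le> 8 * length Ps"
proof (induction Ps arbitrary: w)
  case (Cons P Ps)
  have "length (pauli_block w P) \<le> 8" by (cases P) auto
  with Cons[of "Suc w"] show ?case by simp
qed simp

text \<open>The parity of the Pauli measurement is accumulated on wire 0. That wire starts in the first bit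
  of the input string, which only flips the sign of the outcome. The ancilla keeps the circuit
  well-formed when there are no input wires.\<close>

definition pauli_circuit :: "nat \<Rightarrow> pauli list \<Rightarrow> circuit" where
  "pauli_circuit d Ps = \<lparr>c_in = d + length Ps, c_anc = 1,
     c_gates = (if d = 0 then [] else pauli_gates d Ps), c_out = 1\<rparr>"

lemma pauli_circuit_wf: "circuit_wf (pauli_circuit d Ps)"
  by (auto simp: circuit_wf_def pauli_circuit_def c_wires_def intro: pauli_gates_wf)

lemma pauli_circuit_size: "circuit_size (pauli_circuit d Ps) \<le> d + 9 * length Ps + 2"
  using length_pauli_gates[of d Ps] by (auto simp: circuit_size_def pauli_circuit_def c_wires_def)

lemma basis_state_carrier [simp, intro]: "basis_state bs \<in> carrier_mat (2 ^ length bs) (2 ^ length bs)"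
proof -
  have "set (map (\<lambda>b. outer (unit_vec 2 (if b then 1 else 0))) bs) \<subseteq> carrier_mat 2 2"
    by auto
  from kron_list_carrier[OF this] show ?thesis by (simp add: basis_state_def)
qed

lemma basis_state_Cons: "basis_state (b # bs) = (if b then proj1 else proj0) \<otimes>\<^sub>K basis_state bs"
  by (simp add: basis_state_def)

lemma mtrace_basis_state [simp]: "mtrace (basis_state bs) = 1"
proof (induction bs)
  case (Cons b bs)
  then show ?case
    using mtrace_kron[OF _ basis_state_carrier, of "if b then proj1 else proj0" 2 bs]
    by (auto simp: basis_state_Cons outer_unit_vec_eq mat2_simps)
qed (simp add: basis_state_def mtrace_one)

text \<open>The pulled-back observable is Z on the first bit of \<open>x\<close>, the string
  \<open>Ps\<close> on the register of \<open>\<omega>\<close>, and the identity on the other input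
  bits and the ancilla. The trace factors accordingly, and the string \<open>x\<close> contributes
  only the eigenvalue of Z on its first bit.\<close>

lemma run_pauli_circuit:
  assumes x: "x \<noteq> []" and \<omega>: "\<omega> \<in> carrier_mat (2 ^ length Ps) (2 ^ length Ps)"
  shows "run_circuit (pauli_circuit (length x) Ps) (basis_state x \<otimes>\<^sub>K \<omega>) $$ (1, 1) =
    (mtrace \<omega> - (if hd x then - 1 else 1) * mtrace (pauli_mat Ps * \<omega>)) / 2"
proof -
  obtain b y where xy: "x = b # y" using x by (cases x) auto
  define C where "C = pauli_circuit (length x) Ps"
  define m where "m = length y + length Ps + 1"
  define \<sigma> where "\<sigma> = (basis_state x \<otimes>\<^sub>K \<omega>) \<otimes>\<^sub>K basis_state [False]"
  have \<sigma>: "\<sigma> = basis_state x \<otimes>\<^sub>K (\<omega> \<otimes>\<^sub>K basis_state [False])"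
    unfolding \<sigma>_def by (rule kron_assoc)
  have c1: "\<omega> \<otimes>\<^sub>K basis_state [False] \<in> carrier_mat (2 ^ length Ps * 2) (2 ^ length Ps * 2)"
    using kron_carrier[OF \<omega> basis_state_carrier[of "[False]"]] by simp
  have \<sigma>c: "\<sigma> \<in> carrier_mat (2 ^ Suc m) (2 ^ Suc m)"
    using kron_carrier[OF basis_state_carrier[of x] c1] unfolding \<sigma> xy m_def
    by (simp add: power_add mult_ac)
  have tr: "mtrace \<sigma> = mtrace \<omega>"
    unfolding \<sigma> using mtrace_kron[OF basis_state_carrier c1, of x] mtrace_kron[OF \<omega> basis_state_carrier, of "[False]"]
    by simp
  let ?R = "pauli_mat1 PauliZ # replicate (length y) (1\<^sub>m 2)"
  have "foldr (heisenberg (Suc m)) (c_gates C) (kron_list (pauli_mat1 PauliZ # replicate m (1\<^sub>m 2))) =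
      foldr (heisenberg (Suc m)) (pauli_gates (length ?R) Ps) (kron_list (?R @ replicate (length Ps) (1\<^sub>m 2) @ [1\<^sub>m 2]))"
  proof -
    have "replicate m (1\<^sub>m 2 :: complex mat) = replicate (length y) (1\<^sub>m 2) @ replicate (length Ps) (1\<^sub>m 2) @ [1\<^sub>m 2]"
      by (simp only: m_def replicate_add append_assoc) simp
    then show ?thesis by (simp add: C_def pauli_circuit_def xy)
  qed
  also have "\<dots> = kron_list (?R @ map pauli_mat1 Ps @ [1\<^sub>m 2])"
    by (rule heisenberg_pauli_gates)
      (use set_replicate_one_carrier[of "length y" 2] in \<open>auto simp: m_def\<close>)
  also have "\<dots> = (pauli_mat1 PauliZ \<otimes>\<^sub>K 1\<^sub>m (2 ^ length y)) \<otimes>\<^sub>K (pauli_mat Ps \<otimes>\<^sub>K 1\<^sub>m 2)"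
    by (simp add: kron_list_append kron_list_replicate_one pauli_mat_def kron_assoc)
  finally have obs: "foldr (heisenberg (Suc m)) (c_gates C) (kron_list (pauli_mat1 PauliZ # replicate m (1\<^sub>m 2))) = \<dots>" .
  have e: "2 ^ length x = 2 * (2 ^ length y :: nat)" by (simp add: xy)
  have c2: "pauli_mat1 PauliZ \<otimes>\<^sub>K 1\<^sub>m (2 ^ length y) \<in> carrier_mat (2 ^ length x) (2 ^ length x)"
    unfolding e by auto
  have c3: "pauli_mat Ps \<otimes>\<^sub>K 1\<^sub>m 2 \<in> carrier_mat (2 ^ length Ps * 2) (2 ^ length Ps * 2)"
    by (intro kron_carrier) auto
  have t1: "mtrace ((pauli_mat1 PauliZ \<otimes>\<^sub>K 1\<^sub>m (2 ^ length y)) * basis_state x) = (if b then - 1 else 1)"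
  proof -
    have "(pauli_mat1 PauliZ \<otimes>\<^sub>K 1\<^sub>m (2 ^ length y)) * basis_state x =
        (pauli_mat1 PauliZ * (if b then proj1 else proj0)) \<otimes>\<^sub>K (1\<^sub>m (2 ^ length y) * basis_state y)"
      unfolding xy basis_state_Cons by (rule kron_mult) auto
    also have "mtrace \<dots> = mtrace (pauli_mat1 PauliZ * (if b then proj1 else proj0)) * mtrace (1\<^sub>m (2 ^ length y) * basis_state y)"
      by (rule mtrace_kron[of _ 2 _ "2 ^ length y"]) (auto intro!: mult_carrier_mat)
    also have "1\<^sub>m (2 ^ length y) * basis_state y = basis_state y"
      by (rule left_mult_one_mat) auto
    finally show ?thesis
      by (auto simp: outer_unit_vec_eq pauli_mat1.simps mat2_simps)
  qed
  have t2: "mtrace ((pauli_mat Ps \<otimes>\<^sub>K 1\<^sub>m 2) * (\<omega> \<otimes>\<^sub>K basis_state [False])) = mtrace (pauli_mat Ps * \<omega>)"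
  proof -
    have bs: "basis_state [False] \<in> carrier_mat 2 2"
      using basis_state_carrier[of "[False]"] by simp
    have "(pauli_mat Ps \<otimes>\<^sub>K 1\<^sub>m 2) * (\<omega> \<otimes>\<^sub>K basis_state [False]) = (pauli_mat Ps * \<omega>) \<otimes>\<^sub>K basis_state [False]"
      using bs by (subst kron_mult[OF pauli_mat_carrier \<omega> one_carrier_mat bs]) simp
    then show ?thesis
      using mtrace_kron[OF mult_carrier_mat[OF pauli_mat_carrier \<omega>] bs] by simp
  qed
  have "mtrace (foldr (heisenberg (Suc m)) (c_gates C) (kron_list (pauli_mat1 PauliZ # replicate m (1\<^sub>m 2))) * \<sigma>) =
      mtrace (((pauli_mat1 PauliZ \<otimes>\<^sub>K 1\<^sub>m (2 ^ length y)) * basis_state x) \<otimes>\<^sub>K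
        ((pauli_mat Ps \<otimes>\<^sub>K 1\<^sub>m 2) * (\<omega> \<otimes>\<^sub>K basis_state [False])))"
    unfolding obs \<sigma> by (subst kron_mult[OF c2 basis_state_carrier c3 c1]) simp
  also have "\<dots> = (if b then - 1 else 1) * mtrace (pauli_mat Ps * \<omega>)"
    by (subst mtrace_kron[OF mult_carrier_mat[OF c2 basis_state_carrier] mult_carrier_mat[OF c3 c1]])
      (simp only: t1 t2)
  finally have obs_tr: "mtrace (foldr (heisenberg (Suc m)) (c_gates C) (kron_list (pauli_mat1 PauliZ # replicate m (1\<^sub>m 2))) * \<sigma>) = \<dots>" .
  have anc: "replicate (c_anc C) False = [False]" by (simp add: C_def pauli_circuit_def)
  have "run_circuit C (basis_state x \<otimes>\<^sub>K \<omega>) $$ (1, 1) = (mtrace \<sigma> -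
      mtrace (foldr (heisenberg (Suc m)) (c_gates C) (kron_list (pauli_mat1 PauliZ # replicate m (1\<^sub>m 2))) * \<sigma>)) / 2"
    using run_circuit_accept[of C m "basis_state x \<otimes>\<^sub>K \<omega>"] \<sigma>c pauli_circuit_wf[of "length x" Ps]
    unfolding anc \<sigma>_def[symmetric]
    by (simp add: C_def[symmetric] C_def pauli_circuit_def c_wires_def xy m_def)
  then show ?thesis
    unfolding obs_tr tr by (simp add: C_def xy)
qed

section \<open>Recovering matrix entries from Pauli expectations\<close>

text \<open>For the first qubit, I and Z give the sum and difference of the diagonal block traces,
  and X and Y those of the off-diagonal ones. Each block trace is then the average of two numbers of
  modulus at most \<open>e\<close>, so the bound passes to the blocks without growing with the
  number of qubits.\<close>

lemma pauli_inversion: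
  assumes "D \<in> carrier_mat (2 ^ m) (2 ^ m)"
    and "\<And>Ps. length Ps = m \<Longrightarrow> cmod (mtrace (pauli_mat Ps * D)) \<le> e"
    and "i < 2 ^ m" "j < 2 ^ m"
  shows "cmod (D $$ (i, j)) \<le> e"
  using assms
proof (induction m arbitrary: D i j)
  case 0
  have "mtrace (pauli_mat [] * D) = D $$ (0, 0)"
    using 0(1) left_mult_one_mat[of D 1 1] by (auto simp: mtrace_def)
  then show ?case using 0(2)[of "[]"] 0(3,4) by simp
next
  case (Suc m)
  define N where "N = (2 ^ m :: nat)"
  have D: "D \<in> carrier_mat (2 * N) (2 * N)" using Suc.prems(1) by (simp add: N_def)
  have block: "cmod (mtrace (pauli_mat Ps * mat_block N D a c)) \<le> e"
    if Ps: "length Ps = m" and ac: "a < 2" "c < 2" for Ps a c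
  proof -
    define b where "b a c = mtrace (pauli_mat Ps * mat_block N D a c)" for a c
    have Pc: "pauli_mat Ps \<in> carrier_mat N N"
      using pauli_mat_carrier[of Ps] Ps by (simp add: N_def)
    have le: "cmod (\<Sum>i<2. \<Sum>j<2. pauli_mat1 P $$ (i, j) * b j i) \<le> e" for P
      using Suc.prems(2)[of "P # Ps"] Ps mtrace_kron_mult_block[OF pauli_mat1_carrier Pc D, of P]
      by (simp add: b_def)
    have I: "cmod (b 0 0 + b 1 1) \<le> e" and X: "cmod (b 1 0 + b 0 1) \<le> e"
      and Y: "cmod (\<i> * b 0 1 - \<i> * b 1 0) \<le> e" and Z: "cmod (b 0 0 - b 1 1) \<le> e"
      using le[of PauliI] le[of PauliX] le[of PauliY] le[of PauliZ]
      by (simp_all add: numeral_2_eq_2 pauli_mat1.simps mat_of_rows_list_def)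
    have Y': "cmod (b 0 1 - b 1 0) \<le> e"
      using Y by (simp add: right_diff_distrib[symmetric] norm_mult)
    have half: "cmod x \<le> e" if "x = (y + z) / 2" "cmod y \<le> e" "cmod z \<le> e" for x y z
    proof -
      have "cmod x = cmod (y + z) / 2" unfolding that(1) by (simp add: norm_divide)
      then show ?thesis using norm_triangle_ineq[of y z] that(2,3) by linarith
    qed
    have Zm: "cmod (- (b 0 0 - b 1 1)) \<le> e" and Ym: "cmod (- (b 0 1 - b 1 0)) \<le> e"
      using Z Y' by (simp_all only: norm_minus_cancel)
    have "cmod (b 0 0) \<le> e" by (rule half[OF _ I Z]) simp
    moreover have "cmod (b 1 1) \<le> e" by (rule half[OF _ I Zm]) simp
    moreover have "cmod (b 0 1) \<le> e" by (rule half[OF _ X Y']) simp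
    moreover have "cmod (b 1 0) \<le> e" by (rule half[OF _ X Ym]) simp
    ultimately show ?thesis
      using ac unfolding b_def by (auto simp: less_2_cases_iff)
  qed
  \<comment> \<open>The leading bit of each index selects the block and the remaining bits select
    the entry inside it.\<close>
  have "cmod (mat_block N D (i div N) (j div N) $$ (i mod N, j mod N)) \<le> e"
    using Suc.prems(3,4) block
    by (intro Suc.IH) (auto simp: N_def[symmetric] less_mult_imp_div_less mod_less_of_less_mult)
  moreover have "i mod N < N" "j mod N < N" by (simp_all add: N_def)
  ultimately show ?case
    by (simp add: mat_block_def)
qed

section \<open>Vectors and density matrices\<close>

lemma conjugate_index [simp]: "i < dim_vec v \<Longrightarrow> conjugate v $ i = cnj (v $ i)"
  for v :: "complex vec"
  by (simp add: conjugate_vec_def)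

lemma cinner_sum: "w \<in> carrier_vec N \<Longrightarrow> v \<bullet>c w = (\<Sum>i<N. v $ i * cnj (w $ i))"
  for v w :: "complex vec"
  by (auto simp: scalar_prod_def lessThan_atLeast0)

lemma cinner_swap:
  assumes "v \<in> carrier_vec N" "w \<in> carrier_vec N"
  shows "w \<bullet>c v = cnj (v \<bullet>c w)"
  by (simp add: cinner_sum[OF assms(1)] cinner_sum[OF assms(2)] mult.commute)

lemma cinner_self: "v \<in> carrier_vec N \<Longrightarrow> v \<bullet>c v = complex_of_real (\<Sum>i<N. (cmod (v $ i))\<^sup>2)"
  for v :: "complex vec"
  by (simp add: cinner_sum complex_norm_square[symmetric])

lemma cinner_smult_left: "v \<in> carrier_vec N \<Longrightarrow> w \<in> carrier_vec N \<Longrightarrow> (c \<cdot>\<^sub>v v) \<bullet>c w = c * (v \<bullet>c w)"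
  for v w :: "complex vec"
  by (simp add: cinner_sum sum_distrib_left mult.assoc)

lemma cinner_smult_right: "v \<in> carrier_vec N \<Longrightarrow> w \<in> carrier_vec N \<Longrightarrow> v \<bullet>c (c \<cdot>\<^sub>v w) = cnj c * (v \<bullet>c w)"
  for v w :: "complex vec"
  by (simp add: cinner_sum[of _ N] sum_distrib_left mult_ac)

lemma cinner_diff_left:
  "u \<in> carrier_vec N \<Longrightarrow> v \<in> carrier_vec N \<Longrightarrow> w \<in> carrier_vec N \<Longrightarrow> (u - v) \<bullet>c w = u \<bullet>c w - v \<bullet>c w"
  for u v w :: "complex vec"
  by (simp add: cinner_sum sum_subtractf algebra_simps)

lemma cinner_diff_right:
  "u \<in> carrier_vec N \<Longrightarrow> v \<in> carrier_vec N \<Longrightarrow> w \<in> carrier_vec N \<Longrightarrow> w \<bullet>c (u - v) = w \<bullet>c u - w \<bullet>c v"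
  for u v w :: "complex vec"
  by (simp add: cinner_sum[of _ N] sum_subtractf algebra_simps)

lemma cinner_mat_adjoint:
  fixes A :: "complex mat"
  assumes A: "A \<in> carrier_mat N N" and v: "v \<in> carrier_vec N" and w: "w \<in> carrier_vec N"
  shows "(A *\<^sub>v v) \<bullet>c w = v \<bullet>c (mat_adjoint A *\<^sub>v w)"
proof -
  have Aw: "mat_adjoint A *\<^sub>v w \<in> carrier_vec N"
    by (rule mult_mat_vec_carrier[OF mat_adjoint_carrier[OF A] w])
  have "(A *\<^sub>v v) \<bullet>c w = (\<Sum>i<N. \<Sum>j<N. A $$ (i, j) * v $ j * cnj (w $ i))"
    unfolding cinner_sum[OF w] using A v
    by (intro sum.cong refl) (auto simp: scalar_prod_def sum_distrib_right lessThan_atLeast0)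
  also have "\<dots> = (\<Sum>j<N. \<Sum>i<N. A $$ (i, j) * v $ j * cnj (w $ i))"
    by (rule sum.swap)
  also have "\<dots> = v \<bullet>c (mat_adjoint A *\<^sub>v w)"
    unfolding cinner_sum[OF Aw] using A w
    by (intro sum.cong refl) (auto simp: scalar_prod_def sum_distrib_left lessThan_atLeast0 mult_ac)
  finally show ?thesis .
qed

section \<open>Unit vectors, outer products and positivity\<close>

lemma unit_state_carrier: "unit_state N v \<Longrightarrow> v \<in> carrier_vec N"
  by (simp add: unit_state_def)

lemma unit_state_norm: "unit_state N v \<Longrightarrow> (\<Sum>i<N. (cmod (v $ i))\<^sup>2) = 1"
  unfolding unit_state_def using cinner_self[of v N] by (metis of_real_eq_1_iff)

lemma unit_state_index_le:
  assumes "unit_state N v" "i < N"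
  shows "cmod (v $ i) \<le> 1"
proof -
  have "(cmod (v $ i))\<^sup>2 \<le> (\<Sum>i<N. (cmod (v $ i))\<^sup>2)"
    using assms(2) by (intro member_le_sum) auto
  then show ?thesis
    using unit_state_norm[OF assms(1)] by (simp add: abs_square_le_1)
qed

lemma cauchy_schwarz_unit:
  assumes "unit_state N v" "unit_state N w"
  shows "cmod (v \<bullet>c w) \<le> 1"
proof -
  have "cmod (v \<bullet>c w) \<le> (\<Sum>i<N. cmod (v $ i) * cmod (w $ i))"
    unfolding cinner_sum[OF unit_state_carrier[OF assms(2)]]
    by (rule order_trans[OF norm_sum]) (simp add: norm_mult)
  also have "\<dots> \<le> L2_set (\<lambda>i. cmod (v $ i)) {..<N} * L2_set (\<lambda>i. cmod (w $ i)) {..<N}"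
    using L2_set_mult_ineq[of "\<lambda>i. cmod (v $ i)" "\<lambda>i. cmod (w $ i)" "{..<N}"] by simp
  also have "\<dots> = 1"
    by (simp add: L2_set_def unit_state_norm[OF assms(1)] unit_state_norm[OF assms(2)])
  finally show ?thesis .
qed

lemma outer_index [simp]: "v \<in> carrier_vec N \<Longrightarrow> i < N \<Longrightarrow> j < N \<Longrightarrow> outer v $$ (i, j) = v $ i * cnj (v $ j)"
  by (auto simp: outer_def)

lemma dim_outer: "dim_row (outer v) = dim_vec v" "dim_col (outer v) = dim_vec v"
  by (simp_all add: outer_def)

lemma outer_adjoint [simp]: "mat_adjoint (outer v) = outer v"
  by (rule eq_matI) (auto simp: outer_def mult.commute)

lemma mtrace_outer: "v \<in> carrier_vec N \<Longrightarrow> mtrace (outer v) = v \<bullet>c v"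
  by (simp add: cinner_sum mtrace_def) (auto simp: outer_def)

lemma outer_mult_vec:
  assumes "w \<in> carrier_vec N" "v \<in> carrier_vec N"
  shows "outer w *\<^sub>v v = (v \<bullet>c w) \<cdot>\<^sub>v w"
  using assms
  by (intro eq_vecI) (auto simp: cinner_sum outer_def scalar_prod_def lessThan_atLeast0 sum_distrib_right
      sum_distrib_left mult_ac)

lemma expval_sum:
  assumes "A \<in> carrier_mat N N" "v \<in> carrier_vec N"
  shows "expval A v = (\<Sum>i<N. \<Sum>j<N. A $$ (i, j) * v $ j * cnj (v $ i))"
  using assms
  by (simp add: expval_def cinner_sum scalar_prod_def lessThan_atLeast0 sum_distrib_right)

lemma expval_add:
  assumes "A \<in> carrier_mat N N" "B \<in> carrier_mat N N" "v \<in> carrier_vec N"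
  shows "expval (A + B) v = expval A v + expval B v"
  using assms by (simp add: expval_sum[of _ N] sum.distrib algebra_simps)

lemma expval_smult:
  assumes "A \<in> carrier_mat N N" "v \<in> carrier_vec N"
  shows "expval (c \<cdot>\<^sub>m A) v = c * expval A v"
  using assms by (simp add: expval_sum[of _ N] sum_distrib_left mult_ac)

lemma expval_outer:
  assumes "w \<in> carrier_vec N" "v \<in> carrier_vec N"
  shows "expval (outer w) v = complex_of_real ((cmod (v \<bullet>c w))\<^sup>2)"
  using assms cinner_swap[OF assms(2,1)]
  by (simp add: expval_def outer_mult_vec cinner_smult_left[of _ N] complex_norm_square[symmetric])

lemma expval_conj:
  assumes A: "A \<in> carrier_mat N N" and V: "V \<in> carrier_mat N N" "mat_adjoint V = V" and v: "v \<in> carrier_vec N"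
  shows "expval (V * A * V) v = expval A (V *\<^sub>v v)"
proof -
  have Vv: "V *\<^sub>v v \<in> carrier_vec N" using V v by auto
  have "(V * A * V) *\<^sub>v v = V *\<^sub>v (A *\<^sub>v (V *\<^sub>v v))"
    using A V v by (simp add: assoc_mult_mat_vec[of _ N N _ N] mult_carrier_mat[of _ N N _ N])
  then show ?thesis
    using cinner_mat_adjoint[OF V(1) mult_mat_vec_carrier[OF A Vv] v] V(2) by (simp add: expval_def)
qed

lemma psd_mat_add: "psd_mat N A \<Longrightarrow> psd_mat N B \<Longrightarrow> psd_mat N (A + B)"
  by (auto simp: psd_mat_def expval_add[of _ N] intro: add_nonneg_nonneg)

lemma psd_mat_smult:
  assumes "psd_mat N A" "0 \<le> c"
  shows "psd_mat N (complex_of_real c \<cdot>\<^sub>m A)"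
  using assms by (auto simp: psd_mat_def expval_smult[of _ N] less_eq_complex_def intro!: mult_nonneg_nonneg)

lemma psd_mat_outer: "v \<in> carrier_vec N \<Longrightarrow> psd_mat N (outer v)"
  by (auto simp: psd_mat_def expval_outer[of _ N] less_eq_complex_def)

lemma density_mat_outer: "unit_state N v \<Longrightarrow> density_mat N (outer v)"
  by (auto simp: density_mat_def unit_state_def psd_mat_outer mtrace_outer[of _ N])

lemma density_mat_mix:
  assumes A: "density_mat N A" and B: "density_mat N B" and e: "0 \<le> \<eta>" "\<eta> \<le> 1"
  shows "density_mat N (complex_of_real \<eta> \<cdot>\<^sub>m A + complex_of_real (1 - \<eta>) \<cdot>\<^sub>m B)"
proof -
  have c: "A \<in> carrier_mat N N" "B \<in> carrier_mat N N"
    and t: "mtrace A = 1" "mtrace B = 1" using A B by (auto simp: density_mat_def psd_mat_def)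
  have "psd_mat N (complex_of_real \<eta> \<cdot>\<^sub>m A + complex_of_real (1 - \<eta>) \<cdot>\<^sub>m B)"
    using A B e by (intro psd_mat_add psd_mat_smult) (auto simp: density_mat_def)
  moreover have "mtrace (complex_of_real \<eta> \<cdot>\<^sub>m A + complex_of_real (1 - \<eta>) \<cdot>\<^sub>m B) = 1"
    using c t by (simp add: mtrace_add[of _ N] mtrace_smult[of _ N] flip: of_real_add)
  ultimately show ?thesis by (simp add: density_mat_def)
qed

lemma density_mat_conj:
  assumes r: "density_mat N \<rho>" and V: "V \<in> carrier_mat N N" "mat_adjoint V = V" "V * V = 1\<^sub>m N"
  shows "density_mat N (V * \<rho> * V)"
proof -
  have c: "\<rho> \<in> carrier_mat N N" and p: "\<And>v. v \<in> carrier_vec N \<Longrightarrow> 0 \<le> expval \<rho> v" and t: "mtrace \<rho> = 1"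
    using r by (auto simp: density_mat_def psd_mat_def)
  have "mtrace (V * \<rho> * V) = mtrace (V * (V * \<rho>))"
    using V c by (intro mtrace_comm[of _ N N]) auto
  also have "V * (V * \<rho>) = \<rho>"
    using V c by (simp flip: assoc_mult_mat[of V N N V N \<rho> N])
  finally have "mtrace (V * \<rho> * V) = 1" using t by simp
  moreover have "psd_mat N (V * \<rho> * V)"
    unfolding psd_mat_def
  proof (intro conjI ballI)
    fix v :: "complex vec" assume v: "v \<in> carrier_vec N"
    show "0 \<le> expval (V * \<rho> * V) v"
      unfolding expval_conj[OF c V(1,2) v] using V v by (intro p) auto
  qed (use V c in auto)
  ultimately show ?thesis by (simp add: density_mat_def)
qed

section \<open>Product vectors\<close>

lemma kron_vec_carrier [simp, intro]:
  "v \<in> carrier_vec a \<Longrightarrow> w \<in> carrier_vec b \<Longrightarrow> kron_vec v w \<in> carrier_vec (a * b)"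
  by (auto simp: kron_vec_def)

lemma kron_vec_index: "w \<in> carrier_vec b \<Longrightarrow> v \<in> carrier_vec a \<Longrightarrow> i < a * b \<Longrightarrow>
    kron_vec v w $ i = v $ (i div b) * w $ (i mod b)"
  by (auto simp: kron_vec_def)

lemma cinner_kron_vec:
  assumes "v \<in> carrier_vec a" "v' \<in> carrier_vec a" "w \<in> carrier_vec b" "w' \<in> carrier_vec b"
  shows "kron_vec v w \<bullet>c kron_vec v' w' = (v \<bullet>c v') * (w \<bullet>c w')"
proof -
  have "kron_vec v w \<bullet>c kron_vec v' w' =
      (\<Sum>i<a * b. (v $ (i div b) * cnj (v' $ (i div b))) * (w $ (i mod b) * cnj (w' $ (i mod b))))"
    unfolding cinner_sum[OF kron_vec_carrier[OF assms(2,4)]]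
    using assms by (intro sum.cong refl) (simp add: kron_vec_index[of _ b _ a])
  also have "\<dots> = (\<Sum>i<a. \<Sum>j<b. (v $ i * cnj (v' $ i)) * (w $ j * cnj (w' $ j)))"
    by (rule sum_div_mod)
  finally show ?thesis
    by (simp add: cinner_sum[OF assms(2)] cinner_sum[OF assms(4)] sum_product)
qed

lemma unit_state_kron_vec: "unit_state a v \<Longrightarrow> unit_state b w \<Longrightarrow> unit_state (a * b) (kron_vec v w)"
  by (auto simp: unit_state_def cinner_kron_vec[of _ a _ _ b])

lemma outer_kron_vec:
  assumes "v \<in> carrier_vec a" "w \<in> carrier_vec b"
  shows "outer (kron_vec v w) = outer v \<otimes>\<^sub>K outer w"
proof (rule eq_matI)
  fix i j assume "i < dim_row (outer v \<otimes>\<^sub>K outer w)" "j < dim_col (outer v \<otimes>\<^sub>K outer w)"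
  then have ij: "i < a * b" "j < a * b" using assms by (auto simp: outer_def)
  then have "i div b < a" "j div b < a" "i mod b < b" "j mod b < b"
    by (auto simp: less_mult_imp_div_less mod_less_of_less_mult)
  then show "outer (kron_vec v w) $$ (i, j) = (outer v \<otimes>\<^sub>K outer w) $$ (i, j)"
    using assms ij outer_carrier[OF assms(1)] outer_carrier[OF assms(2)]
    by (simp add: outer_index[OF kron_vec_carrier[OF assms]] index_kron[of i "outer v" "outer w" j]
        kron_vec_index[of w b v a] dim_outer carrier_vecD[OF assms(1)] carrier_vecD[OF assms(2)])
qed (use assms in \<open>auto simp: outer_def kron_vec_def\<close>)

lemma kron_mult_vec:
  assumes A: "A \<in> carrier_mat a a" and B: "B \<in> carrier_mat b b"
    and v: "v \<in> carrier_vec a" and w: "w \<in> carrier_vec b"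
  shows "(A \<otimes>\<^sub>K B) *\<^sub>v kron_vec v w = kron_vec (A *\<^sub>v v) (B *\<^sub>v w)"
proof (rule eq_vecI)
  fix i assume "i < dim_vec (kron_vec (A *\<^sub>v v) (B *\<^sub>v w))"
  then have i: "i < a * b" using A B by (simp add: kron_vec_def)
  then have id: "i div b < a" "i mod b < b" by (auto simp: less_mult_imp_div_less mod_less_of_less_mult)
  have "((A \<otimes>\<^sub>K B) *\<^sub>v kron_vec v w) $ i = (\<Sum>k<a * b. (A \<otimes>\<^sub>K B) $$ (i, k) * kron_vec v w $ k)"
    using A B i v w by (simp add: scalar_prod_def lessThan_atLeast0 kron_vec_def)
  also have "\<dots> = (\<Sum>k<a * b. (A $$ (i div b, k div b) * v $ (k div b)) * (B $$ (i mod b, k mod b) * w $ (k mod b)))"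
    using A B i v w by (intro sum.cong refl) (simp add: index_kron kron_vec_index[of w b v a])
  also have "\<dots> = (\<Sum>k<a. \<Sum>l<b. (A $$ (i div b, k) * v $ k) * (B $$ (i mod b, l) * w $ l))"
    by (rule sum_div_mod)
  also have "\<dots> = kron_vec (A *\<^sub>v v) (B *\<^sub>v w) $ i"
    using A B v w i id
    by (simp add: kron_vec_index[of "B *\<^sub>v w" b "A *\<^sub>v v" a] sum_product scalar_prod_def lessThan_atLeast0)
  finally show "((A \<otimes>\<^sub>K B) *\<^sub>v kron_vec v w) $ i = kron_vec (A *\<^sub>v v) (B *\<^sub>v w) $ i" .
qed (use A B in \<open>auto simp: kron_vec_def\<close>)

lemma expval_kron:
  assumes "A \<in> carrier_mat a a" "B \<in> carrier_mat b b" "v \<in> carrier_vec a" "w \<in> carrier_vec b"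
  shows "expval (A \<otimes>\<^sub>K B) (kron_vec v w) = expval A v * expval B w"
  using assms by (simp add: expval_def kron_mult_vec cinner_kron_vec[of _ a _ _ b])

fun vec_power :: "complex vec \<Rightarrow> nat \<Rightarrow> complex vec" where
  "vec_power v 0 = unit_vec 1 0"
| "vec_power v (Suc t) = kron_vec v (vec_power v t)"

lemma unit_state_vec_power: "unit_state a v \<Longrightarrow> unit_state (a ^ t) (vec_power v t)"
proof (induction t)
  case 0
  show ?case by (simp add: unit_state_def cinner_sum[of _ 1])
qed (simp add: unit_state_kron_vec)

text \<open>The reason for giving the distinguisher \<open>t\<close> copies: a linear functional of
  the joint state then computes the \<open>t\<close>-th power of an overlap.\<close>

lemma expval_tensor_power:
  assumes "A \<in> carrier_mat a a" "unit_state a v"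
  shows "expval (tensor_power A t) (vec_power v t) = expval A v ^ t"
proof (induction t)
  case 0
  show ?case by (simp add: expval_sum[of _ 1])
next
  case (Suc t)
  then show ?case
    using assms unit_state_vec_power[OF assms(2), of t]
    by (simp add: expval_kron[of _ a _ "a ^ t"] unit_state_def)
qed

section \<open>Moments of Haar-random states\<close>

lemma power_le_fact_exp:
  fixes x :: real
  assumes "0 \<le> x"
  shows "x ^ k \<le> fact k * exp x"
proof -
  have "(\<Sum>n\<in>{k}. x ^ n /\<^sub>R fact n) \<le> (\<Sum>n. x ^ n /\<^sub>R fact n)"
    using assms by (intro sum_le_suminf summable_exp_generic) auto
  then have "x ^ k / fact k \<le> exp x"
    by (simp add: exp_def scaleR_conv_of_real divide_inverse mult.commute)
  then show ?thesis by (simp add: field_simps)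
qed

text \<open>Using both exponentials removes the absolute value, so that the average over random
  signs factorises.\<close>

lemma even_power_le_fact_exp:
  fixes x :: real
  shows "x ^ (2 * k) \<le> fact (2 * k) * (exp x + exp (- x))"
proof -
  have "x ^ (2 * k) = \<bar>x\<bar> ^ (2 * k)" by (simp add: power_even_abs)
  also have "\<dots> \<le> fact (2 * k) * exp \<bar>x\<bar>" by (rule power_le_fact_exp) simp
  also have "\<dots> \<le> fact (2 * k) * (exp x + exp (- x))"
    by (intro mult_left_mono) (auto simp: abs_if)
  finally show ?thesis .
qed

text \<open>A weak form of cosh(x) <= exp(x^2/2), sufficient here because the coordinates of a
  vector of norm at most 1 satisfy the restriction on \<open>x\<close>.\<close>

lemma exp_add_exp_minus_le:
  fixes x :: real
  assumes "\<bar>x\<bar> \<le> 1"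
  shows "exp x + exp (- x) \<le> 2 * exp (x\<^sup>2)"
proof -
  have *: "exp y + exp (- y) \<le> 2 * (1 + y\<^sup>2)" if y: "0 \<le> y" "y \<le> 1" for y :: real
  proof -
    \<comment> \<open>The product equals 1 + y^3.\<close>
    have "1 \<le> (1 - y + y\<^sup>2) * (1 + y)"
      using y by (simp add: algebra_simps power2_eq_square)
    also have "\<dots> \<le> (1 - y + y\<^sup>2) * exp y"
      using y by (intro mult_left_mono exp_ge_add_one_self) auto
    finally have "exp (- y) \<le> 1 - y + y\<^sup>2"
      by (simp add: exp_minus field_simps)
    moreover have "exp y \<le> 1 + y + y\<^sup>2" using y by (rule exp_bound)
    ultimately show ?thesis by simp
  qed
  have "exp x + exp (- x) \<le> 2 * (1 + x\<^sup>2)"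
    using *[of "\<bar>x\<bar>"] assms by (cases "0 \<le> x") (auto simp: abs_if)
  also have "\<dots> \<le> 2 * exp (x\<^sup>2)"
    by (intro mult_left_mono exp_ge_add_one_self) auto
  finally show ?thesis .
qed

text \<open>Sign vectors are indexed by subsets of \<open>{..<N}\<close>, so that averages over them
  are sums over \<open>Pow {..<N}\<close> and match the expansion of a product of sums.\<close>

definition subset_sign :: "nat set \<Rightarrow> nat \<Rightarrow> real" where
  "subset_sign S i = (if i \<in> S then 1 else - 1)"

text \<open>Up to the factor 2^N this is the moment generating function of a Rademacher sum:
  expanding the product chooses one sign per coordinate.\<close>

lemma sum_exp_signs:
  fixes x :: "nat \<Rightarrow> real"
  shows "(\<Sum>S\<in>Pow {..<N}. exp (\<Sum>i<N. subset_sign S i * x i)) = (\<Prod>i<N. exp (x i) + exp (- x i))"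
proof -
  have "exp (\<Sum>i<N. subset_sign S i * x i) = (\<Prod>i\<in>S. exp (x i)) * (\<Prod>i\<in>{..<N} - S. exp (- x i))"
    if "S \<in> Pow {..<N}" for S
  proof -
    have S: "S \<subseteq> {..<N}" using that by auto
    have "exp (\<Sum>i<N. subset_sign S i * x i) = (\<Prod>i<N. exp (subset_sign S i * x i))"
      by (simp add: exp_sum)
    also have "\<dots> = (\<Prod>i\<in>{..<N} - S. exp (subset_sign S i * x i)) * (\<Prod>i\<in>S. exp (subset_sign S i * x i))"
      by (rule prod.subset_diff[OF S]) simp
    also have "(\<Prod>i\<in>{..<N} - S. exp (subset_sign S i * x i)) = (\<Prod>i\<in>{..<N} - S. exp (- x i))"
      by (intro prod.cong) (auto simp: subset_sign_def)
    also have "(\<Prod>i\<in>S. exp (subset_sign S i * x i)) = (\<Prod>i\<in>S. exp (x i))"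
      by (intro prod.cong) (auto simp: subset_sign_def)
    finally show ?thesis by (simp add: mult.commute)
  qed
  then show ?thesis by (simp add: prod_add)
qed

text \<open>The exponential moment is at most 2^N exp(1), hence at most 3 times 2^N whatever the
  dimension. Applying this to \<open>x\<close> and to its negative produces the constant 6.\<close>

lemma khintchine_real:
  fixes x :: "nat \<Rightarrow> real"
  assumes x: "(\<Sum>i<N. (x i)\<^sup>2) \<le> 1"
  shows "(\<Sum>S\<in>Pow {..<N}. (\<Sum>i<N. subset_sign S i * x i) ^ (2 * t)) \<le> 2 ^ N * (6 * fact (2 * t))"
proof -
  have abs: "\<bar>x i\<bar> \<le> 1" if "i < N" for i
  proof -
    have "(x i)\<^sup>2 \<le> (\<Sum>i<N. (x i)\<^sup>2)" using that by (intro member_le_sum) auto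
    with x show ?thesis by (simp add: abs_square_le_1[symmetric])
  qed
  have pr: "(\<Sum>S\<in>Pow {..<N}. exp (\<Sum>i<N. subset_sign S i * y i)) \<le> 2 ^ N * 3"
    if y: "\<And>i. i < N \<Longrightarrow> \<bar>y i\<bar> \<le> 1" "(\<Sum>i<N. (y i)\<^sup>2) \<le> 1" for y :: "nat \<Rightarrow> real"
  proof -
    have "(\<Prod>i<N. exp (y i) + exp (- y i)) \<le> (\<Prod>i<N. 2 * exp ((y i)\<^sup>2))"
      using y(1) by (intro prod_mono conjI exp_add_exp_minus_le) (auto intro: add_nonneg_nonneg)
    also have "\<dots> = 2 ^ N * exp (\<Sum>i<N. (y i)\<^sup>2)"
      by (simp add: prod.distrib exp_sum)
    also have "\<dots> \<le> 2 ^ N * exp 1" using y(2) by (intro mult_left_mono) auto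
    also have "\<dots> \<le> 2 ^ N * 3" using exp_le by (intro mult_left_mono) auto
    finally show ?thesis by (simp add: sum_exp_signs)
  qed
  have "(\<Sum>S\<in>Pow {..<N}. (\<Sum>i<N. subset_sign S i * x i) ^ (2 * t)) \<le>
      (\<Sum>S\<in>Pow {..<N}. fact (2 * t) * (exp (\<Sum>i<N. subset_sign S i * x i) + exp (\<Sum>i<N. subset_sign S i * - x i)))"
    using even_power_le_fact_exp[where k = t] by (intro sum_mono) (simp add: sum_negf)
  also have "\<dots> = fact (2 * t) * ((\<Sum>S\<in>Pow {..<N}. exp (\<Sum>i<N. subset_sign S i * x i)) +
      (\<Sum>S\<in>Pow {..<N}. exp (\<Sum>i<N. subset_sign S i * - x i)))"
    by (simp add: sum_distrib_left sum.distrib distrib_left)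
  also have "\<dots> \<le> fact (2 * t) * (2 ^ N * 3 + 2 ^ N * 3)"
    using abs x by (intro mult_left_mono add_mono pr) auto
  finally show ?thesis by (simp add: mult_ac)
qed

text \<open>Real and imaginary parts are bounded separately, and (a + b)^t <= 2^t (a^t + b^t)
  recombines their squares.\<close>

lemma khintchine_complex:
  fixes z :: "nat \<Rightarrow> complex"
  assumes z: "(\<Sum>i<N. (cmod (z i))\<^sup>2) \<le> 1"
  shows "(\<Sum>S\<in>Pow {..<N}. cmod (\<Sum>i<N. of_real (subset_sign S i) * z i) ^ (2 * t)) \<le>
    2 ^ N * (12 * 2 ^ t * fact (2 * t))"
proof -
  let ?A = "\<lambda>S. \<Sum>i<N. subset_sign S i * Re (z i)" and ?B = "\<lambda>S. \<Sum>i<N. subset_sign S i * Im (z i)"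
  have xy: "(\<Sum>i<N. (Re (z i))\<^sup>2) \<le> 1" "(\<Sum>i<N. (Im (z i))\<^sup>2) \<le> 1"
    using z by (auto intro!: order_trans[OF sum_mono z] simp: cmod_power2)
  have pow: "(a + b) ^ t \<le> 2 ^ t * (a ^ t + b ^ t)" if "0 \<le> a" "0 \<le> b" for a b :: real
  proof -
    have "(a + b) ^ t \<le> (2 * max a b) ^ t" using that by (intro power_mono) auto
    also have "\<dots> \<le> 2 ^ t * (a ^ t + b ^ t)"
      using that by (simp add: power_mult_distrib max_def)
    finally show ?thesis .
  qed
  have "cmod (\<Sum>i<N. of_real (subset_sign S i) * z i) ^ (2 * t) = ((?A S)\<^sup>2 + (?B S)\<^sup>2) ^ t" for S
    by (simp add: power_mult cmod_power2)
  also have "((?A S)\<^sup>2 + (?B S)\<^sup>2) ^ t \<le> 2 ^ t * (?A S ^ (2 * t) + ?B S ^ (2 * t))" for S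
    using pow[of "(?A S)\<^sup>2" "(?B S)\<^sup>2"] by (simp add: power_mult)
  finally have "(\<Sum>S\<in>Pow {..<N}. cmod (\<Sum>i<N. of_real (subset_sign S i) * z i) ^ (2 * t)) \<le>
      (\<Sum>S\<in>Pow {..<N}. 2 ^ t * (?A S ^ (2 * t) + ?B S ^ (2 * t)))"
    by (intro sum_mono)
  also have "\<dots> = 2 ^ t * ((\<Sum>S\<in>Pow {..<N}. ?A S ^ (2 * t)) + (\<Sum>S\<in>Pow {..<N}. ?B S ^ (2 * t)))"
    by (simp add: sum_distrib_left sum.distrib distrib_left)
  also have "\<dots> \<le> 2 ^ t * (2 ^ N * (6 * fact (2 * t)) + 2 ^ N * (6 * fact (2 * t)))"
    using xy by (intro mult_left_mono add_mono khintchine_real) auto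
  finally show ?thesis by (simp add: mult_ac)
qed

section \<open>Householder reflections\<close>

lemma mult_unit_vec_col:
  fixes A :: "complex mat"
  assumes "A \<in> carrier_mat a b" "j < b"
  shows "A *\<^sub>v unit_vec b j = col A j"
  using assms by (intro eq_vecI) auto

text \<open>After a phase change of \<open>b\<close> the inner product with \<open>u\<close> is
  real, and the reflection along the difference exchanges the two vectors. It is self-adjoint, so it
  can be moved to the other side of the inner product; the phase disappears in the modulus.\<close>

lemma householder:
  assumes b: "unit_state N b" and u: "unit_state N u"
  shows "\<exists>U. unitary_mat N U \<and> (\<forall>v \<in> carrier_vec N. cmod ((U *\<^sub>v v) \<bullet>c b) = cmod (v \<bullet>c u))"
proof -
  have bc: "b \<in> carrier_vec N" and uc: "u \<in> carrier_vec N" and b1: "b \<bullet>c b = 1" and u1: "u \<bullet>c u = 1"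
    using b u by (auto simp: unit_state_def)
  define r where "r = u \<bullet>c b"
  \<comment> \<open>Makes the inner product of \<open>u\<close> with
    \<open>\<alpha> \<cdot>\<^sub>v b\<close> real and nonnegative; any phase works when
    \<open>r = 0\<close>.\<close>
  define \<alpha> where "\<alpha> = (if r = 0 then 1 else r / of_real (cmod r))"
  have a1: "cmod \<alpha> = 1" by (simp add: \<alpha>_def norm_divide)
  define b' where "b' = \<alpha> \<cdot>\<^sub>v b"
  have b'c: "b' \<in> carrier_vec N" using bc by (simp add: b'_def)
  have ub': "u \<bullet>c b' = of_real (cmod r)"
  proof -
    have "u \<bullet>c b' = cnj \<alpha> * r" using uc bc by (simp add: b'_def cinner_smult_right[of _ N] r_def)
    also have "\<dots> = of_real (cmod r)"
      by (auto simp: \<alpha>_def mult.commute complex_norm_square[symmetric] power2_eq_square field_simps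
          simp flip: of_real_mult)
    finally show ?thesis .
  qed
  have b'u: "b' \<bullet>c u = of_real (cmod r)"
    using cinner_swap[OF uc b'c] ub' by simp
  have b'1: "b' \<bullet>c b' = 1"
    using bc b1 a1 by (simp add: b'_def cinner_smult_right[of _ N] cinner_smult_left[of _ N]
        complex_norm_square[symmetric] mult.commute[of "cnj \<alpha>"] flip: mult.assoc)
  have cm: "cmod (v \<bullet>c b') = cmod (v \<bullet>c b)" if "v \<in> carrier_vec N" for v
    using that bc a1 by (simp add: b'_def cinner_smult_right[of _ N] norm_mult)
  define w where "w = b' - u"
  have wc: "w \<in> carrier_vec N" using b'c uc by (simp add: w_def)
  define q where "q = 2 - 2 * cmod r"
  have ww: "w \<bullet>c w = of_real q"
    using b'c uc by (simp add: w_def cinner_diff_left[of _ N] cinner_diff_right[of _ N] b'1 u1 b'u ub' q_def)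
  have wb': "w \<bullet>c b' = of_real (q / 2)"
    using b'c uc by (simp add: w_def cinner_diff_left[of _ N] b'1 ub' q_def)
  show ?thesis
  \<comment> \<open>Here \<open>q\<close> is the squared length of \<open>w\<close>. When it
    vanishes there is no reflection to take, but then \<open>b'\<close> already equals
    \<open>u\<close>.\<close>
  proof (cases "q = 0")
    case True
    then have "w = 0\<^sub>v N" using ww conjugate_square_eq_0_vec[OF wc] by simp
    then have "w $ i = 0" if "i < N" for i using that by simp
    then have "b' = u" using b'c uc unfolding w_def by (intro eq_vecI) auto
    then show ?thesis
      using cm by (intro exI[of _ "1\<^sub>m N"]) (auto simp: unitary_mat_def)
  next
    case False
    define c where "c = complex_of_real (2 / q)"
    define U where "U = 1\<^sub>m N - c \<cdot>\<^sub>m outer w"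
    have oc: "outer w \<in> carrier_mat N N" using wc by simp
    have Uc: "U \<in> carrier_mat N N" unfolding U_def by (rule minus_carrier_mat[OF smult_carrier_mat[OF oc]])
    have Uv: "U *\<^sub>v v = v - (c * (v \<bullet>c w)) \<cdot>\<^sub>v w" if "v \<in> carrier_vec N" for v
    proof -
      have "U *\<^sub>v v = 1\<^sub>m N *\<^sub>v v - (c \<cdot>\<^sub>m outer w) *\<^sub>v v"
        unfolding U_def using that oc by (intro minus_mult_distrib_mat_vec) auto
      also have "(c \<cdot>\<^sub>m outer w) *\<^sub>v v = c \<cdot>\<^sub>v (outer w *\<^sub>v v)"
        using oc that by (intro eq_vecI) (auto simp: scalar_prod_def sum_distrib_left mult.assoc)
      finally show ?thesis
        using that wc by (simp add: outer_mult_vec[of _ N] smult_smult_assoc)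
    qed
    have adj: "mat_adjoint U = U"
      by (rule eq_matI) (use wc in \<open>auto simp: U_def dim_outer c_def\<close>)
    have UUv: "U *\<^sub>v (U *\<^sub>v v) = v" if v: "v \<in> carrier_vec N" for v
    proof -
      have Uvc: "v - (c * (v \<bullet>c w)) \<cdot>\<^sub>v w \<in> carrier_vec N" using v wc by simp
      have "(v - (c * (v \<bullet>c w)) \<cdot>\<^sub>v w) \<bullet>c w = v \<bullet>c w - c * (v \<bullet>c w) * of_real q"
        using v wc ww by (simp add: cinner_diff_left[of _ N] cinner_smult_left[of _ N])
      also have "\<dots> = - (v \<bullet>c w)"
        using False by (simp add: c_def)
      finally show ?thesis
        unfolding Uv[OF v] Uv[OF Uvc] using v wc by (intro eq_vecI) auto
    qed
    have UU: "U * U = 1\<^sub>m N"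
    proof (rule eq_matI)
      fix i j assume "i < dim_row (1\<^sub>m N :: complex mat)" "j < dim_col (1\<^sub>m N :: complex mat)"
      then have ij: "i < N" "j < N" by auto
      have "(U * U) *\<^sub>v unit_vec N j = unit_vec N j"
        using UUv[of "unit_vec N j"] Uc by (simp add: assoc_mult_mat_vec[of _ N N _ N])
      moreover have "(U * U) *\<^sub>v unit_vec N j = col (U * U) j"
        using mult_unit_vec_col[OF mult_carrier_mat[OF Uc Uc] ij(2)] .
      ultimately have "col (U * U) j $ i = unit_vec N j $ i" by simp
      then show "(U * U) $$ (i, j) = 1\<^sub>m N $$ (i, j)"
        using Uc ij by auto
    qed (use Uc in auto)
    have "cmod ((U *\<^sub>v v) \<bullet>c b) = cmod (v \<bullet>c u)" if v: "v \<in> carrier_vec N" for v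
    proof -
      have "(U *\<^sub>v v) \<bullet>c b' = v \<bullet>c b' - c * (v \<bullet>c w) * of_real (q / 2)"
        using v wc b'c by (simp add: Uv cinner_diff_left[of _ N] cinner_smult_left[of _ N] wb')
      also have "\<dots> = v \<bullet>c b' - v \<bullet>c w" using False by (simp add: c_def)
      also have "\<dots> = v \<bullet>c u" using v b'c uc by (simp add: w_def cinner_diff_right[of _ N])
      finally have "(U *\<^sub>v v) \<bullet>c b' = v \<bullet>c u" .
      then show ?thesis using cm[of "U *\<^sub>v v"] Uc v by (metis mult_mat_vec_carrier)
    qed
    then show ?thesis using Uc adj UU by (intro exI[of _ U]) (auto simp: unitary_mat_def)
  qed
qed

section \<open>Measurability and Haar averages\<close>

lemma space_vec_borel [simp]: "space (vec_borel N) = carrier_vec N"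
  unfolding vec_borel_def by (rule space_measure_of) auto

lemma measurable_vec_index [measurable]:
  assumes "i < N"
  shows "(\<lambda>v. v $ i) \<in> borel_measurable (vec_borel N)"
proof (rule measurableI)
  fix B :: "complex set" assume "B \<in> sets borel"
  then have "{v \<in> carrier_vec N. v $ i \<in> B} \<in> sets (vec_borel N)"
    unfolding vec_borel_def using assms by (subst sets_measure_of) (auto intro!: sigma_sets.Basic)
  also have "{v \<in> carrier_vec N. v $ i \<in> B} = (\<lambda>v. v $ i) -` B \<inter> space (vec_borel N)"
    by auto
  finally show "(\<lambda>v. v $ i) -` B \<inter> space (vec_borel N) \<in> sets (vec_borel N)" .
qed simp

lemma measurable_mult_mat_vec:
  assumes U: "U \<in> carrier_mat N N"
  shows "(\<lambda>v. U *\<^sub>v v) \<in> measurable (vec_borel N) (vec_borel N)"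
  unfolding vec_borel_def[of N]
proof (rule measurable_sigma_sets)
  show "(\<lambda>v. U *\<^sub>v v) \<in> space (sigma (carrier_vec N) {{v \<in> carrier_vec N. v $ i \<in> B} |i B. i < N \<and> B \<in> sets borel}) \<rightarrow> carrier_vec N"
    using U by (auto simp: space_vec_borel[unfolded vec_borel_def])
  fix A assume "A \<in> {{v \<in> carrier_vec N. v $ i \<in> B} |i (B :: complex set). i < N \<and> B \<in> sets borel}"
  then obtain i and B :: "complex set" where i: "i < N" and B: "B \<in> sets borel" and A: "A = {v \<in> carrier_vec N. v $ i \<in> B}"
    by auto
  have m: "(\<lambda>v. \<Sum>j<N. U $$ (i, j) * v $ j) \<in> borel_measurable (vec_borel N)"
    by measurable
  have "(\<lambda>v. U *\<^sub>v v) -` A \<inter> carrier_vec N = (\<lambda>v. \<Sum>j<N. U $$ (i, j) * v $ j) -` B \<inter> space (vec_borel N)"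
    using U i by (auto simp: A scalar_prod_def lessThan_atLeast0)
  also have "\<dots> \<in> sets (vec_borel N)" using m B by (rule measurable_sets)
  finally show "(\<lambda>v. U *\<^sub>v v) -` A \<inter> space (sigma (carrier_vec N) {{v \<in> carrier_vec N. v $ i \<in> B} |i B. i < N \<and> B \<in> sets borel})
      \<in> sets (sigma (carrier_vec N) {{v \<in> carrier_vec N. v $ i \<in> B} |i B. i < N \<and> B \<in> sets borel})"
    by (simp add: vec_borel_def space_vec_borel[unfolded vec_borel_def])
qed (subst sets_measure_of, auto)

lemma measurable_cinner:
  "b \<in> carrier_vec N \<Longrightarrow> (\<lambda>v. v \<bullet>c b) \<in> borel_measurable (vec_borel N)"
  unfolding cinner_sum by measurable

text \<open>By invariance the moment is the same for every unit vector in place of \<open>b\<close>,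
  hence equals its average over all normalised sign vectors. Exchanging this finite average with the
  integral leaves a Rademacher sum for each fixed \<open>v\<close>, to which Khintchine's inequality
  applies.\<close>

lemma haar_moment:
  assumes \<mu>: "is_haar_measure N \<mu>" and b: "unit_state N b" and N: "0 < N"
  shows "(\<integral>v. cmod (v \<bullet>c b) ^ (2 * t) \<partial>\<mu>) \<le> 12 * 2 ^ t * fact (2 * t) / real N ^ t"
proof -
  interpret prob_space \<mu> using \<mu> by (simp add: is_haar_measure_def)
  have sets: "sets \<mu> = sets (vec_borel N)" and unit: "AE v in \<mu>. unit_state N v"
    and inv: "\<And>U. unitary_mat N U \<Longrightarrow> distr \<mu> (vec_borel N) (\<lambda>v. U *\<^sub>v v) = \<mu>"
    using \<mu> by (auto simp: is_haar_measure_def)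
  note meas = measurable_cong_sets[OF sets refl]
  define f where "f b v = cmod (v \<bullet>c b) ^ (2 * t)" for b v
  have fm: "f b \<in> borel_measurable (vec_borel N)" if "b \<in> carrier_vec N" for b
    unfolding f_def using measurable_cinner[OF that] by measurable
  have int: "integrable \<mu> (f c)" if c: "unit_state N c" for c
  proof (rule integrable_const_bound[where B = 1])
    show "AE v in \<mu>. norm (f c v) \<le> 1"
      using unit by eventually_elim (auto simp: f_def intro!: power_le_one cauchy_schwarz_unit[OF _ c])
    show "f c \<in> borel_measurable \<mu>"
      using fm[OF unit_state_carrier[OF c]] by (simp add: meas)
  qed
  have eq: "(\<integral>v. f b v \<partial>\<mu>) = (\<integral>v. f u v \<partial>\<mu>)" if u: "unit_state N u" for u
  proof -
    obtain U where U: "unitary_mat N U" and Uv: "\<forall>v \<in> carrier_vec N. cmod ((U *\<^sub>v v) \<bullet>c b) = cmod (v \<bullet>c u)"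
      using householder[OF b u] by blast
    have Uc: "U \<in> carrier_mat N N" using U by (simp add: unitary_mat_def)
    have "(\<integral>v. f b v \<partial>\<mu>) = (\<integral>v. f b v \<partial>(distr \<mu> (vec_borel N) (\<lambda>v. U *\<^sub>v v)))"
      by (simp only: inv[OF U])
    also have "\<dots> = (\<integral>v. f b (U *\<^sub>v v) \<partial>\<mu>)"
      using measurable_mult_mat_vec[OF Uc] fm[OF unit_state_carrier[OF b]]
      by (intro integral_distr) (simp_all add: meas)
    also have "\<dots> = (\<integral>v. f u v \<partial>\<mu>)"
      using Uv sets_eq_imp_space_eq[OF sets] by (intro Bochner_Integration.integral_cong refl) (simp add: f_def)
    finally show ?thesis .
  qed
  \<comment> \<open>Scaling by 1/sqrt(N) makes the sign vectors unit vectors and is the source of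
    the factor N^t in the denominator.\<close>
  define u where "u S = vec N (\<lambda>i. of_real (subset_sign S i / sqrt N) :: complex)" for S
  have uc: "u S \<in> carrier_vec N" for S by (simp add: u_def)
  have uu: "unit_state N (u S)" for S
  proof -
    have "(\<Sum>i<N. (cmod (u S $ i))\<^sup>2) = (\<Sum>i<N. 1 / real N)"
      by (intro sum.cong refl) (auto simp: u_def subset_sign_def norm_divide power_divide)
    also have "\<dots> = 1" using N by simp
    finally show ?thesis by (simp add: unit_state_def uc cinner_self[OF uc])
  qed
  have ave: "(\<Sum>S\<in>Pow {..<N}. f (u S) v) \<le> 2 ^ N * (12 * 2 ^ t * fact (2 * t)) / real N ^ t"
    if v: "unit_state N v" for v
  proof -
    have "f (u S) v = cmod (\<Sum>i<N. of_real (subset_sign S i) * v $ i) ^ (2 * t) / real N ^ t" for S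
    proof -
      have "v \<bullet>c u S = (\<Sum>i<N. of_real (subset_sign S i) * v $ i) / of_real (sqrt N)"
        unfolding cinner_sum[OF uc] by (simp add: u_def sum_divide_distrib mult.commute)
      then show ?thesis
        by (simp add: f_def norm_divide power_divide power_mult)
    qed
    then show ?thesis
      using khintchine_complex[where N = N and z = "\<lambda>i. v $ i" and t = t] unit_state_norm[OF v]
      by (simp add: sum_divide_distrib[symmetric] divide_right_mono)
  qed
  have "2 ^ N * (\<integral>v. f b v \<partial>\<mu>) = (\<Sum>S\<in>Pow {..<N}. \<integral>v. f (u S) v \<partial>\<mu>)"
    by (simp add: eq[OF uu, symmetric] card_Pow)
  also have "\<dots> = (\<integral>v. (\<Sum>S\<in>Pow {..<N}. f (u S) v) \<partial>\<mu>)"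
    by (rule Bochner_Integration.integral_sum[symmetric]) (rule int[OF uu])
  also have "\<dots> \<le> (\<integral>v. 2 ^ N * (12 * 2 ^ t * fact (2 * t)) / real N ^ t \<partial>\<mu>)"
    using unit by (intro integral_mono_AE Bochner_Integration.integrable_sum int[OF uu])
      (auto elim!: eventually_mono intro: ave)
  also have "\<dots> = 2 ^ N * (12 * 2 ^ t * fact (2 * t) / real N ^ t)"
    by (simp add: prob_space)
  finally show ?thesis
    unfolding f_def by (rule mult_left_le_imp_le) simp
qed

section \<open>The boosted tomography procedure\<close>

text \<open>The exponential moment of the number of bad samples, multiplicative by independence.
  Base 3 is the optimal Chernoff parameter for bad probability 1/4 and threshold 1/2.\<close>

lemma nn_integral_replicate_pmf_filter:
  "(\<integral>\<^sup>+xs. ennreal (3 ^ length (filter P xs)) \<partial>measure_pmf (replicate_pmf l p)) =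
    (\<integral>\<^sup>+x. ennreal (if P x then 3 else 1) \<partial>measure_pmf p) ^ l"
proof (induction l)
  case (Suc l)
  let ?w = "\<lambda>x. ennreal (if P x then 3 else 1)"
  have *: "ennreal (3 ^ length (filter P (x # xs))) = ?w x * ennreal (3 ^ length (filter P xs))" for x xs
    by (subst ennreal_mult[symmetric]) auto
  show ?case
    by (simp add: nn_integral_bind_pmf * nn_integral_cmult nn_integral_multc Suc.IH del: filter.simps)
qed simp

text \<open>A Chernoff bound: weight 3 on a bad sample has mean at most 3/2, while on the event the
  total weight is at least sqrt(3)^l. The quotient per sample is (3/2)/sqrt(3) = sqrt(3)/2.\<close>

lemma replicate_pmf_majority:
  fixes p :: "'a pmf"
  assumes q: "measure_pmf.prob p {x. P x} \<le> 1 / 4"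
  shows "measure_pmf.prob (replicate_pmf l p) {xs. l \<le> 2 * length (filter P xs)} \<le> (sqrt 3 / 2) ^ l"
proof -
  let ?B = "{xs :: 'a list. l \<le> 2 * length (filter P xs)}"
  have w: "(\<integral>\<^sup>+x. ennreal (if P x then 3 else 1) \<partial>measure_pmf p) \<le> ennreal (3 / 2)"
  proof -
    have "(\<integral>\<^sup>+x. ennreal (if P x then 3 else 1) \<partial>measure_pmf p) =
        (\<integral>\<^sup>+x. 1 + 2 * indicator {x. P x} x \<partial>measure_pmf p)"
      by (intro nn_integral_cong) (auto simp: indicator_def)
    also have "\<dots> = 1 + 2 * emeasure (measure_pmf p) {x. P x}"
      by (simp add: nn_integral_add nn_integral_cmult)
    also have "\<dots> = ennreal (1 + 2 * measure_pmf.prob p {x. P x})"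
      by (simp add: measure_pmf.emeasure_eq_measure ennreal_mult')
    also have "\<dots> \<le> ennreal (3 / 2)" using q by (intro ennreal_leI) simp
    finally show ?thesis .
  qed
  have "emeasure (measure_pmf (replicate_pmf l p)) ?B =
      (\<integral>\<^sup>+xs. indicator ?B xs \<partial>measure_pmf (replicate_pmf l p))"
    by simp
  also have "\<dots> \<le> (\<integral>\<^sup>+xs. ennreal (1 / sqrt 3 ^ l) * ennreal (3 ^ length (filter P xs)) \<partial>measure_pmf (replicate_pmf l p))"
  proof (intro nn_integral_mono)
    fix xs
    have "1 \<le> 1 / sqrt 3 ^ l * 3 ^ length (filter P xs)" if "l \<le> 2 * length (filter P xs)"
    proof -
      have "sqrt 3 ^ l \<le> sqrt 3 ^ (2 * length (filter P xs))"
        using that by (intro power_increasing) auto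
      then show ?thesis by (simp add: power_mult field_simps)
    qed
    then show "indicator ?B xs \<le> ennreal (1 / sqrt 3 ^ l) * ennreal (3 ^ length (filter P xs))"
      by (subst ennreal_mult[symmetric]) (auto simp only: indicator_def ennreal_ge_1 split: if_split, auto)
  qed
  also have "\<dots> = ennreal (1 / sqrt 3 ^ l) * (\<integral>\<^sup>+x. ennreal (if P x then 3 else 1) \<partial>measure_pmf p) ^ l"
    by (simp add: nn_integral_cmult nn_integral_replicate_pmf_filter)
  also have "\<dots> \<le> ennreal (1 / sqrt 3 ^ l) * ennreal (3 / 2) ^ l"
    using w by (intro mult_left_mono power_mono) auto
  also have "\<dots> = ennreal (1 / sqrt 3 ^ l * (3 / 2) ^ l)"
    by (subst ennreal_power, simp, rule ennreal_mult[symmetric]) auto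
  also have "1 / sqrt 3 ^ l * (3 / 2) ^ l = (1 / sqrt 3 * (3 / 2)) ^ l"
    by (simp only: power_mult_distrib power_one_over)
  also have "1 / sqrt 3 * (3 / 2) = sqrt 3 / 2"
    using real_div_sqrt[of 3] by simp
  finally show ?thesis
    unfolding measure_pmf.emeasure_eq_measure by (rule ennreal_le_iff[THEN iffD1, rotated]) simp
qed

section \<open>The Frobenius norm and the selection rule\<close>

lemma frob_norm_L2:
  "A \<in> carrier_mat N N \<Longrightarrow> frob_norm A = L2_set (\<lambda>(i, j). cmod (A $$ (i, j))) ({..<N} \<times> {..<N})"
  by (auto simp: frob_norm_def L2_set_def sum.cartesian_product intro!: sum.cong)

lemma frob_norm_nonneg: "0 \<le> frob_norm A"
  by (simp add: frob_norm_def sum_nonneg)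

lemma frob_norm_triangle:
  assumes "A \<in> carrier_mat N N" "B \<in> carrier_mat N N" "C \<in> carrier_mat N N"
  shows "frob_norm (A - B) \<le> frob_norm (A - C) + frob_norm (B - C)"
proof -
  let ?K = "{..<N} \<times> {..<N}"
  have c: "A - B \<in> carrier_mat N N" "A - C \<in> carrier_mat N N" "B - C \<in> carrier_mat N N"
    using assms by auto
  have "frob_norm (A - B) \<le> L2_set (\<lambda>x. (\<lambda>(i, j). cmod ((A - C) $$ (i, j))) x + (\<lambda>(i, j). cmod ((B - C) $$ (i, j))) x) ?K"
    unfolding frob_norm_L2[OF c(1)]
  proof (rule L2_set_mono)
    fix x assume "x \<in> ?K"
    then obtain i j where x: "x = (i, j)" and ij: "i < N" "j < N" by auto
    have "cmod (A $$ (i, j) - B $$ (i, j)) \<le> cmod (A $$ (i, j) - C $$ (i, j)) + cmod (B $$ (i, j) - C $$ (i, j))"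
      using norm_triangle_ineq4[of "A $$ (i, j) - C $$ (i, j)" "B $$ (i, j) - C $$ (i, j)"] by simp
    then show "(\<lambda>(i, j). cmod ((A - B) $$ (i, j))) x \<le>
        (\<lambda>(i, j). cmod ((A - C) $$ (i, j))) x + (\<lambda>(i, j). cmod ((B - C) $$ (i, j))) x"
      using assms ij by (simp add: x)
  qed auto
  also have "\<dots> \<le> frob_norm (A - C) + frob_norm (B - C)"
    unfolding frob_norm_L2[OF c(2)] frob_norm_L2[OF c(3)] by (rule L2_set_triangle_ineq)
  finally show ?thesis .
qed

lemma frob_norm_minus_commute:
  assumes "A \<in> carrier_mat N N" "B \<in> carrier_mat N N"
  shows "frob_norm (A - B) = frob_norm (B - A)"
  using assms by (auto simp: frob_norm_def norm_minus_commute intro!: sum.cong)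

text \<open>Cauchy-Schwarz over index pairs: the products of coordinates of a unit vector again form
  a vector of norm 1. This carries the accuracy of tomography over to the overlap test in
  \<open>Verify\<close>.\<close>

lemma expval_le_frob_norm:
  assumes A: "A \<in> carrier_mat N N" and v: "unit_state N v"
  shows "cmod (expval A v) \<le> frob_norm A"
proof -
  let ?K = "{..<N} \<times> {..<N}"
  have "cmod (expval A v) \<le> (\<Sum>(i, j)\<in>?K. cmod (A $$ (i, j)) * (cmod (v $ j) * cmod (v $ i)))"
    unfolding expval_sum[OF A unit_state_carrier[OF v]] sum.cartesian_product
    by (rule order_trans[OF norm_sum]) (simp add: norm_mult case_prod_beta mult.assoc)
  also have "\<dots> \<le> L2_set (\<lambda>(i, j). cmod (A $$ (i, j))) ?K * L2_set (\<lambda>(i, j). cmod (v $ j) * cmod (v $ i)) ?K"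
    using L2_set_mult_ineq[of "\<lambda>(i, j). cmod (A $$ (i, j))" "\<lambda>(i, j). cmod (v $ j) * cmod (v $ i)" ?K]
    by (simp add: case_prod_beta abs_mult)
  also have "L2_set (\<lambda>(i, j). cmod (v $ j) * cmod (v $ i)) ?K = 1"
  proof -
    have "(\<Sum>x\<in>?K. ((\<lambda>(i, j). cmod (v $ j) * cmod (v $ i)) x)\<^sup>2) =
        (\<Sum>i<N. (cmod (v $ i))\<^sup>2) * (\<Sum>j<N. (cmod (v $ j))\<^sup>2)"
      by (simp add: sum_product sum.cartesian_product case_prod_beta power_mult_distrib mult.commute)
    then show ?thesis by (simp add: L2_set_def unit_state_norm[OF v])
  qed
  finally show ?thesis unfolding frob_norm_L2[OF A] by (simp only: mult_1_right)
qed

text \<open>Let r = sqrt(N/s). Accurate samples lie within 2r of each other, so a strict majority of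
  them makes each of them a good index. Conversely, the neighbours of any good index form a strict
  majority and therefore include an accurate sample; the distance to the true state is then at most
  2r + r.\<close>

lemma select_output_accurate:
  assumes len: "length Ms = l" and Ms: "set Ms \<subseteq> carrier_mat N N" and \<rho>: "\<rho> \<in> carrier_mat N N"
    and maj: "2 * length (filter (\<lambda>M. real N / real s < (frob_norm (M - \<rho>))\<^sup>2) Ms) < l"
  shows "\<exists>M. select_output s N l Ms = Some M \<and> M \<in> carrier_mat N N \<and> frob_norm (M - \<rho>) \<le> 3 * sqrt (N / s)"
proof -
  define r where "r = sqrt (real N / real s)"
  have r: "0 \<le> r" "r\<^sup>2 = real N / real s" by (simp_all add: r_def)
  define Gd where "Gd = {j. j < l \<and> frob_norm (Ms ! j - \<rho>) \<le> r}"
  define Bd where "Bd = {j. j < l \<and> real N / real s < (frob_norm (Ms ! j - \<rho>))\<^sup>2}"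
  have car: "Ms ! j \<in> carrier_mat N N" if "j < l" for j
    using subsetD[OF Ms nth_mem] that len by blast
  have sq: "real N / real s < x\<^sup>2 \<longleftrightarrow> \<not> x \<le> r" if "0 \<le> x" for x
  proof -
    have "x \<le> r \<longleftrightarrow> x\<^sup>2 \<le> r\<^sup>2"
      using that r(1) by (rule power_mono_iff[symmetric]) simp
    then show ?thesis by (simp only: r(2) not_le)
  qed
  have Gd: "Gd = {..<l} - Bd"
    unfolding Gd_def Bd_def sq[OF frob_norm_nonneg] by blast
  have Bd: "Bd \<subseteq> {..<l}" "finite Bd" by (auto simp: Bd_def)
  have "card Gd = card {..<l} - card Bd"
    unfolding Gd by (rule card_Diff_subset[OF Bd(2,1)])
  moreover have "card Bd \<le> card {..<l}"
    by (rule card_mono[OF _ Bd(1)]) simp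
  moreover have "card Bd = length (filter (\<lambda>M. real N / real s < (frob_norm (M - \<rho>))\<^sup>2) Ms)"
    unfolding length_filter_conv_card Bd_def len ..
  ultimately have G: "l < 2 * card Gd" using maj unfolding card_lessThan by linarith
  have fin: "finite Gd" by (simp add: Gd_def)
  have good: "good_index s N l Ms i" if i: "i \<in> Gd" for i
  proof -
    have "(frob_norm (Ms ! j - Ms ! i))\<^sup>2 \<le> 4 * real N / real s" if j: "j \<in> Gd" for j
    proof -
      have "frob_norm (Ms ! j - Ms ! i) \<le> frob_norm (Ms ! j - \<rho>) + frob_norm (Ms ! i - \<rho>)"
        using i j car \<rho> by (intro frob_norm_triangle) (auto simp: Gd_def)
      also have "\<dots> \<le> 2 * r" using i j by (simp add: Gd_def)
      finally have "(frob_norm (Ms ! j - Ms ! i))\<^sup>2 \<le> (2 * r)\<^sup>2"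
        by (intro power_mono frob_norm_nonneg)
      then show ?thesis by (simp add: power_mult_distrib r)
    qed
    then have "Gd \<subseteq> {j. j < l \<and> (frob_norm (Ms ! j - Ms ! i))\<^sup>2 \<le> 4 * real N / real s}"
      by (auto simp: Gd_def)
    then have "card Gd \<le> card {j. j < l \<and> (frob_norm (Ms ! j - Ms ! i))\<^sup>2 \<le> 4 * real N / real s}"
      by (intro card_mono) auto
    then show ?thesis using i G unfolding good_index_def Gd_def by auto
  qed
  \<comment> \<open>Shown for every good index, because the choice made by \<open>SOME\<close> is
    unspecified.\<close>
  have close: "frob_norm (Ms ! i - \<rho>) \<le> 3 * r \<and> i < l" if i: "good_index s N l Ms i" for i
  proof -
    let ?C = "{j. j < l \<and> (frob_norm (Ms ! j - Ms ! i))\<^sup>2 \<le> 4 * real N / real s}"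
    have il: "i < l" and "real l / 2 < real (card ?C)" using i unfolding good_index_def by blast+
    then have C: "l < 2 * card ?C" by linarith
    have "Gd \<inter> ?C \<noteq> {}"
    proof
      assume "Gd \<inter> ?C = {}"
      then have "card (Gd \<union> ?C) = card Gd + card ?C"
        by (rule card_Un_disjoint[OF fin, rotated]) simp
      moreover have "card (Gd \<union> ?C) \<le> card {..<l}"
        by (intro card_mono) (auto simp: Gd_def)
      ultimately show False using G C unfolding card_lessThan by linarith
    qed
    then obtain j where j: "j \<in> Gd" "(frob_norm (Ms ! j - Ms ! i))\<^sup>2 \<le> 4 * real N / real s" by blast
    have "(frob_norm (Ms ! j - Ms ! i))\<^sup>2 \<le> (2 * r)\<^sup>2"
      using j(2) by (simp add: power_mult_distrib r)
    then have ji: "frob_norm (Ms ! j - Ms ! i) \<le> 2 * r"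
      by (rule power2_le_imp_le) (use r(1) in simp)
    have jl: "j < l" using j by (simp add: Gd_def)
    have "frob_norm (Ms ! i - \<rho>) \<le> frob_norm (Ms ! i - Ms ! j) + frob_norm (\<rho> - Ms ! j)"
      by (intro frob_norm_triangle[where N = N] car il jl \<rho>)
    also have "\<dots> = frob_norm (Ms ! j - Ms ! i) + frob_norm (Ms ! j - \<rho>)"
      by (simp only: frob_norm_minus_commute[OF car[OF il] car[OF jl]] frob_norm_minus_commute[OF \<rho> car[OF jl]])
    also have "\<dots> \<le> 2 * r + r" using ji j(1) by (intro add_mono) (auto simp: Gd_def)
    finally show ?thesis using il by simp
  qed
  have "Gd \<noteq> {}" using G by auto
  then have ex: "\<exists>i. good_index s N l Ms i" using good by blast
  define i where "i = (SOME i. good_index s N l Ms i)"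
  have i: "good_index s N l Ms i" unfolding i_def by (rule someI_ex[OF ex])
  have "select_output s N l Ms = Some (Ms ! i)"
    unfolding select_output_def i_def[symmetric] by (rule if_P[OF ex])
  then show ?thesis
    using close[OF i] car[of i] unfolding r_def by blast
qed

text \<open>The base procedure runs with parameter \<open>4 * s\<close>, so its mean squared error
  is a quarter of the tolerated N/s. Markov's inequality gives failure probability at most 1/4 per
  run, and the majority bound applies.\<close>

lemma T_imp_accurate:
  assumes T: "tomography_procedure T" and \<rho>: "density_mat N \<rho>" and pos: "0 < s" "0 < N"
  shows "1 - (sqrt 3 / 2) ^ l \<le> measure_pmf.prob (T_imp T s N l \<rho> (4 * s * N\<^sup>2 * l))
    {Mo. \<exists>M. Mo = Some M \<and> M \<in> carrier_mat N N \<and> frob_norm (M - \<rho>) \<le> 3 * sqrt (N / s)}"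
    (is "_ \<le> measure_pmf.prob _ ?A")
proof -
  define p where "p = T (4 * s) N (tensor_power \<rho> (4 * s * N\<^sup>2))"
  define Q where "Q M \<longleftrightarrow> real N / real s < (frob_norm (M - \<rho>))\<^sup>2" for M
  have \<rho>c: "\<rho> \<in> carrier_mat N N" using \<rho> by (simp add: density_mat_def psd_mat_def)
  have "0 < 4 * s" using pos by simp
  then have sp: "set_pmf p \<subseteq> carrier_mat N N"
    and ex: "(\<integral>\<^sup>+M. ennreal ((frob_norm (M - \<rho>))\<^sup>2) \<partial>measure_pmf p) \<le> ennreal (real N / real (4 * s))"
    using T \<rho> pos(2) unfolding tomography_procedure_def p_def by blast+
  let ?a = "real N / real s"
  have a: "0 < ?a" using pos by simp
  have Q: "measure_pmf.prob p {M. Q M} \<le> 1 / 4"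
  proof -
    have "ennreal (?a * measure_pmf.prob p {M. Q M}) = ennreal ?a * emeasure (measure_pmf p) {M. Q M}"
      unfolding measure_pmf.emeasure_eq_measure using a by (intro ennreal_mult) auto
    also have "\<dots> = (\<integral>\<^sup>+M. ennreal ?a * indicator {M. Q M} M \<partial>measure_pmf p)"
      by (simp add: nn_integral_cmult_indicator)
    also have "\<dots> \<le> (\<integral>\<^sup>+M. ennreal ((frob_norm (M - \<rho>))\<^sup>2) \<partial>measure_pmf p)"
      by (intro nn_integral_mono) (auto simp: indicator_def Q_def intro!: ennreal_leI)
    also note ex
    finally have "?a * measure_pmf.prob p {M. Q M} \<le> real N / real (4 * s)"
      by (rule ennreal_le_iff[THEN iffD1, rotated]) simp
    then have "?a * measure_pmf.prob p {M. Q M} \<le> ?a * (1 / 4)"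
      by simp
    then show ?thesis using a by (simp only: mult_le_cancel_left_pos)
  qed
  let ?G = "{Ms. 2 * length (filter Q Ms) < l}"
  have "1 - (sqrt 3 / 2) ^ l \<le> 1 - measure_pmf.prob (replicate_pmf l p) {Ms. l \<le> 2 * length (filter Q Ms)}"
    using replicate_pmf_majority[OF Q, of l] by simp
  also have "\<dots> = measure_pmf.prob (replicate_pmf l p) ?G"
    by (subst measure_pmf.prob_compl[symmetric]) (auto simp: not_le intro!: arg_cong2[where f = measure])
  \<comment> \<open>Tomography outputs are known to have the right dimension only on the
    support.\<close>
  also have "\<dots> = measure_pmf.prob (replicate_pmf l p) (?G \<inter> set_pmf (replicate_pmf l p))"
    by (simp add: measure_Int_set_pmf)
  also have "\<dots> \<le> measure_pmf.prob (replicate_pmf l p) (select_output s N l -` ?A)"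
  proof (intro measure_pmf.finite_measure_mono subsetI)
    fix Ms assume Ms: "Ms \<in> ?G \<inter> set_pmf (replicate_pmf l p)"
    then have "length Ms = l" "set Ms \<subseteq> carrier_mat N N"
      using sp by (auto simp: set_replicate_pmf)
    then show "Ms \<in> select_output s N l -` ?A"
      using select_output_accurate[OF _ _ \<rho>c, of Ms l s] Ms pos by (simp add: Q_def[abs_def])
  qed auto
  also have "\<dots> = measure_pmf.prob (T_imp T s N l \<rho> (4 * s * N\<^sup>2 * l)) ?A"
    by (simp add: T_imp_def p_def)
  finally show ?thesis .
qed

section \<open>Averaged states\<close>

text \<open>The mixed state seen by a party to whom the sample point is unknown.\<close>

definition mean_mat :: "'a measure \<Rightarrow> nat \<Rightarrow> ('a \<Rightarrow> complex mat) \<Rightarrow> complex mat" where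
  "mean_mat M K f = mat K K (\<lambda>(i, j). \<integral>\<omega>. f \<omega> $$ (i, j) \<partial>M)"

text \<open>A common interface for states indexed by keys and for Haar-random states. The trace
  condition is only almost sure because Haar measure lives on the whole space
  \<open>carrier_vec N\<close> and is concentrated on unit vectors only up to a null set.\<close>

locale integrable_mat = prob_space M for M :: "'a measure" +
  fixes K :: nat and f :: "'a \<Rightarrow> complex mat"
  assumes f_carrier: "\<And>\<omega>. \<omega> \<in> space M \<Longrightarrow> f \<omega> \<in> carrier_mat K K"
    and f_integrable: "\<And>i j. i < K \<Longrightarrow> j < K \<Longrightarrow> integrable M (\<lambda>\<omega>. f \<omega> $$ (i, j))"
    and f_adjoint: "\<And>\<omega>. \<omega> \<in> space M \<Longrightarrow> mat_adjoint (f \<omega>) = f \<omega>"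
    and f_trace: "AE \<omega> in M. mtrace (f \<omega>) = 1"
begin

lemma mean_mat_carrier: "mean_mat M K f \<in> carrier_mat K K"
  by (simp add: mean_mat_def)

lemma mean_mat_adjoint: "mat_adjoint (mean_mat M K f) = mean_mat M K f"
proof (rule eq_matI)
  fix i j assume "i < dim_row (mean_mat M K f)" "j < dim_col (mean_mat M K f)"
  then have ij: "i < K" "j < K" by (auto simp: mean_mat_def)
  have "cnj (f \<omega> $$ (j, i)) = f \<omega> $$ (i, j)" if "\<omega> \<in> space M" for \<omega>
    using f_adjoint[OF that] f_carrier[OF that] ij index_mat_adjoint[of i "f \<omega>" j] by auto
  then have "(\<integral>\<omega>. cnj (f \<omega> $$ (j, i)) \<partial>M) = (\<integral>\<omega>. f \<omega> $$ (i, j) \<partial>M)"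
    by (intro Bochner_Integration.integral_cong refl)
  then show "mat_adjoint (mean_mat M K f) $$ (i, j) = mean_mat M K f $$ (i, j)"
    using ij by (simp add: mean_mat_def)
qed (auto simp: mean_mat_def)

lemma integrable_mtrace_mult:
  assumes "Q \<in> carrier_mat K K"
  shows "integrable M (\<lambda>\<omega>. mtrace (Q * f \<omega>))"
proof -
  have "integrable M (\<lambda>\<omega>. \<Sum>i<K. \<Sum>j<K. Q $$ (i, j) * f \<omega> $$ (j, i))"
    by (intro Bochner_Integration.integrable_sum integrable_mult_right f_integrable) auto
  then show ?thesis
    using mtrace_mult[OF assms f_carrier] by (simp cong: Bochner_Integration.integrable_cong)
qed

lemma integral_mtrace_mult:
  assumes "Q \<in> carrier_mat K K"
  shows "(\<integral>\<omega>. mtrace (Q * f \<omega>) \<partial>M) = mtrace (Q * mean_mat M K f)"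
proof -
  have "(\<integral>\<omega>. mtrace (Q * f \<omega>) \<partial>M) = (\<integral>\<omega>. (\<Sum>i<K. \<Sum>j<K. Q $$ (i, j) * f \<omega> $$ (j, i)) \<partial>M)"
    by (intro Bochner_Integration.integral_cong refl mtrace_mult[OF assms f_carrier])
  also have "\<dots> = (\<Sum>i<K. \<Sum>j<K. Q $$ (i, j) * (\<integral>\<omega>. f \<omega> $$ (j, i) \<partial>M))"
  proof -
    have 1: "integrable M (\<lambda>\<omega>. Q $$ (i, j) * f \<omega> $$ (j, i))" if "i < K" "j < K" for i j
      using that by (intro integrable_mult_right f_integrable)
    have 2: "integrable M (\<lambda>\<omega>. \<Sum>j<K. Q $$ (i, j) * f \<omega> $$ (j, i))" if "i < K" for i
      using that by (intro Bochner_Integration.integrable_sum 1) auto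
    have "(\<integral>\<omega>. (\<Sum>i<K. \<Sum>j<K. Q $$ (i, j) * f \<omega> $$ (j, i)) \<partial>M) =
        (\<Sum>i<K. \<integral>\<omega>. (\<Sum>j<K. Q $$ (i, j) * f \<omega> $$ (j, i)) \<partial>M)"
      by (rule Bochner_Integration.integral_sum) (use 2 in auto)
    also have "\<dots> = (\<Sum>i<K. \<Sum>j<K. \<integral>\<omega>. Q $$ (i, j) * f \<omega> $$ (j, i) \<partial>M)"
      by (intro sum.cong refl Bochner_Integration.integral_sum) (use 1 in auto)
    finally show ?thesis by simp
  qed
  also have "\<dots> = mtrace (Q * mean_mat M K f)"
    by (simp add: mtrace_mult[OF assms mean_mat_carrier]) (simp add: mean_mat_def)
  finally show ?thesis .
qed

lemma mtrace_mean_mat: "mtrace (mean_mat M K f) = 1"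
proof -
  have one: "mtrace (1\<^sub>m K * f \<omega>) = mtrace (f \<omega>)" if "\<omega> \<in> space M" for \<omega>
    using f_carrier[OF that] by simp
  have "mtrace (mean_mat M K f) = (\<integral>\<omega>. mtrace (1\<^sub>m K * f \<omega>) \<partial>M)"
    using mean_mat_carrier by (subst integral_mtrace_mult) auto
  also have "\<dots> = (\<integral>\<omega>. 1 \<partial>M)"
    using f_trace integrable_mtrace_mult[OF one_carrier_mat]
    by (intro integral_cong_AE) (auto simp: one elim!: AE_mp intro!: AE_I2)
  also have "\<dots> = 1" by (simp add: prob_space)
  finally show ?thesis .
qed

text \<open>The acceptance probability in \<open>run_pauli_circuit\<close> is affine in the state,
  so its mean depends only on the mean state. Here \<open>s\<close> stands for the sign contributed
  by the first bit of the input string.\<close>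

lemma accept_pauli:
  fixes s :: complex
  assumes "Q \<in> carrier_mat K K"
  defines "g \<equiv> \<lambda>\<omega>. Re ((mtrace (f \<omega>) - s * mtrace (Q * f \<omega>)) / 2)"
  shows "integrable M g"
    and "(\<integral>\<omega>. g \<omega> \<partial>M) = Re ((1 - s * mtrace (Q * mean_mat M K f)) / 2)"
proof -
  define h where "h \<omega> = (mtrace (1\<^sub>m K * f \<omega>) - s * mtrace (Q * f \<omega>)) / 2" for \<omega>
  have h: "integrable M h"
    unfolding h_def using integrable_mtrace_mult[OF assms(1)] integrable_mtrace_mult[OF one_carrier_mat]
    by (intro integrable_divide_zero Bochner_Integration.integrable_diff integrable_mult_right) auto
  have gh: "g \<omega> = Re (h \<omega>)" if "\<omega> \<in> space M" for \<omega>
    using f_carrier[OF that] by (simp add: g_def h_def)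
  show "integrable M g"
    using integrable_Re[OF h] gh by (simp cong: Bochner_Integration.integrable_cong)
  have "(\<integral>\<omega>. g \<omega> \<partial>M) = (\<integral>\<omega>. Re (h \<omega>) \<partial>M)"
    by (intro Bochner_Integration.integral_cong refl gh)
  also have "\<dots> = Re (\<integral>\<omega>. h \<omega> \<partial>M)"
    by (rule integral_Re[OF h])
  also have "(\<integral>\<omega>. h \<omega> \<partial>M) = (mtrace (1\<^sub>m K * mean_mat M K f) - s * mtrace (Q * mean_mat M K f)) / 2"
    unfolding h_def using integrable_mtrace_mult[OF assms(1)] integrable_mtrace_mult[OF one_carrier_mat]
    by (simp add: integral_mtrace_mult[OF assms(1)] integral_mtrace_mult[OF one_carrier_mat])
  finally show "(\<integral>\<omega>. g \<omega> \<partial>M) = Re ((1 - s * mtrace (Q * mean_mat M K f)) / 2)"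
    using mean_mat_carrier mtrace_mean_mat by simp
qed

end

lemma accept_prob_single: "accept_prob C [x] [\<omega>] (1\<^sub>m 1) = Re (run_circuit C (basis_state x \<otimes>\<^sub>K \<omega>) $$ (1, 1))"
  by (simp add: accept_prob_def)

lemma mtrace_outer_mult:
  assumes "A \<in> carrier_mat K K" "v \<in> carrier_vec K"
  shows "mtrace (outer v * A) = expval A v"
proof -
  have "mtrace (outer v * A) = (\<Sum>i<K. \<Sum>j<K. A $$ (j, i) * v $ i * cnj (v $ j))"
    using assms by (simp add: mtrace_mult[OF outer_carrier[OF assms(2)] assms(1)] mult_ac)
  also have "\<dots> = expval A v"
    unfolding expval_sum[OF assms] by (rule sum.swap)
  finally show ?thesis .
qed

lemma expval_le_entries:
  assumes A: "A \<in> carrier_mat K K" and v: "unit_state K v"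
    and e: "\<And>i j. i < K \<Longrightarrow> j < K \<Longrightarrow> cmod (A $$ (i, j)) \<le> e"
  shows "cmod (expval A v) \<le> (real K)\<^sup>2 * e"
proof -
  have "cmod (expval A v) \<le> (\<Sum>i<K. \<Sum>j<K. cmod (A $$ (i, j) * v $ j * cnj (v $ i)))"
    unfolding expval_sum[OF A unit_state_carrier[OF v]]
    by (intro order_trans[OF norm_sum] sum_mono norm_sum)
  also have "\<dots> \<le> (\<Sum>i<K. \<Sum>j<K. e)"
  proof (intro sum_mono)
    fix i j assume ij: "i \<in> {..<K}" "j \<in> {..<K}"
    then have "cmod (A $$ (i, j)) * (cmod (v $ j) * cmod (v $ i)) \<le> e * (1 * 1)"
      using e[of i j] unit_state_index_le[OF v] order_trans[OF norm_ge_zero e[of i j]]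
      by (intro mult_mono) auto
    then show "cmod (A $$ (i, j) * v $ j * cnj (v $ i)) \<le> e"
      by (simp add: norm_mult mult.assoc)
  qed
  also have "\<dots> = (real K)\<^sup>2 * e"
    by (simp add: power2_eq_square)
  finally show ?thesis .
qed

text \<open>Since \<open>2 ^ m\<close> is polynomial in the application, indistinguishability under measurements of
  Pauli strings already forces the averaged states to be close entrywise.\<close>

lemma mean_expval_close:
  assumes f: "integrable_mat M (2 ^ m) f" and g: "integrable_mat M' (2 ^ m) g"
    and x: "x \<noteq> []"
    and e: "\<And>Ps. length Ps = m \<Longrightarrow>
      \<bar>(\<integral>\<omega>. accept_prob (pauli_circuit (length x) Ps) [x] [f \<omega>] (1\<^sub>m 1) \<partial>M)
       - (\<integral>\<omega>. accept_prob (pauli_circuit (length x) Ps) [x] [g \<omega>] (1\<^sub>m 1) \<partial>M')\<bar> \<le> e"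
    and v: "unit_state (2 ^ m) v"
  shows "cmod ((\<integral>\<omega>. expval (f \<omega>) v \<partial>M) - (\<integral>\<omega>. expval (g \<omega>) v \<partial>M')) \<le> 4 ^ m * (2 * e)"
proof -
  interpret f: integrable_mat M "2 ^ m" f by (rule f)
  interpret g: integrable_mat M' "2 ^ m" g by (rule g)
  let ?K = "2 ^ m :: nat" and ?s = "if hd x then - 1 else 1 :: complex"
  define F where "F = mean_mat M ?K f"
  define G where "G = mean_mat M' ?K g"
  have F: "F \<in> carrier_mat ?K ?K" "mat_adjoint F = F" and G: "G \<in> carrier_mat ?K ?K" "mat_adjoint G = G"
    using f.mean_mat_carrier g.mean_mat_carrier f.mean_mat_adjoint g.mean_mat_adjoint
    by (simp_all add: F_def G_def)
  have FG: "F - G \<in> carrier_mat ?K ?K" using F G by auto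
  have mult: "Q * (F - G) = Q * F - Q * G" if "Q \<in> carrier_mat ?K ?K" for Q
    using that F G by (intro mult_minus_distrib_mat) auto
  have tr: "mtrace (Q * (F - G)) = mtrace (Q * F) - mtrace (Q * G)" if "Q \<in> carrier_mat ?K ?K" for Q
    unfolding mult[OF that] using that F G by (auto simp: mtrace_def sum_subtractf)
  \<comment> \<open>The advantages bound all Pauli expectations of the difference of the two mean
    states, and inversion turns this into a bound on its entries.\<close>
  have entry: "cmod ((F - G) $$ (i, j)) \<le> 2 * e" if ij: "i < ?K" "j < ?K" for i j
  proof (rule pauli_inversion[OF FG _ ij])
    fix Ps :: "pauli list" assume Ps: "length Ps = m"
    have Q: "pauli_mat Ps \<in> carrier_mat ?K ?K" using pauli_mat_carrier[of Ps] Ps by simp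
    have acc: "accept_prob (pauli_circuit (length x) Ps) [x] [\<omega>] (1\<^sub>m 1) =
        Re ((mtrace \<omega> - ?s * mtrace (pauli_mat Ps * \<omega>)) / 2)" if "\<omega> \<in> carrier_mat ?K ?K" for \<omega>
      unfolding accept_prob_single using run_pauli_circuit[OF x, of \<omega> Ps] that Ps by (simp only:)
    have 1: "(\<integral>\<omega>. accept_prob (pauli_circuit (length x) Ps) [x] [f \<omega>] (1\<^sub>m 1) \<partial>M) =
        Re ((1 - ?s * mtrace (pauli_mat Ps * F)) / 2)"
      unfolding F_def f.accept_pauli(2)[OF Q, symmetric]
      by (intro Bochner_Integration.integral_cong refl acc f.f_carrier)
    have 2: "(\<integral>\<omega>. accept_prob (pauli_circuit (length x) Ps) [x] [g \<omega>] (1\<^sub>m 1) \<partial>M') =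
        Re ((1 - ?s * mtrace (pauli_mat Ps * G)) / 2)"
      unfolding G_def g.accept_pauli(2)[OF Q, symmetric]
      by (intro Bochner_Integration.integral_cong refl acc g.f_carrier)
    \<comment> \<open>An acceptance probability contains half of the Pauli expectation, hence the
      factor 2; the sign from \<open>hd x\<close> cancels in the absolute value.\<close>
    have "\<bar>Re (mtrace (pauli_mat Ps * F)) - Re (mtrace (pauli_mat Ps * G))\<bar> \<le> 2 * e"
      using e[OF Ps] unfolding 1 2 by (cases "hd x") (auto simp: abs_if add_divide_distrib diff_divide_distrib split: if_splits)
    moreover have "Im (mtrace (pauli_mat Ps * F)) = 0" "Im (mtrace (pauli_mat Ps * G)) = 0"
      using mtrace_hermitian_real[OF Q F(1) pauli_mat_adjoint F(2)]
        mtrace_hermitian_real[OF Q G(1) pauli_mat_adjoint G(2)] by auto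
    ultimately show "cmod (mtrace (pauli_mat Ps * (F - G))) \<le> 2 * e"
      by (simp add: tr[OF Q] cmod_def)
  qed
  have vc: "v \<in> carrier_vec ?K" and oc: "outer v \<in> carrier_mat ?K ?K"
    using unit_state_carrier[OF v] by auto
  have "(\<integral>\<omega>. expval (f \<omega>) v \<partial>M) = (\<integral>\<omega>. mtrace (outer v * f \<omega>) \<partial>M)"
    by (intro Bochner_Integration.integral_cong refl mtrace_outer_mult[OF f.f_carrier vc, symmetric])
  also have "\<dots> = mtrace (outer v * F)" unfolding F_def by (rule f.integral_mtrace_mult[OF oc])
  finally have ef: "(\<integral>\<omega>. expval (f \<omega>) v \<partial>M) = mtrace (outer v * F)" .
  have "(\<integral>\<omega>. expval (g \<omega>) v \<partial>M') = (\<integral>\<omega>. mtrace (outer v * g \<omega>) \<partial>M')"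
    by (intro Bochner_Integration.integral_cong refl mtrace_outer_mult[OF g.f_carrier vc, symmetric])
  also have "\<dots> = mtrace (outer v * G)" unfolding G_def by (rule g.integral_mtrace_mult[OF oc])
  finally have eg: "(\<integral>\<omega>. expval (g \<omega>) v \<partial>M') = mtrace (outer v * G)" .
  have "cmod (expval (F - G) v) \<le> (real ?K)\<^sup>2 * (2 * e)"
    by (rule expval_le_entries[OF FG v entry])
  then show ?thesis
    unfolding ef eg tr[OF oc, symmetric] mtrace_outer_mult[OF FG vc]
    by (simp add: power2_eq_square power_mult_distrib[symmetric])
qed

section \<open>Tensor powers of Haar-random and keyed states\<close>

lemma tensor_power_index_Suc:
  assumes A: "A \<in> carrier_mat N N" and ij: "i < N ^ Suc t" "j < N ^ Suc t"
  shows "tensor_power A (Suc t) $$ (i, j) =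
    A $$ (i div N ^ t, j div N ^ t) * tensor_power A t $$ (i mod N ^ t, j mod N ^ t)"
proof -
  have "dim_row A = N" "dim_col A = N" "dim_row (tensor_power A t) = N ^ t" "dim_col (tensor_power A t) = N ^ t"
    using tensor_power_carrier[OF A, of t] A by (blast dest: carrier_matD)+
  then show ?thesis using ij by (simp add: index_kron)
qed

text \<open>Each entry is a monomial in coordinates of \<open>v\<close> and their conjugates; the
  induction splits off the leading digit of both indices.\<close>

lemma measurable_tensor_power_outer:
  assumes "i < N ^ t" "j < N ^ t"
  shows "(\<lambda>v. tensor_power (outer v) t $$ (i, j)) \<in> borel_measurable (vec_borel N)"
  using assms
proof (induction t arbitrary: i j)
  case (Suc t)
  have lt: "i div N ^ t < N" "j div N ^ t < N" "i mod N ^ t < N ^ t" "j mod N ^ t < N ^ t"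
    using Suc.prems by (auto simp: less_mult_imp_div_less mod_less_of_less_mult[of _ N])
  have c: "(\<lambda>v. cnj (v $ (j div N ^ t))) \<in> borel_measurable (vec_borel N)"
    using measurable_compose[OF measurable_vec_index[OF lt(2)] borel_measurable_continuous_onI[OF continuous_on_cnj[OF continuous_on_id]]]
    by simp
  have "(\<lambda>v. (v $ (i div N ^ t) * cnj (v $ (j div N ^ t))) * tensor_power (outer v) t $$ (i mod N ^ t, j mod N ^ t))
      \<in> borel_measurable (vec_borel N)"
    by (intro borel_measurable_times measurable_vec_index[OF lt(1)] c Suc.IH[OF lt(3,4)])
  then show ?case
    using lt Suc.prems
    by (subst measurable_cong[where g = "\<lambda>v. (v $ (i div N ^ t) * cnj (v $ (j div N ^ t))) *
        tensor_power (outer v) t $$ (i mod N ^ t, j mod N ^ t)"])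
      (simp_all add: tensor_power_index_Suc[OF outer_carrier, where N = N] del: tensor_power_Suc)
qed simp

lemma tensor_power_outer_le:
  assumes v: "unit_state N v" and "i < N ^ t" "j < N ^ t"
  shows "cmod (tensor_power (outer v) t $$ (i, j)) \<le> 1"
  using assms(2,3)
proof (induction t arbitrary: i j)
  case (Suc t)
  have vc: "v \<in> carrier_vec N" by (rule unit_state_carrier[OF v])
  have lt: "i div N ^ t < N" "j div N ^ t < N" "i mod N ^ t < N ^ t" "j mod N ^ t < N ^ t"
    using Suc.prems by (auto simp: less_mult_imp_div_less mod_less_of_less_mult[of _ N])
  have "cmod (tensor_power (outer v) (Suc t) $$ (i, j)) =
      (cmod (v $ (i div N ^ t)) * cmod (v $ (j div N ^ t))) * cmod (tensor_power (outer v) t $$ (i mod N ^ t, j mod N ^ t))"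
    using lt vc Suc.prems
    by (simp add: tensor_power_index_Suc[OF outer_carrier[OF vc]] norm_mult del: tensor_power_Suc)
  also have "\<dots> \<le> 1 * 1 * 1"
    using lt by (intro mult_mono unit_state_index_le[OF v] Suc.IH) auto
  finally show ?case by simp
qed simp

lemma integrable_mat_haar:
  assumes \<mu>: "is_haar_measure N \<mu>"
  shows "integrable_mat \<mu> (N ^ t) (\<lambda>v. tensor_power (outer v) t)"
proof -
  interpret prob_space \<mu> using \<mu> by (simp add: is_haar_measure_def)
  have sets: "sets \<mu> = sets (vec_borel N)" and unit: "AE v in \<mu>. unit_state N v"
    using \<mu> by (auto simp: is_haar_measure_def)
  have sp: "space \<mu> = carrier_vec N" using sets_eq_imp_space_eq[OF sets] by simp
  show ?thesis
  proof unfold_locales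
    fix i j assume ij: "i < N ^ t" "j < N ^ t"
    show "integrable \<mu> (\<lambda>v. tensor_power (outer v) t $$ (i, j))"
    proof (rule integrable_const_bound[where B = 1])
      show "AE v in \<mu>. norm (tensor_power (outer v) t $$ (i, j)) \<le> 1"
        using unit by eventually_elim (rule tensor_power_outer_le[OF _ ij])
      show "(\<lambda>v. tensor_power (outer v) t $$ (i, j)) \<in> borel_measurable \<mu>"
        using measurable_tensor_power_outer[OF ij] by (simp add: measurable_cong_sets[OF sets refl])
    qed
  next
    show "AE v in \<mu>. mtrace (tensor_power (outer v) t) = 1"
      using unit
    proof eventually_elim
      case (elim v)
      then show ?case
        using mtrace_tensor_power[OF outer_carrier, of v N t] mtrace_outer[of v N] by (simp add: unit_state_def)
    qed
  qed (use sp in \<open>auto intro: tensor_power_adjoint\<close>)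
qed

text \<open>The underlying space of a \<open>pmf\<close> measure is the whole type, so dimension and
  self-adjointness must hold even for keys outside the support. Padding with zero matrices there
  ensures this without affecting any integral.\<close>

lemma integrable_mat_pmf:
  assumes "finite (set_pmf p)"
    and "\<And>k. k \<in> set_pmf p \<Longrightarrow> \<rho> k \<in> carrier_mat N N \<and> mat_adjoint (\<rho> k) = \<rho> k \<and> mtrace (\<rho> k) = 1"
    and "\<And>k. k \<notin> set_pmf p \<Longrightarrow> \<rho> k = 0\<^sub>m N N"
  shows "integrable_mat (measure_pmf p) (N ^ t) (\<lambda>k. tensor_power (\<rho> k) t)"
proof (unfold_locales)
  have c: "\<rho> k \<in> carrier_mat N N" for k using assms(2)[of k] assms(3)[of k] by (cases "k \<in> set_pmf p") auto
  have h: "mat_adjoint (\<rho> k) = \<rho> k" for k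
  proof (cases "k \<in> set_pmf p")
    case False
    have "mat_adjoint (0\<^sub>m N N) = (0\<^sub>m N N :: complex mat)" by (rule eq_matI) auto
    then show ?thesis using assms(3)[OF False] by simp
  qed (use assms(2) in auto)
  show "tensor_power (\<rho> k) t \<in> carrier_mat (N ^ t) (N ^ t)" for k using c by auto
  show "mat_adjoint (tensor_power (\<rho> k) t) = tensor_power (\<rho> k) t" for k by (rule tensor_power_adjoint[OF h])
  show "integrable (measure_pmf p) (\<lambda>k. tensor_power (\<rho> k) t $$ (i, j))" for i j
    by (rule integrable_measure_pmf_finite[OF assms(1)])
  show "AE k in measure_pmf p. mtrace (tensor_power (\<rho> k) t) = 1"
    using assms(2) by (auto simp: AE_measure_pmf_iff mtrace_tensor_power[where a = N])
qed

section \<open>From PRFS security to overlap moments\<close>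

text \<open>Input and output lengths are bounded by the size of the generating circuit. This is what
  makes the Pauli distinguishers polynomial in size.\<close>

lemma QPT_generator_poly_bounded:
  assumes "QPT_generator d n G"
  obtains p :: "nat poly" where "\<And>l. d l \<le> poly p l" "\<And>l. n l \<le> poly p l"
proof -
  obtain C where C: "QPT C" "\<And>l. c_in (C l) = l + d l \<and> c_out (C l) = n l"
    using assms unfolding QPT_generator_def by blast
  then obtain p :: "nat poly" where p: "\<And>l. circuit_size (C l) \<le> poly p l"
    unfolding QPT_def poly_size_def poly_bounded_def by blast
  have "d l \<le> circuit_size (C l)" "n l \<le> circuit_size (C l)" for l
    using C(2)[of l] by (simp_all add: circuit_size_def c_wires_def)
  then show ?thesis by (intro that[of p] order_trans[OF _ p])
qed

lemma set_pmf_uniform_bits: "set_pmf (uniform_bits l) = {k. length k = l}"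
  and finite_set_pmf_uniform_bits: "finite (set_pmf (uniform_bits l))"
proof -
  have "finite {k :: bool list. length k = l}"
    using finite_lists_length_eq[of "UNIV :: bool set" l] by simp
  moreover have "replicate l False \<in> {k. length k = l}" by simp
  ultimately show "set_pmf (uniform_bits l) = {k. length k = l}"
    unfolding uniform_bits_def by (intro set_pmf_of_set) blast+
  with \<open>finite _\<close> show "finite (set_pmf (uniform_bits l))" by simp
qed

text \<open>The security definition integrates over a product of independent Haar states, one per
  input; for a single input only coordinate 0 remains.\<close>

lemma integral_PiM_single:
  fixes h :: "'a \<Rightarrow> real"
  assumes "prob_space M" "h \<in> borel_measurable M"
  shows "(\<integral>\<theta>. h (\<theta> 0) \<partial>(\<Pi>\<^sub>M i\<in>{..<Suc 0}. M)) = (\<integral>v. h v \<partial>M)"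
proof -
  have "(\<integral>v. h v \<partial>M) = (\<integral>v. h v \<partial>distr (\<Pi>\<^sub>M i\<in>{..<Suc 0}. M) M (\<lambda>\<theta>. \<theta> 0))"
    using distr_PiM_component[of "{..<Suc 0}" "\<lambda>_. M" 0] assms(1) by simp
  also have "\<dots> = (\<integral>\<theta>. h (\<theta> 0) \<partial>(\<Pi>\<^sub>M i\<in>{..<Suc 0}. M))"
    using assms(2) by (intro integral_distr measurable_component_singleton) auto
  finally show ?thesis by simp
qed

lemma finite_paulis: "finite {Ps :: pauli list. length Ps = m}"
proof -
  have "(UNIV :: pauli set) = {PauliI, PauliX, PauliY, PauliZ}"
    using pauli.exhaust by blast
  moreover have "finite {PauliI, PauliX, PauliY, PauliZ}" by simp
  ultimately have "finite (UNIV :: pauli set)" by (rule ssubst)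
  from finite_lists_length_eq[OF this, of m] show ?thesis by simp
qed

text \<open>Security supplies a negligible function for one distinguisher family only, that is, for
  one Pauli string per security parameter. Applied to a string of maximal advantage, that function
  bounds the advantages of all strings at once, so the averaged states are close and their overlaps
  with the \<open>t\<close>-fold product of \<open>b l\<close> can be compared. The resulting
  function may depend on \<open>t\<close>. The restriction to \<open>0 < d l\<close> provides an
  input bit for the parity wire.\<close>

lemma prfs_overlap:
  assumes haar: "\<And>N. 0 < N \<Longrightarrow> is_haar_measure N (haar N)"
    and prfs: "PRFS_generator haar d n G"
    and G: "\<And>l k y. length k = l \<Longrightarrow> length y = d l \<Longrightarrow>
      density_mat (2 ^ n l) (G l k y) \<and> mat_adjoint (G l k y) = G l k y"
    and x: "\<And>l. length (x l) = d l" and b: "\<And>l. unit_state (2 ^ n l) (b l)"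
  shows "\<exists>\<epsilon>. negligible \<epsilon> \<and> (\<forall>l. 0 < d l \<longrightarrow>
    measure_pmf.expectation (uniform_bits l) (\<lambda>k. Re (expval (G l k (x l)) (b l)) ^ t) \<le>
      12 * 2 ^ t * fact (2 * t) / (2 ^ n l) ^ t + 4 ^ (n l * t) * (2 * \<epsilon> l))"
proof -
  have gen: "QPT_generator d n G" and sec: "PRFS_secure haar d n G"
    using prfs by (auto simp: PRFS_generator_def)
  define acc1 where "acc1 l Ps = measure_pmf.expectation (uniform_bits l)
    (\<lambda>k. accept_prob (pauli_circuit (d l) Ps) [x l] [tensor_power (G l k (x l)) t] (1\<^sub>m 1))" for l Ps
  define acc2 where "acc2 l Ps = (\<integral>\<theta>. accept_prob (pauli_circuit (d l) Ps) [x l]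
    [tensor_power (outer (\<theta> 0)) t] (1\<^sub>m 1) \<partial>(\<Pi>\<^sub>M i\<in>{..<Suc 0}. haar (2 ^ n l)))" for l Ps
  define \<Delta> where "\<Delta> l Ps = \<bar>acc1 l Ps - acc2 l Ps\<bar>" for l Ps
  \<comment> \<open>There are finitely many strings, so a maximal advantage is attained.\<close>
  have "\<exists>Ps. length Ps = n l * t \<and> (\<forall>Ps'. length Ps' = n l * t \<longrightarrow> \<Delta> l Ps' \<le> \<Delta> l Ps)" for l
  proof -
    let ?S = "{Ps :: pauli list. length Ps = n l * t}"
    have "replicate (n l * t) PauliI \<in> ?S" by simp
    then have ne: "\<Delta> l ` ?S \<noteq> {}" by blast
    have fin: "finite (\<Delta> l ` ?S)" using finite_paulis by blast
    obtain Ps where Ps: "length Ps = n l * t" "Max (\<Delta> l ` ?S) = \<Delta> l Ps"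
      using Max_in[OF fin ne] by (elim imageE) blast
    have "\<Delta> l Ps' \<le> \<Delta> l Ps" if "length Ps' = n l * t" for Ps'
      unfolding Ps(2)[symmetric] by (rule Max_ge[OF fin]) (use that in blast)
    with Ps(1) show ?thesis by blast
  qed
  then have "\<forall>l. \<exists>Ps. length Ps = n l * t \<and> (\<forall>Ps'. length Ps' = n l * t \<longrightarrow> \<Delta> l Ps' \<le> \<Delta> l Ps)"
    by blast
  from choice[OF this] obtain Q
    where Q: "\<And>l. length (Q l) = n l * t" "\<And>l Ps. length Ps = n l * t \<Longrightarrow> \<Delta> l Ps \<le> \<Delta> l (Q l)"
    by blast
  obtain p :: "nat poly" where p: "\<And>l. d l \<le> poly p l" "\<And>l. n l \<le> poly p l"
    using QPT_generator_poly_bounded[OF gen] by blast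
  have "poly_bounded (\<lambda>l. circuit_size (pauli_circuit (d l) (Q l)))"
    unfolding poly_bounded_def
  proof (intro exI allI)
    fix l
    have "circuit_size (pauli_circuit (d l) (Q l)) \<le> d l + 9 * (n l * t) + 2"
      using pauli_circuit_size[of "d l" "Q l"] by (simp add: Q(1))
    also have "\<dots> \<le> poly p l + 9 * (poly p l * t) + 2"
      using p[of l] by (intro add_mono mult_mono) auto
    also have "\<dots> = poly (p + [:9 * t:] * p + [:2:]) l"
      by simp
    finally show "circuit_size (pauli_circuit (d l) (Q l)) \<le> poly (p + [:9 * t:] * p + [:2:]) l" .
  qed
  then have size: "poly_size (\<lambda>l. pauli_circuit (d l) (Q l))"
    by (simp add: poly_size_def pauli_circuit_wf)
  have const: "poly_bounded (\<lambda>l. c)" for c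
    unfolding poly_bounded_def by (intro exI[of _ "[:c:]"]) simp
  have adv: "density_mat (2 ^ 0) (1\<^sub>m 1)"
  proof -
    have "0 \<le> expval (1\<^sub>m (Suc 0)) v" if "v \<in> carrier_vec (Suc 0)" for v
    proof -
      have "expval (1\<^sub>m (Suc 0)) v = v \<bullet>c v" using that by (simp add: expval_def)
      then show ?thesis unfolding cinner_self[OF that] by (simp add: less_eq_complex_def)
    qed
    then show ?thesis by (simp add: density_mat_def psd_mat_def mtrace_one)
  qed
  \<comment> \<open>The security game with one input, \<open>t\<close> copies and trivial advice on
    zero qubits; the non-uniformity lies entirely in the choice of \<open>Q l\<close>.\<close>
  have "\<exists>\<epsilon>. negligible \<epsilon> \<and> (\<forall>l. \<Delta> l (Q l) \<le> \<epsilon> l)"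
    using sec[unfolded PRFS_secure_def, rule_format, of "\<lambda>_. 1" "\<lambda>_. t" "\<lambda>l. [x l]" "\<lambda>l. pauli_circuit (d l) (Q l)"
        "\<lambda>_. 0" "\<lambda>_. 1\<^sub>m 1"] const size adv x Q(1)
    by (simp add: \<Delta>_def acc1_def acc2_def pauli_circuit_def mult.commute)
  then obtain \<epsilon> where \<epsilon>: "negligible \<epsilon>" "\<And>l. \<Delta> l (Q l) \<le> \<epsilon> l" by blast
  show ?thesis
  proof (intro exI[of _ \<epsilon>] conjI allI impI)
    show "negligible \<epsilon>" by (rule \<epsilon>)
    fix l assume dl: "0 < d l"
    let ?N = "2 ^ n l :: nat" and ?m = "n l * t" and ?U = "measure_pmf (uniform_bits l)"
    have xl: "x l \<noteq> []" using x[of l] dl by auto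
    have K: "?N ^ t = 2 ^ ?m" by (simp add: power_mult)
    \<comment> \<open>Outside the support nothing is known about \<open>G\<close>, so it is replaced
      there by the zero matrix to satisfy the interface for averaged states.\<close>
    define \<rho> where "\<rho> k = (if k \<in> set_pmf (uniform_bits l) then G l k (x l) else 0\<^sub>m ?N ?N)" for k
    have \<rho>eq: "\<rho> k = G l k (x l)" if "k \<in> set_pmf (uniform_bits l)" for k using that by (simp add: \<rho>_def)
    have \<rho>: "density_mat ?N (\<rho> k)" "mat_adjoint (\<rho> k) = \<rho> k" if "k \<in> set_pmf (uniform_bits l)" for k
      using G[of k l "x l"] that x by (auto simp: \<rho>eq set_pmf_uniform_bits)
    have \<rho>c: "\<rho> k \<in> carrier_mat ?N ?N" for k
      using \<rho>(1)[of k] by (cases "k \<in> set_pmf (uniform_bits l)") (auto simp: \<rho>_def density_mat_def psd_mat_def)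
    have f: "integrable_mat ?U (2 ^ ?m) (\<lambda>k. tensor_power (\<rho> k) t)"
      unfolding K[symmetric]
    proof (rule integrable_mat_pmf[OF finite_set_pmf_uniform_bits])
      show "\<rho> k \<in> carrier_mat ?N ?N \<and> mat_adjoint (\<rho> k) = \<rho> k \<and> mtrace (\<rho> k) = 1"
        if "k \<in> set_pmf (uniform_bits l)" for k
        using \<rho>[OF that] \<rho>c[of k] by (auto simp: density_mat_def)
    qed (simp add: \<rho>_def)
    let ?H = "haar (2 ^ n l)"
    have hN: "is_haar_measure ?N ?H" using haar by simp
    then have prob: "prob_space ?H" by (simp add: is_haar_measure_def)
    have g: "integrable_mat ?H (2 ^ ?m) (\<lambda>v. tensor_power (outer v) t)"
      using integrable_mat_haar[OF hN, of t] by (simp only: K)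
    interpret g: integrable_mat ?H "2 ^ ?m" "\<lambda>v. tensor_power (outer v) t" by (rule g)
    define v where "v = vec_power (b l) t"
    have v: "unit_state (2 ^ ?m) v"
      using unit_state_vec_power[OF b[of l], of t] by (simp only: v_def K)
    have close: "\<bar>(\<integral>k. accept_prob (pauli_circuit (length (x l)) Ps) [x l] [tensor_power (\<rho> k) t] (1\<^sub>m 1) \<partial>?U)
       - (\<integral>v. accept_prob (pauli_circuit (length (x l)) Ps) [x l] [tensor_power (outer v) t] (1\<^sub>m 1) \<partial>?H)\<bar> \<le> \<epsilon> l"
      if Ps: "length Ps = ?m" for Ps
    proof -
      let ?h = "\<lambda>v. accept_prob (pauli_circuit (length (x l)) Ps) [x l] [tensor_power (outer v) t] (1\<^sub>m 1)"
      have 1: "(\<integral>k. accept_prob (pauli_circuit (length (x l)) Ps) [x l] [tensor_power (\<rho> k) t] (1\<^sub>m 1) \<partial>?U) = acc1 l Ps"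
        unfolding acc1_def x by (intro integral_cong_AE) (auto simp: AE_measure_pmf_iff \<rho>eq)
      have Qc: "pauli_mat Ps \<in> carrier_mat (2 ^ ?m) (2 ^ ?m)" using pauli_mat_carrier[of Ps] Ps by simp
      have acc: "?h v = Re ((mtrace (tensor_power (outer v) t) - (if hd (x l) then - 1 else 1) *
          mtrace (pauli_mat Ps * tensor_power (outer v) t)) / 2)" if "v \<in> space ?H" for v
        unfolding accept_prob_single
        using run_pauli_circuit[OF xl, of "tensor_power (outer v) t" Ps] g.f_carrier[OF that] Ps
        by (simp only:)
      have "?h \<in> borel_measurable ?H"
        using borel_measurable_integrable[OF g.accept_pauli(1)[OF Qc, of "if hd (x l) then - 1 else 1"]]
        by (subst measurable_cong[OF acc])
      from integral_PiM_single[OF prob this]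
      have 2: "(\<integral>v. ?h v \<partial>?H) = acc2 l Ps"
        unfolding acc2_def x by simp
      show ?thesis
        unfolding 1 2 using Q(2)[OF Ps] \<epsilon>(2)[of l] by (simp add: \<Delta>_def)
    qed
    have cl: "cmod ((\<integral>k. expval (tensor_power (\<rho> k) t) v \<partial>?U) - (\<integral>w. expval (tensor_power (outer w) t) v \<partial>?H))
        \<le> 4 ^ ?m * (2 * \<epsilon> l)"
      by (rule mean_expval_close[OF f g xl close v])
    \<comment> \<open>Positivity makes the overlap real, so the complex average is the average of
      real \<open>t\<close>-th powers.\<close>
    have real: "expval (\<rho> k) (b l) = of_real (Re (expval (\<rho> k) (b l)))" if "k \<in> set_pmf (uniform_bits l)" for k
      using \<rho>(1)[OF that] unit_state_carrier[OF b[of l]]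
      by (auto simp: density_mat_def psd_mat_def less_eq_complex_def complex_eq_iff)
    have "(\<integral>k. expval (tensor_power (\<rho> k) t) v \<partial>?U) =
        (\<integral>k. of_real (Re (expval (G l k (x l)) (b l)) ^ t) \<partial>?U)"
    proof (rule integral_cong_AE)
      show "AE k in ?U. expval (tensor_power (\<rho> k) t) v = of_real (Re (expval (G l k (x l)) (b l)) ^ t)"
      proof (unfold AE_measure_pmf_iff, intro ballI)
        fix k assume k: "k \<in> set_pmf (uniform_bits l)"
        show "expval (tensor_power (\<rho> k) t) v = of_real (Re (expval (G l k (x l)) (b l)) ^ t)"
          unfolding v_def expval_tensor_power[OF \<rho>c b] of_real_power
          using real[OF k] by (simp only: \<rho>eq[OF k])
      qed
    qed auto
    also have "\<dots> = of_real (\<integral>k. Re (expval (G l k (x l)) (b l)) ^ t \<partial>?U)"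
      by (rule integral_complex_of_real)
    finally have e1: "(\<integral>k. expval (tensor_power (\<rho> k) t) v \<partial>?U) = \<dots>" .
    have sp: "space ?H = carrier_vec ?N"
      using hN sets_eq_imp_space_eq[of ?H "vec_borel ?N"] by (simp add: is_haar_measure_def)
    have "(\<integral>w. expval (tensor_power (outer w) t) v \<partial>?H) = (\<integral>w. of_real (cmod (w \<bullet>c b l) ^ (2 * t)) \<partial>?H)"
    proof (rule Bochner_Integration.integral_cong[OF refl])
      fix w assume "w \<in> space ?H"
      then have w: "w \<in> carrier_vec ?N" by (simp add: sp)
      have bl: "b l \<in> carrier_vec ?N" by (rule unit_state_carrier[OF b])
      show "expval (tensor_power (outer w) t) v = of_real (cmod (w \<bullet>c b l) ^ (2 * t))"
        unfolding v_def expval_tensor_power[OF outer_carrier[OF w] b] expval_outer[OF w bl]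
        using cinner_swap[OF w bl] by (simp add: power_mult)
    qed
    also have "\<dots> = of_real (\<integral>w. cmod (w \<bullet>c b l) ^ (2 * t) \<partial>?H)"
      by (rule integral_complex_of_real)
    finally have e2: "(\<integral>w. expval (tensor_power (outer w) t) v \<partial>?H) = \<dots>" .
    have "(\<integral>w. cmod (w \<bullet>c b l) ^ (2 * t) \<partial>?H) \<le> 12 * 2 ^ t * fact (2 * t) / real ?N ^ t"
      by (rule haar_moment[OF hN b]) simp
    moreover have "\<bar>(\<integral>k. Re (expval (G l k (x l)) (b l)) ^ t \<partial>?U) - (\<integral>w. cmod (w \<bullet>c b l) ^ (2 * t) \<partial>?H)\<bar> \<le> 4 ^ ?m * (2 * \<epsilon> l)"
      using cl unfolding e1 e2 of_real_diff[symmetric] norm_of_real .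
    ultimately show "(\<integral>k. Re (expval (G l k (x l)) (b l)) ^ t \<partial>?U) \<le>
      12 * 2 ^ t * fact (2 * t) / (2 ^ n l) ^ t + 4 ^ (n l * t) * (2 * \<epsilon> l)"
      by simp
  qed
qed

section \<open>Recognizable abort\<close>

lemma cinner_unit_vecs: "unit_vec 2 (Suc 0) \<bullet>c unit_vec 2 0 = (0 :: complex)"
  "unit_vec 2 0 \<bullet>c unit_vec 2 0 = (1 :: complex)" "unit_vec 2 (Suc 0) \<bullet>c unit_vec 2 (Suc 0) = (1 :: complex)"
  by (simp_all add: cinner_sum[of _ 2] numeral_2_eq_2)

lemma unit_state_unit_vec: "unit_state 2 (unit_vec 2 0)" "unit_state 2 (unit_vec 2 (Suc 0))"
  by (simp_all add: unit_state_def cinner_unit_vecs)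

lemma unit_state_bot_state: "unit_state N bh \<Longrightarrow> unit_state (2 * N) (bot_state bh)"
  unfolding bot_state_def One_nat_def by (intro unit_state_kron_vec unit_state_unit_vec)

text \<open>The right-hand side required of \<open>Ghat\<close> by
  \<open>recognizable_abort\<close>, kept verbatim so that unfolding matches it.\<close>

definition abort_mix :: "real \<Rightarrow> complex vec \<Rightarrow> complex vec \<Rightarrow> complex mat" where
  "abort_mix \<eta> \<psi> bh = complex_of_real \<eta> \<cdot>\<^sub>m (outer (unit_vec 2 0) \<otimes>\<^sub>K outer \<psi>) +
     complex_of_real (1 - \<eta>) \<cdot>\<^sub>m outer (bot_state bh)"

lemma abort_mix_eq:
  assumes "\<psi> \<in> carrier_vec N"
  shows "abort_mix \<eta> \<psi> bh = complex_of_real \<eta> \<cdot>\<^sub>m outer (kron_vec (unit_vec 2 0) \<psi>) +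
     complex_of_real (1 - \<eta>) \<cdot>\<^sub>m outer (bot_state bh)"
  unfolding abort_mix_def using outer_kron_vec[OF unit_vec_carrier assms, of 2 0] by simp

lemma density_mat_abort_mix:
  assumes "unit_state N \<psi>" "unit_state N bh" "0 \<le> \<eta>" "\<eta> \<le> 1"
  shows "density_mat (2 * N) (abort_mix \<eta> \<psi> bh)"
  unfolding abort_mix_eq[OF unit_state_carrier[OF assms(1)]]
  by (intro density_mat_mix density_mat_outer unit_state_kron_vec unit_state_bot_state
      unit_state_unit_vec assms)

lemma ptrace_first_abort_mix:
  assumes \<psi>: "\<psi> \<in> carrier_vec N" and bh: "bh \<in> carrier_vec N"
  shows "ptrace_first 2 N (abort_mix \<eta> \<psi> bh) =
    complex_of_real \<eta> \<cdot>\<^sub>m outer \<psi> + complex_of_real (1 - \<eta>) \<cdot>\<^sub>m outer bh"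
proof (rule eq_matI)
  fix i j assume "i < dim_row (complex_of_real \<eta> \<cdot>\<^sub>m outer \<psi> + complex_of_real (1 - \<eta>) \<cdot>\<^sub>m outer bh)"
    "j < dim_col (complex_of_real \<eta> \<cdot>\<^sub>m outer \<psi> + complex_of_real (1 - \<eta>) \<cdot>\<^sub>m outer bh)"
  then have ij: "i < N" "j < N" using bh by (auto simp: dim_outer)
  have d: "dim_vec \<psi> = N" "dim_vec bh = N" using \<psi> bh by auto
  have bs: "outer (bot_state bh) = proj1 \<otimes>\<^sub>K outer bh"
    unfolding bot_state_def One_nat_def by (rule outer_kron_vec[OF unit_vec_carrier bh])
  have dp: "dim_row proj0 = 2" "dim_col proj0 = 2" "dim_row proj1 = 2" "dim_col proj1 = 2"
    by (simp_all add: dim_outer)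
  have "abort_mix \<eta> \<psi> bh $$ (i, j) = complex_of_real \<eta> * outer \<psi> $$ (i, j)"
    "abort_mix \<eta> \<psi> bh $$ (N + i, N + j) = complex_of_real (1 - \<eta>) * outer bh $$ (i, j)"
    unfolding abort_mix_def bs using ij
    by (simp_all add: index_kron dp dim_outer d) (simp_all add: outer_unit_vec_eq mat2_def)
  then show "ptrace_first 2 N (abort_mix \<eta> \<psi> bh) $$ (i, j) =
      (complex_of_real \<eta> \<cdot>\<^sub>m outer \<psi> + complex_of_real (1 - \<eta>) \<cdot>\<^sub>m outer bh) $$ (i, j)"
    using ij by (simp add: ptrace_first_def numeral_2_eq_2 dim_outer d)
qed (use \<psi> bh in \<open>auto simp: ptrace_first_def dim_outer\<close>)

text \<open>The abort branch contributes exactly \<open>1 - \<eta>\<close>, and any overlap of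
  \<open>\<psi>\<close> with \<open>bh\<close> only adds to it. Hence a small overlap certifies a
  small abort probability.\<close>

lemma expval_ptrace_abort_mix:
  assumes \<psi>: "unit_state N \<psi>" and bh: "unit_state N bh" and \<eta>: "0 \<le> \<eta>" "\<eta> \<le> 1"
  shows "1 - \<eta> \<le> Re (expval (ptrace_first 2 N (abort_mix \<eta> \<psi> bh)) bh)"
proof -
  have c: "\<psi> \<in> carrier_vec N" "bh \<in> carrier_vec N" using \<psi> bh by (auto simp: unit_state_def)
  have "expval (ptrace_first 2 N (abort_mix \<eta> \<psi> bh)) bh =
      complex_of_real (\<eta> * (cmod (bh \<bullet>c \<psi>))\<^sup>2 + (1 - \<eta>) * (cmod (bh \<bullet>c bh))\<^sup>2)"
    unfolding ptrace_first_abort_mix[OF c]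
    using c by (simp add: expval_add[of _ N] expval_smult[of _ N] expval_outer[of _ N])
  then show ?thesis using bh \<eta>(1) by (simp add: unit_state_def)
qed

text \<open>\<open>V\<close> fixes the first qubit, so it sends the abort vector to one that still
  starts with |1> and is orthogonal to the non-abort branch. Only the abort branch contributes, with
  a squared overlap of at most 1.\<close>

lemma expval_conj_abort_mix:
  assumes \<psi>: "unit_state N \<psi>" and bh: "unit_state N bh" and \<eta>: "0 \<le> \<eta>" "\<eta> \<le> 1"
    and W: "W \<in> carrier_mat N N" "mat_adjoint W = W" "W * W = 1\<^sub>m N"
  defines "V \<equiv> 1\<^sub>m 2 \<otimes>\<^sub>K W"
  shows "density_mat (2 * N) (V * abort_mix \<eta> \<psi> bh * V)"
    and "Re (expval (V * abort_mix \<eta> \<psi> bh * V) (bot_state bh)) \<le> 1 - \<eta>"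
proof -
  have c: "\<psi> \<in> carrier_vec N" "bh \<in> carrier_vec N" using \<psi> bh by (auto simp: unit_state_def)
  have V: "V \<in> carrier_mat (2 * N) (2 * N)" "mat_adjoint V = V"
    using W(1,2) by (auto simp: V_def kron_adjoint)
  have VV: "V * V = 1\<^sub>m (2 * N)"
    unfolding V_def kron_mult[OF one_carrier_mat one_carrier_mat W(1) W(1)] W(3)
    by (simp add: kron_one)
  note dens = density_mat_abort_mix[OF \<psi> bh \<eta>]
  show "density_mat (2 * N) (V * abort_mix \<eta> \<psi> bh * V)"
    by (rule density_mat_conj[OF dens V VV])
  have bc: "bot_state bh \<in> carrier_vec (2 * N)"
    by (rule unit_state_carrier[OF unit_state_bot_state[OF bh]])
  have Wb: "W *\<^sub>v bh \<in> carrier_vec N" using W(1) c(2) by auto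
  have "(W *\<^sub>v bh) \<bullet>c (W *\<^sub>v bh) = bh \<bullet>c (W *\<^sub>v (W *\<^sub>v bh))"
    using cinner_mat_adjoint[OF W(1) c(2) Wb] W(2) by simp
  also have "W *\<^sub>v (W *\<^sub>v bh) = bh"
    using W(1,3) c(2) by (simp flip: assoc_mult_mat_vec[OF W(1) W(1) c(2)])
  finally have uW: "unit_state N (W *\<^sub>v bh)"
    using bh Wb by (simp add: unit_state_def)
  have Vb: "V *\<^sub>v bot_state bh = kron_vec (unit_vec 2 (Suc 0)) (W *\<^sub>v bh)"
    unfolding bot_state_def V_def One_nat_def
    using kron_mult_vec[OF one_carrier_mat W(1) unit_vec_carrier c(2), of 2 "Suc 0"] by simp
  let ?w = "kron_vec (unit_vec 2 (Suc 0)) (W *\<^sub>v bh)" and ?p = "kron_vec (unit_vec 2 0) \<psi>"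
  have uw: "unit_state (2 * N) ?w" by (intro unit_state_kron_vec unit_state_unit_vec uW)
  have wc: "?w \<in> carrier_vec (2 * N)" and pc: "?p \<in> carrier_vec (2 * N)"
    using Wb c by auto
  have orth: "?w \<bullet>c ?p = 0"
    by (subst cinner_kron_vec[OF unit_vec_carrier unit_vec_carrier Wb c(1)]) (simp add: cinner_unit_vecs)
  have "expval (V * abort_mix \<eta> \<psi> bh * V) (bot_state bh) = expval (abort_mix \<eta> \<psi> bh) ?w"
    using dens by (subst expval_conj[OF _ V bc]) (auto simp: Vb density_mat_def psd_mat_def)
  also have "\<dots> = complex_of_real (\<eta> * (cmod (?w \<bullet>c ?p))\<^sup>2 + (1 - \<eta>) * (cmod (?w \<bullet>c bot_state bh))\<^sup>2)"
    unfolding abort_mix_eq[OF c(1)] using wc pc bc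
    by (simp add: expval_add[of _ "2 * N"] expval_smult[of _ "2 * N"] expval_outer[of _ "2 * N"])
  finally have "Re (expval (V * abort_mix \<eta> \<psi> bh * V) (bot_state bh)) = (1 - \<eta>) * (cmod (?w \<bullet>c bot_state bh))\<^sup>2"
    by (simp only: orth) simp
  also have "\<dots> \<le> (1 - \<eta>) * 1"
    using \<eta> cauchy_schwarz_unit[OF uw unit_state_bot_state[OF bh]]
    by (intro mult_left_mono power_le_one) auto
  finally show "Re (expval (V * abort_mix \<eta> \<psi> bh * V) (bot_state bh)) \<le> 1 - \<eta>" by simp
qed

lemma recognizable_abort_density:
  assumes abort: "recognizable_abort d n G Ghat bothat" and k: "length k = l" and y: "length y = d l"
  shows "density_mat (2 ^ n l) (G l k y)" "mat_adjoint (G l k y) = G l k y"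
proof -
  have bh: "unit_state (2 ^ n l) (bothat l)" using abort by (simp add: recognizable_abort_def)
  obtain \<eta> \<psi> where e: "0 \<le> \<eta>" "\<eta> \<le> 1" "unit_state (2 ^ n l) \<psi>"
    and G: "Ghat l k y = abort_mix \<eta> \<psi> (bothat l)" "G l k y = ptrace_first 2 (2 ^ n l) (Ghat l k y)"
    using abort k y unfolding recognizable_abort_def abort_mix_def by blast
  note c = unit_state_carrier[OF e(3)] unit_state_carrier[OF bh]
  have Geq: "G l k y = complex_of_real \<eta> \<cdot>\<^sub>m outer \<psi> + complex_of_real (1 - \<eta>) \<cdot>\<^sub>m outer (bothat l)"
    unfolding G ptrace_first_abort_mix[OF c] ..
  show "density_mat (2 ^ n l) (G l k y)"
    unfolding Geq by (intro density_mat_mix density_mat_outer e bh)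
  have oc: "complex_of_real \<eta> \<cdot>\<^sub>m outer \<psi> \<in> carrier_mat (2 ^ n l) (2 ^ n l)"
    "complex_of_real (1 - \<eta>) \<cdot>\<^sub>m outer (bothat l) \<in> carrier_mat (2 ^ n l) (2 ^ n l)"
    by (intro smult_carrier_mat outer_carrier c)+
  show "mat_adjoint (G l k y) = G l k y"
    unfolding Geq mat_adjoint_add[OF oc] mat_adjoint_smult by simp
qed

text \<open>The abort probability lies between the two overlaps and is thereby eliminated: control
  of \<open>G\<close>, which security provides, passes directly to the channel output tested by
  \<open>Verify\<close>.\<close>

lemma recognizable_abort_Phi:
  assumes abort: "recognizable_abort d n G Ghat bothat"
    and k: "length k = l" and y: "length y = d l" and P: "length P = n l"
  shows "density_mat (2 ^ (n l + 1)) (Phi Ghat l (P, k, y, b))"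
    and "Re (expval (Phi Ghat l (P, k, y, b)) (bot_state (bothat l))) \<le> Re (expval (G l k y) (bothat l))"
proof -
  let ?N = "2 ^ n l :: nat"
  have bh: "unit_state ?N (bothat l)" using abort by (simp add: recognizable_abort_def)
  obtain \<eta> \<psi> where e: "0 \<le> \<eta>" "\<eta> \<le> 1" "unit_state ?N \<psi>"
    and G: "Ghat l k y = abort_mix \<eta> \<psi> (bothat l)" "G l k y = ptrace_first 2 ?N (Ghat l k y)"
    using abort k y unfolding recognizable_abort_def abort_mix_def by blast
  define W where "W = (if b then pauli_mat P else 1\<^sub>m (2 ^ length P))"
  have W: "W \<in> carrier_mat ?N ?N" "mat_adjoint W = W" "W * W = 1\<^sub>m ?N"
    using pauli_mat_carrier[of P] pauli_mat_square[of P] P by (auto simp: W_def)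
  have Phi: "Phi Ghat l (P, k, y, b) = (1\<^sub>m 2 \<otimes>\<^sub>K W) * abort_mix \<eta> \<psi> (bothat l) * (1\<^sub>m 2 \<otimes>\<^sub>K W)"
    by (simp add: W_def G Let_def)
  show "density_mat (2 ^ (n l + 1)) (Phi Ghat l (P, k, y, b))"
    using expval_conj_abort_mix(1)[OF e(3) bh e(1,2) W] unfolding Phi by simp
  have "Re (expval (Phi Ghat l (P, k, y, b)) (bot_state (bothat l))) \<le> 1 - \<eta>"
    using expval_conj_abort_mix(2)[OF e(3) bh e(1,2) W] unfolding Phi .
  also have "\<dots> \<le> Re (expval (G l k y) (bothat l))"
    unfolding G by (rule expval_ptrace_abort_mix[OF e(3) bh e(1,2)])
  finally show "Re (expval (Phi Ghat l (P, k, y, b)) (bot_state (bothat l))) \<le> Re (expval (G l k y) (bothat l))" .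
qed

section \<open>Correctness for a single key\<close>

lemma pmf_bind_ge:
  assumes "\<And>x. x \<in> set_pmf p \<Longrightarrow> x \<in> A \<Longrightarrow> c \<le> pmf (f x) v" and "0 \<le> c"
  shows "measure_pmf.prob p A * c \<le> pmf (bind_pmf p f) v"
proof -
  have "measure_pmf.prob p A * c = measure_pmf.expectation p (\<lambda>x. indicator A x * c)"
    by simp
  also have "\<dots> \<le> measure_pmf.expectation p (\<lambda>x. pmf (f x) v)"
  proof (rule integral_mono_AE)
    show "integrable (measure_pmf p) (\<lambda>x. indicator A x * c)"
      by (rule measure_pmf.integrable_const_bound[where B = "\<bar>c\<bar>"]) (auto simp: indicator_def)
    show "integrable (measure_pmf p) (\<lambda>x. pmf (f x) v)"
      by (rule measure_pmf.integrable_const_bound[where B = 1]) (auto simp: pmf_le_1)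
    show "AE x in measure_pmf p. indicator A x * c \<le> pmf (f x) v"
      using assms by (auto simp: AE_measure_pmf_iff indicator_def)
  qed
  also have "\<dots> = pmf (bind_pmf p f) v"
    by (simp add: pmf_bind)
  finally show ?thesis .
qed

text \<open>The square comes from two independent tomography runs, the one being verified and the
  one inside \<open>Verify\<close>; the verdict is \<open>Valid\<close> whenever both are
  accurate.\<close>

lemma verify_correct:
  assumes T: "tomography_procedure T" and \<rho>: "density_mat (2 ^ (n l + 1)) (Phi Ghat l inp)"
    and L: "L l = 3 ^ 8 * 2 ^ (3 * (n l + 1) + 2) * l"
    and bot: "unit_state (2 ^ n l) (bothat l)"
    and small: "Re (expval (Phi Ghat l inp) (bot_state (bothat l))) \<le> 2 / 27"
  shows "(1 - (sqrt 3 / 2) ^ l)\<^sup>2 \<le>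
    pmf (bind_pmf (Tomography T n l (Phi Ghat l inp) (L l)) (\<lambda>M. Verify T n Ghat bothat L l inp M)) Valid"
proof -
  define N where "N = (2 ^ (n l + 1) :: nat)"
  define s where "s = (3 ^ 8 * N :: nat)"
  define \<rho>' where "\<rho>' = Phi Ghat l inp"
  define \<delta> where "\<delta> = (sqrt 3 / 2) ^ l"
  define tomo where "tomo = Tomography T n l \<rho>' (L l)"
  define A where "A = {Mo. \<exists>M. Mo = Some M \<and> M \<in> carrier_mat N N \<and> frob_norm (M - \<rho>') \<le> 1 / 27}"
  have dens: "density_mat N \<rho>'" using \<rho> by (simp add: \<rho>'_def N_def)
  then have \<rho>c: "\<rho>' \<in> carrier_mat N N" by (simp add: density_mat_def psd_mat_def)
  have N: "0 < N" "0 < s" by (simp_all add: N_def s_def)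
  have "sqrt 3 \<le> 2" by (rule real_le_lsqrt) auto
  then have \<delta>: "0 \<le> \<delta>" "\<delta> \<le> 1"
    unfolding \<delta>_def by (intro zero_le_power power_le_one; simp)+
  \<comment> \<open>The three summands account for the factor 4 of the boosted procedure, the factor
    N contained in \<open>s\<close>, and N^2.\<close>
  have "3 * (n l + 1) + 2 = 2 + (n l + 1) + (n l + 1) * 2" by simp
  then have "2 ^ (3 * (n l + 1) + 2) = 4 * N * N\<^sup>2"
    unfolding N_def by (simp only: power_add power_mult) simp
  then have Ll: "L l = 4 * s * N\<^sup>2 * l"
    unfolding L s_def by simp
  \<comment> \<open>Since \<open>s\<close> is 3^8 N, the selection error 3 sqrt(N/s) equals 3/81 =
    1/27.\<close>
  have "real N / real s = (1 / 81)\<^sup>2" using N by (simp add: s_def power2_eq_square)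
  then have rt: "3 * sqrt (real N / real s) = 1 / 27" by simp
  have tomo: "1 - \<delta> \<le> measure_pmf.prob tomo A"
    using T_imp_accurate[OF T dens N(2,1), of l]
    unfolding tomo_def Tomography_def Ll s_def[symmetric] N_def[symmetric] rt A_def \<delta>_def .
  let ?b = "bot_state (bothat l)"
  have bu: "unit_state N ?b" using unit_state_bot_state[OF bot] by (simp add: N_def)
  have valid: "1 - \<delta> \<le> pmf (Verify T n Ghat bothat L l inp Mo) Valid" if Mo: "Mo \<in> A" for Mo
  proof -
    obtain M where M: "Mo = Some M" "M \<in> carrier_mat N N" "frob_norm (M - \<rho>') \<le> 1 / 27"
      using Mo by (auto simp: A_def)
    have sum: "\<rho>' + (M - \<rho>') = M"
      using M(2) \<rho>c by (intro eq_matI) auto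
    have "expval M ?b = expval \<rho>' ?b + expval (M - \<rho>') ?b"
      using expval_add[OF \<rho>c minus_carrier_mat[OF \<rho>c] unit_state_carrier[OF bu], of M] unfolding sum .
    moreover have "Re (expval (M - \<rho>') ?b) \<le> 1 / 27"
      using complex_Re_le_cmod[of "expval (M - \<rho>') ?b"] expval_le_frob_norm[OF minus_carrier_mat[OF \<rho>c] bu, of M] M(3)
      by linarith
    ultimately have small': "\<not> Re (expval M ?b) > 1 / 9"
      using small unfolding \<rho>'_def[symmetric] by simp
    define h where "h = (\<lambda>Mo'. case (Some M, Mo') of
         (Some M, Some Mhat) \<Rightarrow>
           (if Re (expval M ?b) > 1 / 9 then Invalid
            else if (frob_norm (M - Mhat))\<^sup>2 \<le> 4 / 729 then Valid
            else Invalid)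
       | _ \<Rightarrow> Invalid)"
    have "A \<subseteq> h -` {Valid}"
    proof
      fix Mo' assume "Mo' \<in> A"
      then obtain M' where M': "Mo' = Some M'" "M' \<in> carrier_mat N N" "frob_norm (M' - \<rho>') \<le> 1 / 27"
        by (auto simp: A_def)
      have "frob_norm (M - M') \<le> 2 / 27"
        using frob_norm_triangle[OF M(2) M'(2) \<rho>c] M(3) M'(3) by linarith
      then have "(frob_norm (M - M'))\<^sup>2 \<le> (2 / 27)\<^sup>2"
        by (rule power_mono) (rule frob_norm_nonneg)
      then have "(frob_norm (M - M'))\<^sup>2 \<le> 4 / 729" by (simp add: power2_eq_square)
      then show "Mo' \<in> h -` {Valid}" using small' by (simp add: h_def M')
    qed
    then have "measure_pmf.prob tomo A \<le> measure_pmf.prob tomo (h -` {Valid})"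
      by (intro measure_pmf.finite_measure_mono) auto
    also have "\<dots> = pmf (Verify T n Ghat bothat L l inp Mo) Valid"
      unfolding Verify_def M(1) h_def tomo_def \<rho>'_def by (simp add: pmf_map)
    finally show ?thesis using tomo by simp
  qed
  have "(1 - \<delta>)\<^sup>2 \<le> measure_pmf.prob tomo A * (1 - \<delta>)"
    unfolding power2_eq_square using tomo \<delta> by (intro mult_right_mono) auto
  also have "\<dots> \<le> pmf (bind_pmf tomo (\<lambda>M. Verify T n Ghat bothat L l inp M)) Valid"
    using \<delta> by (intro pmf_bind_ge valid) auto
  finally show ?thesis by (simp add: \<delta>_def tomo_def \<rho>'_def)
qed

section \<open>Assembling the bounds\<close>

text \<open>The lower bound makes the Haar moments small; the upper bound keeps the loss from Pauli
  inversion polynomial. Rounding up costs at most the factor 2.\<close>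

lemma two_power_n_len:
  assumes "1 \<le> l"
  shows "real l ^ 3 \<le> 2 ^ n_len l" and "2 ^ n_len l \<le> 2 * real l ^ 3"
proof -
  have l: "0 < real l" using assms by simp
  have "0 \<le> log 2 (real l)" using assms by (simp add: zero_le_log_cancel_iff)
  then have n: "real (n_len l) = of_int \<lceil>3 * log 2 (real l)\<rceil>"
    by (simp add: n_len_def)
  have l3: "2 powr (3 * log 2 (real l)) = real l ^ 3"
  proof -
    have "2 powr (3 * log 2 (real l)) = (2 powr log 2 (real l)) powr 3"
      by (simp add: powr_powr mult.commute)
    then show ?thesis using l by (simp add: powr_numeral)
  qed
  have p: "2 ^ n_len l = (2 :: real) powr real (n_len l)" by (simp add: powr_realpow)
  show "real l ^ 3 \<le> 2 ^ n_len l"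
    unfolding p l3[symmetric] n by (intro powr_mono) auto
  have "2 powr real (n_len l) \<le> (2 :: real) powr (3 * log 2 (real l) + 1)"
    unfolding n by (intro powr_mono) linarith+
  also have "\<dots> = 2 * real l ^ 3" by (simp add: powr_add l3)
  finally show "2 ^ n_len l \<le> 2 * real l ^ 3" unfolding p .
qed

text \<open>From 4 on the iterated logarithm is at least 1, so the quotient is positive. This
  guarantees the input bit that serves as the parity wire.\<close>

lemma d_len_pos:
  assumes "4 \<le> l"
  shows "0 < d_len l"
proof -
  have "log 2 4 = (2 :: real)" using log_pow_cancel[of 2 2] by simp
  then have 2: "2 \<le> log 2 (real l)"
    using assms log_mono[of 2 4 "real l"] by simp
  then have "1 \<le> log 2 (log 2 (real l))"
    using log_mono[of 2 2 "log 2 (real l)"] by simp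
  with 2 have "0 < log 2 (real l) / log 2 (log 2 (real l))" by simp
  then show ?thesis by (simp add: d_len_def)
qed

lemma geometric_bigo: "(\<lambda>l. (sqrt 3 / 2) ^ l) \<in> O(\<lambda>l. 1 / real l ^ c)"
proof -
  have "sqrt 3 < 2" by (rule real_less_lsqrt) auto
  then have r: "0 < sqrt 3 / 2" "sqrt 3 / 2 < 1" by auto
  \<comment> \<open>The base is generalised so that the asymptotic comparison depends only on its
    lying strictly between 0 and 1.\<close>
  have "(\<lambda>l. r ^ l) \<in> O(\<lambda>l. 1 / real l ^ c)" if "0 < r" "r < 1" for r :: real
    using that by real_asymp
  from this[OF r] show ?thesis .
qed

theorem lemma7p7:
  fixes haar :: "nat \<Rightarrow> complex vec measure"
    and G Ghat :: "nat \<Rightarrow> bool list \<Rightarrow> bool list \<Rightarrow> complex mat"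
    and bothat :: "nat \<Rightarrow> complex vec"
    and T :: "nat \<Rightarrow> nat \<Rightarrow> complex mat \<Rightarrow> complex mat pmf"
    and L :: "nat \<Rightarrow> nat"
  assumes haar: "\<And>N. 0 < N \<Longrightarrow> is_haar_measure N (haar N)"
    and prfs: "PRFS_generator haar d_len n_len G"
    and abort: "recognizable_abort d_len n_len G Ghat bothat"
    and tomo: "tomography_procedure T"
    and L: "\<And>l. L l = 3 ^ 8 * 2 ^ (3 * (n_len l + 1) + 2) * l"
  shows "(\<lambda>l. real (L l)) \<in> O(\<lambda>l. 2 ^ (3 * n_len l) * real l)
    \<and> (\<forall>P x b.
         (\<forall>l. length (P l) = n_len l \<and> length (x l) = d_len l) \<longrightarrow>
         distributional_same_input_correctness (Phi Ghat) (Tomography T n_len)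
           (Verify T n_len Ghat bothat L) L (input_dist P x b))"
proof (intro conjI allI impI)
  have "real (L l) = 3 ^ 8 * 32 * (2 ^ (3 * n_len l) * real l)" for l
  proof -
    have "3 * (n_len l + 1) + 2 = 5 + 3 * n_len l" by simp
    then have "real (L l) = 3 ^ 8 * (2 ^ 5 * 2 ^ (3 * n_len l)) * real l"
      unfolding L by (simp only: power_add of_nat_mult of_nat_power of_nat_numeral)
    then show ?thesis by simp
  qed
  then show "(\<lambda>l. real (L l)) \<in> O(\<lambda>l. 2 ^ (3 * n_len l) * real l)"
    by simp
next
  fix P :: "nat \<Rightarrow> pauli list" and x :: "nat \<Rightarrow> bool list" and b :: "nat \<Rightarrow> bool"
  assume "\<forall>l. length (P l) = n_len l \<and> length (x l) = d_len l"
  then have P: "\<And>l. length (P l) = n_len l" and x: "\<And>l. length (x l) = d_len l" by auto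
  have bot: "unit_state (2 ^ n_len l) (bothat l)" for l
    using abort by (simp add: recognizable_abort_def)
  define V where "V l = pmf (bind_pmf (input_dist P x b l) (\<lambda>inp.
      bind_pmf (Tomography T n_len l (Phi Ghat l inp) (L l)) (\<lambda>M. Verify T n_len Ghat bothat L l inp M))) Valid" for l
  define ov where "ov l k = Re (expval (G l k (x l)) (bothat l))" for l k
  define bad where "bad l = measure_pmf.prob (uniform_bits l) {k. 2 / 27 < ov l k}" for l
  define \<delta> where "\<delta> l = (sqrt 3 / 2) ^ l" for l :: nat
  have "sqrt 3 \<le> 2" by (rule real_le_lsqrt) auto
  then have \<delta>: "0 \<le> \<delta> l" "\<delta> l \<le> 1" for l
    unfolding \<delta>_def by (intro zero_le_power power_le_one; simp)+
  \<comment> \<open>A union bound in product form: failure requires an untypically large overlap or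
    an inaccurate result in one of the two tomography runs.\<close>
  have V: "1 - V l \<le> bad l + 2 * \<delta> l" for l
  proof -
    have "measure_pmf.prob (uniform_bits l) {k. \<not> 2 / 27 < ov l k} * (1 - \<delta> l)\<^sup>2 \<le> V l"
      unfolding V_def input_dist_def bind_map_pmf
    proof (rule pmf_bind_ge)
      fix k assume "k \<in> set_pmf (uniform_bits l)" "k \<in> {k. \<not> 2 / 27 < ov l k}"
      then have k: "length k = l" and small: "ov l k \<le> 2 / 27" by (auto simp: set_pmf_uniform_bits)
      note Phi = recognizable_abort_Phi[OF abort k x P, of "b l"]
      show "(1 - \<delta> l)\<^sup>2 \<le> pmf (bind_pmf (Tomography T n_len l (Phi Ghat l (P l, k, x l, b l)) (L l))
          (\<lambda>M. Verify T n_len Ghat bothat L l (P l, k, x l, b l) M)) Valid"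
        unfolding \<delta>_def
        by (rule verify_correct[where n = n_len and l = l and L = L and bothat = bothat, OF tomo Phi(1) L bot order_trans[OF Phi(2) small[unfolded ov_def]]])
    qed simp
    moreover have "measure_pmf.prob (uniform_bits l) {k. \<not> 2 / 27 < ov l k} = 1 - bad l"
      unfolding bad_def by (subst measure_pmf.prob_compl[symmetric]) (auto intro!: arg_cong2[where f = measure])
    ultimately have "(1 - bad l) * (1 - \<delta> l)\<^sup>2 \<le> V l" by simp
    moreover have "(1 - bad l) * (1 - 2 * \<delta> l) \<le> (1 - bad l) * (1 - \<delta> l)\<^sup>2"
      by (intro mult_left_mono) (auto simp: bad_def power2_eq_square algebra_simps)
    moreover have "0 \<le> bad l * (2 * \<delta> l)"
      using \<delta>(1) by (simp add: bad_def)
    ultimately show ?thesis by (simp add: algebra_simps)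
  qed
  have "negligible (\<lambda>l. 1 - V l)"
    unfolding negligible_def
  proof
    fix c :: nat
    \<comment> \<open>The number of copies is the exponent \<open>c\<close> to be beaten: 2^n >= l^3
      already makes the \<open>c\<close>-th Haar moment O(l^(-3c)).\<close>
    have "\<exists>\<epsilon>. negligible \<epsilon> \<and> (\<forall>l. 0 < d_len l \<longrightarrow>
      measure_pmf.expectation (uniform_bits l) (\<lambda>k. Re (expval (G l k (x l)) (bothat l)) ^ c) \<le>
        12 * 2 ^ c * fact (2 * c) / (2 ^ n_len l) ^ c + 4 ^ (n_len l * c) * (2 * \<epsilon> l))"
      by (rule prfs_overlap[OF haar prfs _ x bot]) (use recognizable_abort_density[OF abort] in auto)
    then obtain \<epsilon> where neg: "negligible \<epsilon>"
      and \<epsilon>: "\<And>l. 0 < d_len l \<Longrightarrow> measure_pmf.expectation (uniform_bits l) (\<lambda>k. ov l k ^ c) \<le>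
        12 * 2 ^ c * fact (2 * c) / (2 ^ n_len l) ^ c + 4 ^ (n_len l * c) * (2 * \<epsilon> l)"
      unfolding ov_def by blast
    define A where "A = (12 * 2 ^ c * fact (2 * c) :: real)"
    have A: "0 \<le> A" by (simp add: A_def)
    \<comment> \<open>Pauli inversion costs a factor of order l^(6c), so the exponent 7c leaves
      l^(-c).\<close>
    have "\<epsilon> \<in> O(\<lambda>l. 1 / real l ^ (7 * c))"
      using neg unfolding negligible_def by blast
    then obtain C where C: "0 < C" "eventually (\<lambda>l. norm (\<epsilon> l) \<le> C * norm (1 / real l ^ (7 * c))) at_top"
      by (elim landau_o.bigE) auto
    obtain D where D: "0 < D" "eventually (\<lambda>l. norm (\<delta> l) \<le> D * norm (1 / real l ^ c)) at_top"
      using geometric_bigo[of c] unfolding \<delta>_def[symmetric] by (elim landau_o.bigE) auto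
    \<comment> \<open>Collects the Markov factor (27/2)^c applied to the Haar and security terms,
      and the two tomography failures.\<close>
    define K where "K = (27 / 2) ^ c * (A + 2 * 4 ^ c * C) + 2 * D"
    have "eventually (\<lambda>l. norm (1 - V l) \<le> K * norm (1 / real l ^ c)) at_top"
      using C(2) D(2) eventually_ge_at_top[of 4]
    proof eventually_elim
      case (elim l)
      then have l: "1 \<le> l" and l0: "0 < real l" and dl: "0 < d_len l" using d_len_pos by auto
      let ?E = "measure_pmf.expectation (uniform_bits l) (\<lambda>k. ov l k ^ c)"
      \<comment> \<open>Below the threshold, Markov's inequality needs the \<open>c\<close>-th power
        to be nonnegative, which for odd \<open>c\<close> rests on positivity of the
        overlap.\<close>
      have nonneg: "0 \<le> ov l k" if "k \<in> set_pmf (uniform_bits l)" for k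
      proof -
        have "density_mat (2 ^ n_len l) (G l k (x l))"
          using that x by (intro recognizable_abort_density[OF abort]) (auto simp: set_pmf_uniform_bits)
        then show ?thesis
          using unit_state_carrier[OF bot[of l]] by (auto simp: ov_def density_mat_def psd_mat_def less_eq_complex_def)
      qed
      \<comment> \<open>Markov's inequality for the \<open>c\<close>-th moment.\<close>
      have "(2 / 27) ^ c * bad l = measure_pmf.expectation (uniform_bits l) (\<lambda>k. (2 / 27) ^ c * indicator {k. 2 / 27 < ov l k} k)"
        by (simp add: bad_def)
      also have "\<dots> \<le> ?E"
      proof (rule integral_mono_AE)
        show "AE k in uniform_bits l. (2 / 27) ^ c * indicator {k. 2 / 27 < ov l k} k \<le> ov l k ^ c"
          using nonneg by (auto simp: AE_measure_pmf_iff indicator_def intro!: power_mono)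
      qed (rule integrable_measure_pmf_finite[OF finite_set_pmf_uniform_bits])+
      finally have bad: "bad l \<le> (27 / 2) ^ c * ?E"
        by (simp add: power_divide field_simps)
      have t1: "A / (2 ^ n_len l) ^ c \<le> A / real l ^ c"
      proof -
        have "real l \<le> real l ^ 3" using l by (intro self_le_power) auto
        also note two_power_n_len(1)[OF l]
        finally have "real l ^ c \<le> (2 ^ n_len l) ^ c"
          by (rule power_mono) simp
        then show ?thesis using A l0 by (intro divide_left_mono) auto
      qed
      have t2: "4 ^ (n_len l * c) * (2 * \<epsilon> l) \<le> 2 * 4 ^ c * C / real l ^ c"
      proof -
        have e: "\<epsilon> l \<le> C / real l ^ (7 * c)" using elim(1) by simp
        have "(4 :: real) ^ (n_len l * c) = (2 ^ n_len l) ^ (2 * c)"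
          by (simp add: power_mult power2_eq_square power_mult_distrib[symmetric])
        also have "\<dots> \<le> (2 * real l ^ 3) ^ (2 * c)"
          using two_power_n_len(2)[OF l] by (intro power_mono) auto
        also have "\<dots> = 4 ^ c * real l ^ (6 * c)"
          by (simp add: power_mult_distrib power_mult[symmetric]) (simp add: power_mult)
        finally have f: "(4 :: real) ^ (n_len l * c) \<le> 4 ^ c * real l ^ (6 * c)" .
        have "4 ^ (n_len l * c) * (2 * \<epsilon> l) \<le> 4 ^ (n_len l * c) * (2 * (C / real l ^ (7 * c)))"
          using e by (intro mult_left_mono) auto
        also have "\<dots> \<le> (4 ^ c * real l ^ (6 * c)) * (2 * (C / real l ^ (7 * c)))"
          using f C(1) by (intro mult_right_mono) auto
        also have "real l ^ (7 * c) = real l ^ (6 * c) * real l ^ c"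
          by (simp flip: power_add)
        also have "(4 ^ c * real l ^ (6 * c)) * (2 * (C / (real l ^ (6 * c) * real l ^ c))) = 2 * 4 ^ c * C / real l ^ c"
          using l0 by (simp add: field_simps)
        finally show ?thesis .
      qed
      have "1 - V l \<le> (27 / 2) ^ c * ?E + 2 * \<delta> l"
        using V[of l] bad by linarith
      also have "\<dots> \<le> (27 / 2) ^ c * (A / real l ^ c + 2 * 4 ^ c * C / real l ^ c) + 2 * (D / real l ^ c)"
      proof (intro add_mono mult_left_mono)
        show "?E \<le> A / real l ^ c + 2 * 4 ^ c * C / real l ^ c"
          using \<epsilon>[OF dl] t1 t2 unfolding A_def by linarith
        show "\<delta> l \<le> D / real l ^ c" using elim(2) by simp
      qed auto
      also have "\<dots> = K / real l ^ c"
        by (simp add: K_def add_divide_distrib distrib_left)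
      finally have "1 - V l \<le> K / real l ^ c" .
      moreover have "0 \<le> 1 - V l" by (simp add: V_def pmf_le_1)
      ultimately show "norm (1 - V l) \<le> K * norm (1 / real l ^ c)" by simp
    qed
    then show "(\<lambda>l. 1 - V l) \<in> O(\<lambda>l. 1 / real l ^ c)"
      by (rule bigoI)
  qed
  then show "distributional_same_input_correctness (Phi Ghat) (Tomography T n_len)
      (Verify T n_len Ghat bothat L) L (input_dist P x b)"
    unfolding distributional_same_input_correctness_def
    by (intro exI[of _ "\<lambda>l. 1 - V l"]) (simp add: V_def)
qed

end
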